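(* Let $n\ge1$ and $p>2$. Let $K>0$ and $\alpha>0$ be arbitrary constants, let $\lambda=n(p-2)+p$ and $$h(t)=\frac{|\log(-t)|^{p-2}-1}{p-2}.$$ Then the origin $(0,0)$ is regular with respect to the domain $$\Theta=\biggl\{(x,t)\in\mathbf{R}^{n+1}:-\frac{1}{2e}<t<0\text{ and }\biggl(\frac{|x|}{(-t)^{1/\lambda}}\biggr)^{p/(p-1)}<K(-t)^{n(p-2)/\lambda}h(t)^{\alpha(p-2)}\biggr\}.$$
   Context: Points of $\mathbf{R}^{n+1}$ are written $(x,t)$ with $x\in\mathbf{R}^n$, $t\in\mathbf{R}$; $\nabla$ and $\operatorname{div}$ are taken with respect to $x$ only. The equation considered is $\partial_t u=\Delta_p u:=\operatorname{div}(|\nabla u|^{p-2}\nabla u)$. For an open set $U\subset\mathbf{R}^n$ and $t_1<t_2$ let $U_{t_1,t_2}=U\times(t_1,t_2)$; $D'\Subset D$ means that $\overline{D'}$ is a compact subset of $D$. A function $u$ on $\Theta$ is \emph{$p$-parabolic} if it is a continuous weak solution, i.e. $u$ is continuous and, whenever $U_{t_1,t_2}\Subset\Theta$, one has $u\in L^p(t_1,t_2;W^{1,p}(U))$, $t\mapsto\int_U|u(x,t)|^2\,dx$ is continuous on $[t_1,t_2]$, and $\int_{t_1}^{t_2}\int_U|\nabla u|^{p-2}\nabla u\cdot\nabla\varphi\,dx\,dt-\int_{t_1}^{t_2}\int_U u\,\partial_t\varphi\,dx\,dt=0$ for all $\varphi\in C_0^\infty(U_{t_1,t_2})$. A space-time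 box is $Q_{t_1,t_2}$ with $Q=(a_1,b_1)\times\cdots\times(a_n,b_n)$; its parabolic boundary is $\partial_pQ_{t_1,t_2}=(\overline{Q}\times\{t_1\})\cup(\partial Q\times(t_1,t_2])$. A function $u:\Theta\to(-\infty,\infty]$ is \emph{$p$-superparabolic} if (i) $u$ is lower semicontinuous; (ii) $u$ is finite in a dense subset of $\Theta$; (iii) for each space-time box $Q_{t_1,t_2}\Subset\Theta$: if $h$ is $p$-parabolic in $Q_{t_1,t_2}$, continuous on $\overline{Q}_{t_1,t_2}$ and $h\le u$ on $\partial_pQ_{t_1,t_2}$, then $h\le u$ in $Q_{t_1,t_2}$. For a bounded function $f:\partial\Theta\to\mathbf{R}$, the upper class $\mathcal{U}_f$ is the set of all $p$-superparabolic functions $u$ on $\Theta$ which are bounded below and satisfy $\liminf_{\Theta\ni\eta\to\xi}u(\eta)\ge f(\xi)$ for all $\xi\in\partial\Theta$. The upper Perron solution is $\overline{H}f(\xi)=\inf_{u\in\mathcal{U}_f}u(\xi)$, $\xi\in\Theta$. A point $\xi_0\in\partial\Theta$ is \emph{regular} with respect to $\Theta$ if $\lim_{\Theta\ni\xi\to\xi_0}\overline{H}f(\xi)=f(\xi_0)$ for every continuous $f:\partial\Theta\to\mathbf{R}$. *)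

theory Defs
  imports "HOL-Analysis.Analysis"
begin

text \<open>
  Space is an arbitrary Euclidean space \<open>'a\<close>; a space-time point \<open>(x, t)\<close> is an element of
  \<open>'a \<times> real\<close>. Functions on a set are total functions whose values outside the set are never
  used.
\<close>

definition compactly_contained :: "'a::topological_space set \<Rightarrow> 'a set \<Rightarrow> bool" where
  "compactly_contained D' D \<longleftrightarrow> compact (closure D') \<and> closure D' \<subseteq> D"

text \<open>\<open>C\<^sup>k\<close> on the whole space, by iterating directional derivatives.\<close>

primrec Ck :: "nat \<Rightarrow> ('a::euclidean_space \<Rightarrow> real) \<Rightarrow> bool" where
  "Ck 0 f \<longleftrightarrow> continuous_on UNIV f"
| "Ck (Suc k) f \<longleftrightarrow>
     (\<forall>x. f differentiable at x) \<and> (\<forall>v. Ck k (\<lambda>x. frechet_derivative f (at x) v))"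

text \<open>\<open>C\<^sub>0\<^sup>\<infinity>(\<Omega>)\<close>, each function being extended by zero to the whole space.\<close>

definition test_functions :: "'a::euclidean_space set \<Rightarrow> ('a \<Rightarrow> real) set" where
  "test_functions \<Omega> = {\<phi>. (\<forall>k. Ck k \<phi>) \<and> compactly_contained {x. \<phi> x \<noteq> 0} \<Omega>}"

definition space_gradient ::
    "('a::euclidean_space \<times> real \<Rightarrow> real) \<Rightarrow> 'a \<times> real \<Rightarrow> 'a" where
  "space_gradient \<phi> z = (\<Sum>b\<in>Basis. frechet_derivative \<phi> (at z) (b, 0) *\<^sub>R b)"

definition time_derivative :: "('a::euclidean_space \<times> real \<Rightarrow> real) \<Rightarrow> 'a \<times> real \<Rightarrow> real" where
  "time_derivative \<phi> z = frechet_derivative \<phi> (at z) (0, 1)"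

definition in_Lp ::
    "real \<Rightarrow> 'a::euclidean_space set \<Rightarrow> ('a \<Rightarrow> 'b::euclidean_space) \<Rightarrow> bool" where
  "in_Lp p A f \<longleftrightarrow>
     set_borel_measurable lborel A f \<and> set_integrable lborel A (\<lambda>x. norm (f x) powr p)"

text \<open>\<open>f \<in> W\<^sup>1\<^sup>,\<^sup>p(U)\<close> with distributional gradient \<open>g\<close>.\<close>

definition sobolev_with_gradient ::
    "real \<Rightarrow> 'a::euclidean_space set \<Rightarrow> ('a \<Rightarrow> real) \<Rightarrow> ('a \<Rightarrow> 'a) \<Rightarrow> bool" where
  "sobolev_with_gradient p U f g \<longleftrightarrow> in_Lp p U f \<and> in_Lp p U g \<and>
     (\<forall>\<phi>\<in>test_functions U. \<forall>b\<in>Basis.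
        (LINT x:U|lborel. f x * frechet_derivative \<phi> (at x) b) =
        - (LINT x:U|lborel. (g x \<bullet> b) * \<phi> x))"

text \<open>
  \<open>u \<in> L\<^sup>p(t1, t2; W\<^sup>1\<^sup>,\<^sup>p(U))\<close> with spatial gradient \<open>g\<close>: almost every time slice is a Sobolev
  function, and \<open>|u|\<^sup>p + |g|\<^sup>p\<close> is integrable over \<open>U \<times> (t1, t2)\<close>. The gradient \<open>g\<close> is unique up to
  a null set.
\<close>

definition parabolic_sobolev_with_gradient ::
    "real \<Rightarrow> 'a::euclidean_space set \<Rightarrow> real \<Rightarrow> real \<Rightarrow>
     ('a \<times> real \<Rightarrow> real) \<Rightarrow> ('a \<times> real \<Rightarrow> 'a) \<Rightarrow> bool" where
  "parabolic_sobolev_with_gradient p U t1 t2 u g \<longleftrightarrow>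
     in_Lp p (U \<times> {t1<..<t2}) u \<and> in_Lp p (U \<times> {t1<..<t2}) g \<and>
     (AE t in lborel. t \<in> {t1<..<t2} \<longrightarrow>
        sobolev_with_gradient p U (\<lambda>x. u (x, t)) (\<lambda>x. g (x, t)))"

definition p_parabolic ::
    "real \<Rightarrow> ('a::euclidean_space \<times> real) set \<Rightarrow> ('a \<times> real \<Rightarrow> real) \<Rightarrow> bool" where
  "p_parabolic p \<Theta> u \<longleftrightarrow> continuous_on \<Theta> u \<and>
     (\<forall>U t1 t2. open U \<and> t1 < t2 \<and> compactly_contained (U \<times> {t1<..<t2}) \<Theta> \<longrightarrow>
        continuous_on {t1..t2} (\<lambda>t. LINT x:U|lborel. \<bar>u (x, t)\<bar>\<^sup>2) \<and>
        (\<exists>g. parabolic_sobolev_with_gradient p U t1 t2 u g \<and>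
           (\<forall>\<phi>\<in>test_functions (U \<times> {t1<..<t2}).
              (LINT t:{t1<..<t2}|lborel. LINT x:U|lborel.
                 (norm (g (x, t)) powr (p - 2) *\<^sub>R g (x, t)) \<bullet> space_gradient \<phi> (x, t))
            - (LINT t:{t1<..<t2}|lborel. LINT x:U|lborel.
                 u (x, t) * time_derivative \<phi> (x, t)) = 0)))"

definition parabolic_boundary ::
    "'a::euclidean_space set \<Rightarrow> real \<Rightarrow> real \<Rightarrow> ('a \<times> real) set" where
  "parabolic_boundary Q t1 t2 = closure Q \<times> {t1} \<union> frontier Q \<times> {t1<..t2}"

definition lower_semicontinuous_on :: "'a::topological_space set \<Rightarrow> ('a \<Rightarrow> ereal) \<Rightarrow> bool" where
  "lower_semicontinuous_on S u \<longleftrightarrow> (\<forall>\<xi>\<in>S. u \<xi> \<le> Liminf (at \<xi> within S) u)"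

definition p_superparabolic ::
    "real \<Rightarrow> ('a::euclidean_space \<times> real) set \<Rightarrow> ('a \<times> real \<Rightarrow> ereal) \<Rightarrow> bool" where
  "p_superparabolic p \<Theta> u \<longleftrightarrow>
     (\<forall>\<xi>\<in>\<Theta>. u \<xi> \<noteq> -\<infinity>) \<and>
     lower_semicontinuous_on \<Theta> u \<and>
     \<Theta> \<subseteq> closure {\<xi>\<in>\<Theta>. u \<xi> < \<infinity>} \<and>
     (\<forall>a b t1 t2 h.
        (\<forall>i\<in>Basis. a \<bullet> i < b \<bullet> i) \<and> t1 < t2 \<and>
        compactly_contained (box a b \<times> {t1<..<t2}) \<Theta> \<and>
        p_parabolic p (box a b \<times> {t1<..<t2}) h \<and>
        continuous_on (closure (box a b \<times> {t1<..<t2})) h \<and>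
        (\<forall>\<xi>\<in>parabolic_boundary (box a b) t1 t2. ereal (h \<xi>) \<le> u \<xi>)
        \<longrightarrow> (\<forall>\<xi>\<in>box a b \<times> {t1<..<t2}. ereal (h \<xi>) \<le> u \<xi>))"

definition upper_class ::
    "real \<Rightarrow> ('a::euclidean_space \<times> real) set \<Rightarrow> ('a \<times> real \<Rightarrow> real) \<Rightarrow>
     ('a \<times> real \<Rightarrow> ereal) set" where
  "upper_class p \<Theta> f =
     {u. p_superparabolic p \<Theta> u \<and>
         (\<exists>m::real. \<forall>\<eta>\<in>\<Theta>. ereal m \<le> u \<eta>) \<and>
         (\<forall>\<xi>\<in>frontier \<Theta>. Liminf (at \<xi> within \<Theta>) u \<ge> ereal (f \<xi>))}"

definition upper_perron ::
    "real \<Rightarrow> ('a::euclidean_space \<times> real) set \<Rightarrow> ('a \<times> real \<Rightarrow> real) \<Rightarrow> 'a \<times> real \<Rightarrow> ereal" where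
  "upper_perron p \<Theta> f \<xi> = (INF u\<in>upper_class p \<Theta> f. u \<xi>)"

definition regular_point ::
    "real \<Rightarrow> ('a::euclidean_space \<times> real) set \<Rightarrow> 'a \<times> real \<Rightarrow> bool" where
  "regular_point p \<Theta> \<xi>0 \<longleftrightarrow> \<xi>0 \<in> frontier \<Theta> \<and>
     (\<forall>f. continuous_on (frontier \<Theta>) f \<longrightarrow>
        (upper_perron p \<Theta> f \<longlongrightarrow> ereal (f \<xi>0)) (at \<xi>0 within \<Theta>))"

end

theory Submission
  imports Defs
begin

text \<open>
  Put \<open>q = p/(p-1)\<close>. The functions \<open>b + c t + \<gamma> |x - a|\<^sup>q\<close>, with \<open>c\<close> determined by \<open>\<gamma>\<close>, are exact
  solutions whose flux is linear in \<open>x\<close>. They are the only solutions needed, because the domain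
  lies in a cusp \<open>|x|\<^sup>q \<le> K (-t)\<^sup>\<theta>\<close> with \<open>\<theta> = (1 + \<beta>(p-2))/(p-1)\<close> for some \<open>0 < \<beta> < 1\<close>: there
  \<open>w = 2BK(-t)\<^sup>\<beta> - B(-t)\<^bsup>-(1-\<beta>)/(p-1)\<^esup> |x|\<^sup>q\<close> is positive, tends to \<open>0\<close> at the origin, and is a
  strict supersolution for every large \<open>B\<close>, since for \<open>p > 2\<close> diffusion grows superlinearly with the
  amplitude. Large \<open>B\<close> also makes \<open>w\<close> dominate the boundary data away from the origin.

  The spatial profile of \<open>w\<close> at each time is that of an exact solution, so comparing weak solutions
  with exact solutions (mollify, test with a power of the positive part of the difference, pass to
  the limit by Fatou) shows that \<open>f(0,0) + \<epsilon> + w\<close> belongs to the upper class. Conversely a member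
  of the upper class cannot go below \<open>f(0,0) - 2\<epsilon> - w\<close>: at a negative minimum of the difference
  an exact solution would touch strictly from below, contradicting the comparison property on a
  small box.
\<close>

section \<open>Directional derivatives and integration\<close>

text \<open>The obstacle is that the competitors in the comparison property are weak solutions with
  an L^p gradient only, and mollification does not commute with the nonlinear flux. The mollified
  equation therefore pairs a mollified gradient with a mollified flux; their product has no sign and
  no fixed integrable bound before the limit. Monotonicity of the flux returns only in the limit,
  through a form of Fatou with a lower bound that moves with the radius.

  The exponent of the spatial coefficient in w is chosen so that diffusion, the (p-1)-st power of
  that coefficient, scales like (-t)^(\<beta> - 1), exactly as the time derivative of (-t)^\<beta>.
  The supersolution inequality is thus one inequality between constants, valid up to the tip.

  The two halves differ. Above, an exact solution with the profile of w itself suffices. Below, the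
  touching must leave a gap on the lateral sides of a box, which the same profile cannot give; hence
  a halved coefficient and a shifted centre.\<close>

definition has_dir_deriv :: "('e::euclidean_space \<Rightarrow> real) \<Rightarrow> real \<Rightarrow> 'e \<Rightarrow> 'e \<Rightarrow> bool" where
  "has_dir_deriv f D v z \<longleftrightarrow> ((\<lambda>s. f (z + s *\<^sub>R v)) has_real_derivative D) (at 0)"

lemma has_dir_deriv_line:
  assumes "has_dir_deriv f D v (z + s *\<^sub>R v)"
  shows "((\<lambda>s. f (z + s *\<^sub>R v)) has_real_derivative D) (at s)"
proof -
  have "((\<lambda>r. f (z + s *\<^sub>R v + r *\<^sub>R v)) has_real_derivative D) (at (s + - s))"
    using assms by (simp add: has_dir_deriv_def)
  then have "((\<lambda>r. f (z + s *\<^sub>R v + (r + - s) *\<^sub>R v)) has_real_derivative D) (at s)"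
    using DERIV_shift[of "\<lambda>r. f (z + s *\<^sub>R v + r *\<^sub>R v)" D s "- s"] by simp
  then show ?thesis
    by (simp add: algebra_simps)
qed

lemma frechet_imp_dir_deriv:
  fixes f :: "'e::euclidean_space \<Rightarrow> real"
  assumes "(f has_derivative f') (at z)"
  shows "has_dir_deriv f (f' v) v z"
proof -
  have "(f has_derivative f') (at (z + 0 *\<^sub>R v))"
    using assms by simp
  moreover have "((\<lambda>s::real. z + s *\<^sub>R v) has_derivative (\<lambda>s. s *\<^sub>R v)) (at 0)"
    by (auto intro!: derivative_eq_intros)
  ultimately have "((\<lambda>s. f (z + s *\<^sub>R v)) has_derivative (\<lambda>s. f' (s *\<^sub>R v))) (at 0)"
    using has_derivative_compose[of "\<lambda>s. z + s *\<^sub>R v" "\<lambda>s. s *\<^sub>R v" 0 UNIV f f'] by simp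
  moreover have "f' (s *\<^sub>R v) = f' v * s" for s
    using has_derivative_bounded_linear[OF assms]
    by (simp add: linear_simps)
  ultimately show ?thesis
    by (simp add: has_dir_deriv_def has_field_derivative_def fun_eq_iff)
qed

lemma dir_deriv_frechet:
  fixes f :: "'e::euclidean_space \<Rightarrow> real"
  assumes "f differentiable at z"
  shows "has_dir_deriv f (frechet_derivative f (at z) v) v z"
  using frechet_imp_dir_deriv frechet_derivative_works assms by blast

lemma has_dir_deriv_mult:
  "has_dir_deriv f D v z \<Longrightarrow> has_dir_deriv g E v z \<Longrightarrow>
    has_dir_deriv (\<lambda>x. f x * g x) (D * g z + f z * E) v z"
  unfolding has_dir_deriv_def by (auto intro!: derivative_eq_intros)

lemma has_dir_deriv_diff:
  "has_dir_deriv f D v z \<Longrightarrow> has_dir_deriv g E v z \<Longrightarrow>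
    has_dir_deriv (\<lambda>x. f x - g x) (D - E) v z"
  unfolding has_dir_deriv_def by (auto intro!: derivative_eq_intros)

lemma has_dir_deriv_chain:
  assumes "has_dir_deriv f D v z" "(\<psi> has_real_derivative E) (at (f z))"
  shows "has_dir_deriv (\<lambda>x. \<psi> (f x)) (E * D) v z"
  using assms DERIV_chain2[of \<psi> E "\<lambda>s. f (z + s *\<^sub>R v)" 0 D UNIV]
  unfolding has_dir_deriv_def by simp

lemma has_dir_deriv_cong_open:
  assumes "has_dir_deriv f D v z" "open S" "z \<in> S" "\<And>x. x \<in> S \<Longrightarrow> f x = g x"
  shows "has_dir_deriv g D v z"
proof -
  have "isCont (\<lambda>s::real. z + s *\<^sub>R v) 0"
    by (intro continuous_intros)
  then have "\<forall>\<^sub>F s in at 0. z + s *\<^sub>R v \<in> S"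
    using assms(2,3) unfolding isCont_def by (intro topological_tendstoD) auto
  then have "\<forall>\<^sub>F s in at 0. f (z + s *\<^sub>R v) = g (z + s *\<^sub>R v)"
    by eventually_elim (use assms(4) in auto)
  then have "\<forall>\<^sub>F s in nhds 0. f (z + s *\<^sub>R v) = g (z + s *\<^sub>R v)"
    using assms(3,4) by (auto simp: eventually_at_filter elim: eventually_mono)
  then show ?thesis
    using assms(1) unfolding has_dir_deriv_def by (subst (asm) DERIV_cong_ev) auto
qed

lemma LIMSEQ_1_over_Suc: "(\<lambda>n. 1 / real (Suc n)) \<longlonglongrightarrow> 0"
  using LIMSEQ_inverse_real_of_nat by (simp add: inverse_eq_divide)

section \<open>Invariance of Lebesgue integrals under translation and reflection\<close>

lemma lborel_integrable_shift:
  fixes f :: "'e::euclidean_space \<Rightarrow> 'b::{banach, second_countable_topology}"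
  assumes "integrable lborel f"
  shows "integrable lborel (\<lambda>x. f (x + c))"
proof -
  have "integrable (distr lborel borel ((+) c)) f"
    using assms by (simp add: lborel_distr_plus)
  then show ?thesis
    by (subst (asm) integrable_distr_eq) (auto simp: add.commute intro: borel_measurable_integrable[OF assms, simplified])
qed

lemma lborel_integral_shift:
  fixes f :: "'e::euclidean_space \<Rightarrow> 'b::{banach, second_countable_topology}"
  assumes "f \<in> borel_measurable borel"
  shows "(LBINT x. f (x + c)) = (LBINT x. f x)"
proof -
  have "(LBINT x. f x) = (\<integral>x. f x \<partial>distr lborel borel ((+) c))"
    by (simp add: lborel_distr_plus)
  also have "\<dots> = (LBINT x. f (c + x))"
    using assms by (intro integral_distr) auto
  finally show ?thesis
    by (simp add: add.commute)
qed

lemma lborel_distr_reflect: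
  "distr lborel borel (\<lambda>x. t - x) = (lborel :: 'e::euclidean_space measure)"
  by (subst lborel_affine[of "-1" t], auto simp: density_1)

lemma lborel_integral_reflect:
  fixes f :: "'e::euclidean_space \<Rightarrow> 'b::{banach, second_countable_topology}"
  assumes "f \<in> borel_measurable borel"
  shows "(LBINT x. f (t - x)) = (LBINT x. f x)"
proof -
  have "(LBINT x. f x) = (\<integral>x. f x \<partial>distr lborel borel (\<lambda>x. t - x))"
    by (simp add: lborel_distr_reflect)
  also have "\<dots> = (LBINT x. f (t - x))"
    using assms by (intro integral_distr) auto
  finally show ?thesis ..
qed

lemma lborel_integrable_reflect:
  fixes f :: "'e::euclidean_space \<Rightarrow> 'b::{banach, second_countable_topology}"
  assumes "integrable lborel f"
  shows "integrable lborel (\<lambda>x. f (t - x))"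
proof -
  have "integrable (distr lborel borel (\<lambda>x. t - x)) f"
    using assms by (simp add: lborel_distr_reflect)
  then show ?thesis
    by (subst (asm) integrable_distr_eq) (auto intro: borel_measurable_integrable[OF assms, simplified])
qed

lemma integrable_bounded_support:
  fixes f :: "'e::euclidean_space \<Rightarrow> 'b::{banach, second_countable_topology}"
  assumes "f \<in> borel_measurable borel" "bounded S" "\<And>x. x \<notin> S \<Longrightarrow> f x = 0" "\<And>x. norm (f x) \<le> M"
  shows "integrable lborel f"
proof -
  obtain a where a: "S \<subseteq> cbox (- a) a"
    using assms(2) bounded_subset_cbox_symmetric by blast
  show ?thesis
  proof (rule Bochner_Integration.integrable_bound)
    show "integrable lborel (\<lambda>x. indicator (cbox (- a) a) x *\<^sub>R M :: real)"
      by (intro integrable_scaleR_left integrable_real_indicator emeasure_bounded_finite) auto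
    show "AE x in lborel. norm (f x) \<le> norm (indicator (cbox (- a) a) x *\<^sub>R M)"
      using assms(3,4) a by (auto intro!: AE_I2 simp: indicator_def) (smt (verit, best) assms(4))+
  qed (use assms in auto)
qed

text \<open>
  By translation invariance the difference quotients of \<open>P\<close> have integral zero; no Fubini
  argument and no continuity of the derivative is needed.
\<close>

lemma integral_dir_deriv_eq_0:
  fixes P P' :: "'e::euclidean_space \<Rightarrow> real"
  assumes meas: "P \<in> borel_measurable borel" and S: "bounded S" "\<And>x. x \<notin> S \<Longrightarrow> P x = 0"
    and bd: "\<And>x. \<bar>P x\<bar> \<le> M" and der: "\<And>z. has_dir_deriv P (P' z) v z"
    and bd': "\<And>z. \<bar>P' z\<bar> \<le> M'"
  shows "integrable lborel P'" "integral\<^sup>L lborel P' = 0"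
proof -
  define Q where "Q = (\<lambda>k::nat. \<lambda>x. real (Suc k) * (P (x + (1 / real (Suc k)) *\<^sub>R v) - P x))"
  have intP: "integrable lborel P"
    using integrable_bounded_support[OF meas S] bd by auto
  have intQ: "integral\<^sup>L lborel (Q k) = 0" for k
    unfolding Q_def
    using lborel_integrable_shift[OF intP] lborel_integral_shift[OF meas] intP by simp
  obtain R where R: "\<And>x. x \<in> S \<Longrightarrow> norm x \<le> R"
    using S(1) bounded_iff by blast
  \<comment> \<open>All steps \<open>1 / real (Suc k)\<close> are at most 1, so every difference
    quotient is supported in one ball, which carries the dominating function.\<close>
  have Q0: "Q k x = 0" if "x \<notin> cball 0 (R + norm v)" for k x
  proof -
    have 1: "norm x > R + norm v" using that by simp
    have "norm ((1 / real (Suc k)) *\<^sub>R v) \<le> norm v"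
      by (simp add: field_simps)
    then have "norm (x + (1 / real (Suc k)) *\<^sub>R v) > R"
      using 1 norm_triangle_ineq4[of "x + (1 / real (Suc k)) *\<^sub>R v" "(1 / real (Suc k)) *\<^sub>R v"]
      by (simp add: add_diff_cancel)
    then have "x + (1 / real (Suc k)) *\<^sub>R v \<notin> S" using R by force
    moreover have "x \<notin> S" using R 1 by (smt (verit) norm_ge_zero)
    ultimately show ?thesis using S(2) by (simp add: Q_def)
  qed
  \<comment> \<open>By the mean value theorem a quotient is a value of P' on the segment, so the
    bound M' passes to all quotients.\<close>
  have Qb: "\<bar>Q k x\<bar> \<le> M'" for k x
  proof -
    obtain s where "P (x + (1 / real (Suc k)) *\<^sub>R v) - P (x + 0 *\<^sub>R v) = (1 / real (Suc k) - 0) * P' (x + s *\<^sub>R v)"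
      using MVT2[of 0 "1 / real (Suc k)" "\<lambda>s. P (x + s *\<^sub>R v)" "\<lambda>s. P' (x + s *\<^sub>R v)"]
        has_dir_deriv_line[OF der] by auto
    then have "Q k x = P' (x + s *\<^sub>R v)" by (simp add: Q_def)
    then show ?thesis using bd' by simp
  qed
  have lim: "(\<lambda>k. Q k x) \<longlonglongrightarrow> P' x" for x
  proof -
    have "((\<lambda>s. (P (x + s *\<^sub>R v) - P x) / s) \<longlongrightarrow> P' x) (at 0)"
      using der[of x] by (simp add: has_dir_deriv_def DERIV_def)
    moreover have "(\<lambda>k. 1 / real (Suc k)) \<longlonglongrightarrow> 0"
      by (rule LIMSEQ_1_over_Suc)
    then have "filterlim (\<lambda>k. 1 / real (Suc k)) (at 0) sequentially"
      by (auto simp: filterlim_at)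
    ultimately have "(\<lambda>k. (P (x + (1 / real (Suc k)) *\<^sub>R v) - P x) / (1 / real (Suc k))) \<longlonglongrightarrow> P' x"
      by (rule filterlim_compose)
    then show ?thesis by (simp add: Q_def mult.commute)
  qed
  have Qm [measurable]: "Q k \<in> borel_measurable borel" for k
    unfolding Q_def using meas by measurable
  have [measurable]: "P' \<in> borel_measurable borel"
    by (rule borel_measurable_LIMSEQ_real[OF lim Qm])
  have w: "integrable lborel (\<lambda>x. indicator (cball 0 (R + norm v)) x *\<^sub>R M' :: real)"
    by (intro integrable_scaleR_left integrable_real_indicator emeasure_bounded_finite) auto
  have dom: "AE x in lborel. norm (Q k x) \<le> indicator (cball 0 (R + norm v)) x *\<^sub>R M'" for k
    using Qb Q0 by (intro AE_I2) (auto simp: indicator_def)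
  have lim': "AE x in lborel. (\<lambda>k. Q k x) \<longlonglongrightarrow> P' x"
    using lim by simp
  have "integrable lborel P'"
    by (rule integrable_dominated_convergence[OF _ _ w lim' dom]) simp_all
  moreover have "(\<lambda>k. integral\<^sup>L lborel (Q k)) \<longlonglongrightarrow> integral\<^sup>L lborel P'"
    by (rule integral_dominated_convergence[OF _ _ w lim' dom]) simp_all
  ultimately show "integrable lborel P'" "integral\<^sup>L lborel P' = 0"
    using intQ by (auto simp: LIMSEQ_const_iff)
qed

section \<open>A smooth bump function\<close>

text \<open>The standard function exp(-1/r), flat at 0, times a polynomial in 1/r. Carrying the
  polynomial as a parameter makes the family closed under differentiation.\<close>

definition flat :: "real poly \<Rightarrow> real \<Rightarrow> real" where
  "flat P r = (if r > 0 then poly P (1 / r) * exp (- (1 / r)) else 0)"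

lemma power_poly_div_exp_tendsto_0:
  "((\<lambda>y. y ^ k * poly P y / exp y) \<longlongrightarrow> (0::real)) at_top"
proof (induction P arbitrary: k)
  case 0
  then show ?case by simp
next
  case (pCons a P)
  have "((\<lambda>y. a * (y ^ k / exp y) + y ^ Suc k * poly P y / exp y) \<longlongrightarrow> a * 0 + 0) at_top"
    by (intro tendsto_intros tendsto_power_div_exp_0 pCons.IH)
  moreover have "(\<lambda>y. a * (y ^ k / exp y) + y ^ Suc k * poly P y / exp y) =
      (\<lambda>y. y ^ k * poly (pCons a P) y / exp y)"
    by (auto simp: fun_eq_iff field_simps)
  ultimately show ?case by simp
qed

text \<open>In the variable y = 1/r one has d/dr = -y^2 d/dy, which turns P(y) e^(-y) into y^2 (P -
  P')(y) e^(-y); \<open>[:0, 0, 1:]\<close> is y^2. At r = 0 the difference quotient from the right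
  is y P(y) e^(-y), which tends to 0.\<close>

lemma flat_deriv:
  "(flat P has_real_derivative flat ([:0, 0, 1:] * (P - pderiv P)) r) (at r)"
proof -
  consider "r > 0" | "r < 0" | "r = 0" by linarith
  then show ?thesis
  proof cases
    case 1
    have "((\<lambda>r. poly P (1 / r) * exp (- (1 / r))) has_real_derivative
        flat ([:0, 0, 1:] * (P - pderiv P)) r) (at r)"
      using 1
      by (auto intro!: derivative_eq_intros DERIV_chain2[OF poly_DERIV]
          simp: flat_def field_simps power2_eq_square)
    then show ?thesis
      by (rule has_field_derivative_transform_within_open[of _ _ _ "{0<..}"])
        (use 1 in \<open>auto simp: flat_def\<close>)
  next
    case 2
    have "((\<lambda>r. 0) has_real_derivative flat ([:0, 0, 1:] * (P - pderiv P)) r) (at r)"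
      using 2 by (simp add: flat_def)
    then show ?thesis
      by (rule has_field_derivative_transform_within_open[of _ _ _ "{..<0}"])
        (use 2 in \<open>auto simp: flat_def\<close>)
  next
    case 3
    have "((\<lambda>y. y ^ 1 * poly P y / exp y) \<longlongrightarrow> 0) at_top"
      by (rule power_poly_div_exp_tendsto_0)
    moreover have "\<forall>\<^sub>F y in at_top. y ^ 1 * poly P y / exp y = flat P (inverse y) / inverse y"
      using eventually_gt_at_top[of "0::real"]
      by eventually_elim (auto simp: flat_def field_simps exp_minus)
    ultimately have "((\<lambda>s. flat P s / s) \<longlongrightarrow> 0) (at_right 0)"
      unfolding filterlim_at_right_to_top by (rule Lim_transform_eventually)
    moreover have "((\<lambda>s. flat P s / s) \<longlongrightarrow> 0) (at_left 0)"
    proof (rule Lim_transform_eventually)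
      show "\<forall>\<^sub>F s in at_left 0. 0 = flat P s / s"
        by (auto simp: eventually_at_filter flat_def)
    qed simp
    ultimately have "((\<lambda>s. flat P s / s) \<longlongrightarrow> 0) (at 0)"
      by (simp add: filterlim_at_split)
    then show ?thesis
      using 3 by (simp add: DERIV_def flat_def)
  qed
qed

lemma continuous_flat: "continuous_on S (flat P)"
  using flat_deriv DERIV_isCont continuous_at_imp_continuous_on by blast

text \<open>A class closed under all directional derivatives: its members are then \<open>Ck\<close>
  for every k by one induction, with no product or chain rule for \<open>Ck\<close>. The offset
  \<tau> is free, possibly negative, because a time slice of a space-time bump is again of this
  form, with the offset reduced by the square of the time distance.\<close>

inductive smooth_alg :: "('e::euclidean_space \<Rightarrow> real) \<Rightarrow> bool" where
  const: "smooth_alg (\<lambda>x. c)"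
| inner: "smooth_alg (\<lambda>x. x \<bullet> u)"
| flat: "smooth_alg (\<lambda>x. flat P (\<tau> - (norm (x - z))\<^sup>2))"
| add: "smooth_alg f \<Longrightarrow> smooth_alg g \<Longrightarrow> smooth_alg (\<lambda>x. f x + g x)"
| mult: "smooth_alg f \<Longrightarrow> smooth_alg g \<Longrightarrow> smooth_alg (\<lambda>x. f x * g x)"

lemma flat_ball_derivative:
  fixes z :: "'e::euclidean_space"
  shows "((\<lambda>x. flat P (\<tau> - (norm (x - z))\<^sup>2)) has_derivative
    (\<lambda>v. flat ([:0, 0, 1:] * (P - pderiv P)) (\<tau> - (norm (x - z))\<^sup>2) * (- 2 * ((x - z) \<bullet> v)))) (at x)"
proof -
  have 1: "((\<lambda>x. \<tau> - (norm (x - z))\<^sup>2) has_derivative (\<lambda>v. - 2 * ((x - z) \<bullet> v))) (at x)"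
    unfolding power2_norm_eq_inner
    by (auto intro!: derivative_eq_intros simp: inner_commute)
  have 2: "(flat P has_derivative (\<lambda>h. flat ([:0, 0, 1:] * (P - pderiv P)) (\<tau> - (norm (x - z))\<^sup>2) * h))
      (at (\<tau> - (norm (x - z))\<^sup>2))"
    using flat_deriv by (simp add: has_field_derivative_def)
  show ?thesis
    using has_derivative_compose[OF 1 2] .
qed

lemma smooth_alg_derivative:
  assumes "smooth_alg f"
  shows "\<exists>f'. (\<forall>x. (f has_derivative f' x) (at x)) \<and> (\<forall>v. smooth_alg (\<lambda>x. f' x v))"
  using assms
proof induction
  case (const c)
  then show ?case
    by (intro exI[of _ "\<lambda>x v. 0"]) (auto intro: smooth_alg.const)
next
  case (inner u)
  then show ?case
    by (intro exI[of _ "\<lambda>x v. v \<bullet> u"]) (auto intro!: smooth_alg.const derivative_eq_intros)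
next
  case (flat P \<tau> z)
  have "smooth_alg (\<lambda>x. flat ([:0, 0, 1:] * (P - pderiv P)) (\<tau> - (norm (x - z))\<^sup>2) *
      ((- 2) * (x \<bullet> v + - (z \<bullet> v))))" for v
    by (intro smooth_alg.intros)
  then show ?case
    by (intro exI[of _ "\<lambda>x v. flat ([:0, 0, 1:] * (P - pderiv P)) (\<tau> - (norm (x - z))\<^sup>2) * (- 2 * ((x - z) \<bullet> v))"]
        conjI allI flat_ball_derivative) (simp add: inner_diff_left)
next
  case (add f g)
  then obtain f' g' where f': "\<And>x. (f has_derivative f' x) (at x)" "\<And>v. smooth_alg (\<lambda>x. f' x v)"
    and g': "\<And>x. (g has_derivative g' x) (at x)" "\<And>v. smooth_alg (\<lambda>x. g' x v)" by blast
  show ?case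
    by (intro exI[of _ "\<lambda>x v. f' x v + g' x v"] conjI allI
        has_derivative_add f' g' smooth_alg.add[OF f'(2) g'(2)])
next
  case (mult f g)
  then obtain f' g' where f': "\<And>x. (f has_derivative f' x) (at x)" "\<And>v. smooth_alg (\<lambda>x. f' x v)"
    and g': "\<And>x. (g has_derivative g' x) (at x)" "\<And>v. smooth_alg (\<lambda>x. g' x v)" by blast
  show ?case
    by (intro exI[of _ "\<lambda>x v. f x * g' x v + f' x v * g x"] conjI allI has_derivative_mult f' g'
        smooth_alg.add[OF smooth_alg.mult[OF mult.hyps(1) g'(2)] smooth_alg.mult[OF f'(2) mult.hyps(2)]])
qed

lemma smooth_alg_imp_Ck: "smooth_alg f \<Longrightarrow> Ck k f"
proof (induction k arbitrary: f)
  case 0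
  then obtain f' where "\<forall>x. (f has_derivative f' x) (at x)"
    using smooth_alg_derivative by blast
  then have "\<forall>x. isCont f x"
    using has_derivative_continuous by blast
  then show ?case
    by (simp add: continuous_at_imp_continuous_on)
next
  case (Suc k)
  obtain f' where f': "\<And>x. (f has_derivative f' x) (at x)" "\<And>v. smooth_alg (\<lambda>x. f' x v)"
    using smooth_alg_derivative[OF Suc.prems] by blast
  have eq: "frechet_derivative f (at x) = f' x" for x
    using frechet_derivative_at[OF f'(1)] by simp
  have "f differentiable at x" for x
    using f'(1) by (auto simp: differentiable_def)
  moreover have "Ck k (\<lambda>x. f' x v)" for v
    using Suc.IH f'(2) by blast
  ultimately show ?case
    by (simp add: eq)
qed

section \<open>The standard mollifier on an arbitrary Euclidean space\<close>

definition bump_mass :: "real \<Rightarrow> 'e::euclidean_space itself \<Rightarrow> real" where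
  "bump_mass \<rho> T = (LBINT y. flat 1 (\<rho>\<^sup>2 - (norm (y::'e))\<^sup>2))"

definition mollifier :: "real \<Rightarrow> 'e::euclidean_space \<Rightarrow> real" where
  "mollifier \<rho> y = flat 1 (\<rho>\<^sup>2 - (norm y)\<^sup>2) / bump_mass \<rho> TYPE('e)"

text \<open>The chain rule applied to \<open>mollifier\<close>: \<open>[:0, 0, 1:]\<close> is the
  polynomial that \<open>flat_deriv\<close> produces from 1.\<close>

definition mollifier_deriv :: "real \<Rightarrow> 'e::euclidean_space \<Rightarrow> 'e \<Rightarrow> real" where
  "mollifier_deriv \<rho> v y =
     - (2 * (y \<bullet> v) * flat [:0, 0, 1:] (\<rho>\<^sup>2 - (norm y)\<^sup>2)) / bump_mass \<rho> TYPE('e)"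

lemma flat_nonneg: "flat 1 r \<ge> 0" and flat_le_1: "flat 1 r \<le> 1"
  by (auto simp: flat_def)

lemma flat_ball_eq_0: "\<rho> \<ge> 0 \<Longrightarrow> norm y \<ge> \<rho> \<Longrightarrow> flat P (\<rho>\<^sup>2 - (norm y)\<^sup>2) = 0"
  by (metis diff_gt_0_iff_gt flat_def not_less power_mono)

lemma continuous_flat_ball: "continuous_on S (\<lambda>y. flat P (\<rho>\<^sup>2 - (norm y)\<^sup>2))"
proof (rule continuous_on_compose2[OF continuous_flat[of UNIV P]])
  show "continuous_on S (\<lambda>y. \<rho>\<^sup>2 - (norm y)\<^sup>2)"
    by (intro continuous_intros)
qed simp

lemma flat_ball_measurable [measurable]:
  "(\<lambda>y::'e::euclidean_space. flat P (\<rho>\<^sup>2 - (norm y)\<^sup>2)) \<in> borel_measurable borel"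
  by (intro borel_measurable_continuous_onI continuous_flat_ball)

lemma flat_ball_bounded:
  assumes "\<rho> \<ge> 0"
  obtains M where "\<And>y::'e::euclidean_space. \<bar>flat P (\<rho>\<^sup>2 - (norm y)\<^sup>2)\<bar> \<le> M"
proof -
  have "compact ((\<lambda>y::'e. flat P (\<rho>\<^sup>2 - (norm y)\<^sup>2)) ` cball 0 \<rho>)"
    by (intro compact_continuous_image continuous_flat_ball) auto
  then have "bounded ((\<lambda>y::'e. flat P (\<rho>\<^sup>2 - (norm y)\<^sup>2)) ` cball 0 \<rho>)"
    by (rule compact_imp_bounded)
  then obtain M where M: "\<And>y::'e. y \<in> cball 0 \<rho> \<Longrightarrow> \<bar>flat P (\<rho>\<^sup>2 - (norm y)\<^sup>2)\<bar> \<le> M"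
    by (metis (no_types, lifting) bounded_iff imageI real_norm_def)
  have "\<bar>flat P (\<rho>\<^sup>2 - (norm y)\<^sup>2)\<bar> \<le> \<bar>M\<bar>" for y :: 'e
    using M[of y] flat_ball_eq_0[OF assms, of y P] by (cases "norm y \<le> \<rho>") auto
  then show ?thesis using that by blast
qed

lemma flat_ball_integrable:
  assumes "\<rho> \<ge> 0"
  shows "integrable lborel (\<lambda>y::'e::euclidean_space. flat 1 (\<rho>\<^sup>2 - (norm y)\<^sup>2))"
  by (rule integrable_bounded_support[of _ "cball 0 \<rho>" 1])
    (use assms in \<open>auto simp: flat_nonneg flat_le_1 not_le intro!: flat_ball_eq_0\<close>)

lemma bump_mass_pos:
  assumes "\<rho> > 0"
  shows "bump_mass \<rho> TYPE('e::euclidean_space) > 0"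
proof -
  \<comment> \<open>On the ball of radius \<rho>/2 the argument of \<open>flat\<close> is at least
    3\<rho>^2/4, so the bump is at least e there.\<close>
  define e where "e = exp (- (1 / (3 * \<rho>\<^sup>2 / 4)))"
  have "e * indicator (ball 0 (\<rho> / 2)) y \<le> flat 1 (\<rho>\<^sup>2 - (norm y)\<^sup>2)" for y :: 'e
  proof (cases "y \<in> ball 0 (\<rho> / 2)")
    case True
    then have "(norm y)\<^sup>2 \<le> (\<rho> / 2)\<^sup>2"
      by (intro power_mono) auto
    then have 1: "\<rho>\<^sup>2 - (norm y)\<^sup>2 \<ge> 3 * \<rho>\<^sup>2 / 4"
      by (simp add: power_divide)
    moreover have 2: "3 * \<rho>\<^sup>2 / 4 > 0" using assms by simp
    ultimately have "1 / (\<rho>\<^sup>2 - (norm y)\<^sup>2) \<le> 1 / (3 * \<rho>\<^sup>2 / 4)"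
      by (intro divide_left_mono mult_pos_pos less_le_trans[OF 2 1]) auto
    then show ?thesis
      using less_le_trans[OF 2 1] True unfolding flat_def e_def by simp
  qed (simp add: flat_nonneg)
  then have "(LBINT y. e * indicator (ball 0 (\<rho> / 2)) (y::'e)) \<le> bump_mass \<rho> TYPE('e)"
    unfolding bump_mass_def using flat_ball_integrable[of \<rho>] assms
    by (intro integral_mono integrable_mult_right integrable_real_indicator emeasure_bounded_finite) auto
  moreover have "(LBINT y. e * indicator (ball 0 (\<rho> / 2)) (y::'e)) > 0"
    using assms content_ball_pos[of "\<rho> / 2" "0::'e"] by (simp add: e_def)
  ultimately show ?thesis by linarith
qed

context
  fixes \<rho> :: real
  assumes \<rho>: "\<rho> > 0"
begin

lemma mollifier_nonneg: "mollifier \<rho> (y::'e::euclidean_space) \<ge> 0"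
  using bump_mass_pos[OF \<rho>, where 'e='e] by (simp add: mollifier_def flat_nonneg)

lemma mollifier_eq_0: "norm y \<ge> \<rho> \<Longrightarrow> mollifier \<rho> y = 0"
  using \<rho> by (simp add: mollifier_def flat_ball_eq_0)

lemma mollifier_deriv_eq_0: "norm y \<ge> \<rho> \<Longrightarrow> mollifier_deriv \<rho> v y = 0"
  using \<rho> by (simp add: mollifier_deriv_def flat_ball_eq_0)

lemma mollifier_integrable: "integrable lborel (mollifier \<rho> :: 'e::euclidean_space \<Rightarrow> real)"
  unfolding mollifier_def using \<rho> by (intro integrable_divide_zero impI flat_ball_integrable) simp

lemma mollifier_integral: "(LBINT y. mollifier \<rho> (y::'e::euclidean_space)) = 1"
  unfolding mollifier_def using bump_mass_pos[OF \<rho>, where 'e='e] by (simp add: bump_mass_def)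

lemma mollifier_bounded:
  "mollifier \<rho> (y::'e::euclidean_space) \<le> 1 / bump_mass \<rho> TYPE('e)"
  using bump_mass_pos[OF \<rho>, where 'e='e]
  by (auto simp: mollifier_def flat_le_1 intro!: divide_right_mono)

lemma mollifier_deriv_bounded:
  obtains M where "\<And>y::'e::euclidean_space. \<bar>mollifier_deriv \<rho> v y\<bar> \<le> M"
proof -
  obtain M where M: "\<And>y::'e. \<bar>flat [:0, 0, 1:] (\<rho>\<^sup>2 - (norm y)\<^sup>2)\<bar> \<le> M"
    using flat_ball_bounded[of \<rho>] \<rho> by (meson less_imp_le)
  have M0: "M \<ge> 0" using M[of 0] by linarith
  have "\<bar>mollifier_deriv \<rho> v y\<bar> \<le> 2 * (\<rho> * norm v) * M / bump_mass \<rho> TYPE('e)" for y :: 'e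
  proof (cases "norm y \<ge> \<rho>")
    case True
    then show ?thesis
      using mollifier_deriv_eq_0[OF True] M0 \<rho> bump_mass_pos[OF \<rho>, where 'e='e] by simp
  next
    case False
    have "\<bar>y \<bullet> v\<bar> \<le> norm y * norm v" by (rule Cauchy_Schwarz_ineq2)
    also have "\<dots> \<le> \<rho> * norm v" using False by (intro mult_right_mono) auto
    finally have "\<bar>2 * (y \<bullet> v) * flat [:0, 0, 1:] (\<rho>\<^sup>2 - (norm y)\<^sup>2)\<bar> \<le> 2 * (\<rho> * norm v) * M"
      using M[of y] unfolding abs_mult by (intro mult_mono) auto
    then show ?thesis
      using bump_mass_pos[OF \<rho>, where 'e='e]
      by (simp add: mollifier_deriv_def abs_divide divide_right_mono)
  qed
  then show ?thesis using that by blast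
qed

end

lemma mollifier_measurable [measurable]:
  "(mollifier \<rho> :: 'e::euclidean_space \<Rightarrow> real) \<in> borel_measurable borel"
  "(mollifier_deriv \<rho> v :: 'e::euclidean_space \<Rightarrow> real) \<in> borel_measurable borel"
  unfolding mollifier_def mollifier_deriv_def by measurable

lemma mollifier_has_derivative:
  fixes z :: "'e::euclidean_space"
  shows "((\<lambda>y. mollifier \<rho> (z - y)) has_derivative (\<lambda>v. - mollifier_deriv \<rho> v (z - y))) (at y)"
proof -
  have "((\<lambda>y. flat 1 (\<rho>\<^sup>2 - (norm (y - z))\<^sup>2) / bump_mass \<rho> TYPE('e)) has_derivative
    (\<lambda>v. flat ([:0, 0, 1:] * (1 - pderiv 1)) (\<rho>\<^sup>2 - (norm (y - z))\<^sup>2) * (- 2 * ((y - z) \<bullet> v)) / bump_mass \<rho> TYPE('e))) (at y)"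
    using has_derivative_mult_right[OF flat_ball_derivative[of 1 "\<rho>\<^sup>2" z y], of "1 / bump_mass \<rho> TYPE('e)"]
    by (simp add: field_simps)
  moreover have "flat ([:0, 0, 1:] * (1 - pderiv 1)) (\<rho>\<^sup>2 - (norm (y - z))\<^sup>2) * (- 2 * ((y - z) \<bullet> v)) / bump_mass \<rho> TYPE('e)
     = - mollifier_deriv \<rho> v (z - y)" for v
    by (simp add: mollifier_deriv_def norm_minus_commute inner_diff_left pderiv_1 algebra_simps diff_divide_distrib)
  ultimately show ?thesis
    by (simp add: mollifier_def norm_minus_commute)
qed

lemma mollifier_dir_deriv:
  fixes y :: "'e::euclidean_space"
  shows "has_dir_deriv (mollifier \<rho>) (mollifier_deriv \<rho> v y) v y"
proof -
  have "((\<lambda>y. mollifier \<rho> (0 - y)) has_derivative (\<lambda>v. - mollifier_deriv \<rho> v (0 - y))) (at y)"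
    by (rule mollifier_has_derivative)
  moreover have "(\<lambda>y::'e. mollifier \<rho> (0 - y)) = mollifier \<rho>"
    by (simp add: mollifier_def fun_eq_iff)
  moreover have "(\<lambda>v. - mollifier_deriv \<rho> v (0 - y)) = (\<lambda>v. mollifier_deriv \<rho> v y)"
    by (simp add: mollifier_deriv_def fun_eq_iff)
  ultimately have "(mollifier \<rho> has_derivative (\<lambda>v. mollifier_deriv \<rho> v y)) (at y)"
    by (simp only:)
  then show ?thesis
    by (rule frechet_imp_dir_deriv)
qed

lemma mollifier_test_function:
  assumes "\<rho> > 0" "cball z \<rho> \<subseteq> D"
  shows "(\<lambda>y. mollifier \<rho> (z - y)) \<in> test_functions D"
proof -
  have "smooth_alg (\<lambda>y. flat 1 (\<rho>\<^sup>2 - (norm (y - z))\<^sup>2) * (1 / bump_mass \<rho> TYPE('a)))"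
    by (intro smooth_alg.mult smooth_alg.flat smooth_alg.const)
  then have "smooth_alg (\<lambda>y. mollifier \<rho> (z - y))"
    by (simp add: mollifier_def norm_minus_commute)
  moreover have "{y. mollifier \<rho> (z - y) \<noteq> 0} \<subseteq> cball z \<rho>"
    using mollifier_eq_0[OF assms(1)] by (metis (mono_tags, lifting) dist_norm linear mem_Collect_eq mem_cball subsetI)
  then have "closure {y. mollifier \<rho> (z - y) \<noteq> 0} \<subseteq> cball z \<rho>"
    by (simp add: closure_minimal)
  then have "compactly_contained {y. mollifier \<rho> (z - y) \<noteq> 0} D"
    using assms(2) unfolding compactly_contained_def
    by (meson bounded_cball bounded_subset closed_closure compact_eq_bounded_closed order_trans)
  ultimately show ?thesis
    using smooth_alg_imp_Ck by (auto simp: test_functions_def)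
qed

text \<open>The gradient in \<open>parabolic_sobolev_with_gradient\<close> is characterised slice by
  slice, so the space-time kernel has to be admissible as a test function of x at each fixed
  t.\<close>

lemma mollifier_slice_test_function:
  fixes z :: "'a::euclidean_space \<times> real"
  assumes "\<rho> > 0" "\<And>x. (x, t) \<in> cball z \<rho> \<Longrightarrow> x \<in> U"
  shows "(\<lambda>x. mollifier \<rho> (z - (x, t))) \<in> test_functions U"
proof -
  have eq: "\<rho>\<^sup>2 - (norm (z - (x, t)))\<^sup>2 = (\<rho>\<^sup>2 - (snd z - t)\<^sup>2) - (norm (x - fst z))\<^sup>2" for x
    by (cases z) (simp add: norm_Pair norm_minus_commute)
  have "smooth_alg (\<lambda>x. flat 1 ((\<rho>\<^sup>2 - (snd z - t)\<^sup>2) - (norm (x - fst z))\<^sup>2) * (1 / bump_mass \<rho> TYPE('a \<times> real)))"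
    by (intro smooth_alg.mult smooth_alg.flat smooth_alg.const)
  then have "smooth_alg (\<lambda>x. mollifier \<rho> (z - (x, t)))"
    unfolding mollifier_def eq by simp
  moreover have "compactly_contained {x. mollifier \<rho> (z - (x, t)) \<noteq> 0} U"
  proof -
    have "closed {x. (x, t) \<in> cball z \<rho>}"
      using continuous_closed_vimage[of "cball z \<rho>" "\<lambda>x. (x, t)"]
      by (auto simp: vimage_def intro!: continuous_intros)
    moreover have "{x. mollifier \<rho> (z - (x, t)) \<noteq> 0} \<subseteq> {x. (x, t) \<in> cball z \<rho>}"
      using mollifier_eq_0[OF assms(1)] by (metis (mono_tags, lifting) dist_norm linear mem_Collect_eq mem_cball subsetI)
    ultimately have sub: "closure {x. mollifier \<rho> (z - (x, t)) \<noteq> 0} \<subseteq> {x. (x, t) \<in> cball z \<rho>}"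
      by (intro closure_minimal)
    have "{x. (x, t) \<in> cball z \<rho>} \<subseteq> fst ` cball z \<rho>"
      by force
    then have "bounded {x. (x, t) \<in> cball z \<rho>}"
      using bounded_subset bounded_fst bounded_cball by blast
    then have "bounded (closure {x. mollifier \<rho> (z - (x, t)) \<noteq> 0})"
      using sub bounded_subset by blast
    then show ?thesis
      using sub assms(2) by (auto simp: compactly_contained_def compact_eq_bounded_closed)
  qed
  ultimately show ?thesis
    using smooth_alg_imp_Ck by (auto simp: test_functions_def)
qed

lemma mollifier_slice_derivative:
  fixes z :: "'a::euclidean_space \<times> real"
  shows "frechet_derivative (\<lambda>x. mollifier \<rho> (z - (x, t))) (at x) v = - mollifier_deriv \<rho> (v, 0) (z - (x, t))"
proof -
  have "((\<lambda>x. (x, t)) has_derivative (\<lambda>v. (v, 0))) (at x)"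
    by (auto intro!: derivative_eq_intros)
  from has_derivative_compose[OF this mollifier_has_derivative[of \<rho> z "(x, t)"]]
  show ?thesis
    using frechet_derivative_at by metis
qed

lemma mollifier_frechet:
  "frechet_derivative (\<lambda>y. mollifier \<rho> (z - y)) (at y) v = - mollifier_deriv \<rho> v (z - y)"
  using frechet_derivative_at[OF mollifier_has_derivative] by metis

section \<open>Mollification in \<open>L\<^sup>1\<close>\<close>

definition L1_translation_cont :: "('e::euclidean_space \<Rightarrow> real) \<Rightarrow> bool" where
  "L1_translation_cont f \<longleftrightarrow> (\<forall>e>0. \<exists>d>0. \<forall>h. norm h < d \<longrightarrow> (LBINT x. \<bar>f (x + h) - f x\<bar>) < e)"

lemma L1_translation_cont_closure:
  fixes f :: "'e::euclidean_space \<Rightarrow> real"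
  assumes f: "integrable lborel f"
    and appr: "\<And>e. e > 0 \<Longrightarrow> \<exists>g. integrable lborel g \<and> (LBINT x. \<bar>f x - g x\<bar>) < e \<and> L1_translation_cont g"
  shows "L1_translation_cont f"
  unfolding L1_translation_cont_def
proof (intro allI impI)
  fix e :: real assume e: "e > 0"
  then obtain g where g: "integrable lborel g" and fg: "(LBINT x. \<bar>f x - g x\<bar>) < e / 3"
    and "L1_translation_cont g"
    using appr[of "e / 3"] by auto
  then obtain d where d: "d > 0" "\<And>h. norm h < d \<Longrightarrow> (LBINT x. \<bar>g (x + h) - g x\<bar>) < e / 3"
    using e unfolding L1_translation_cont_def by (meson divide_pos_pos zero_less_numeral)
  have "(LBINT x. \<bar>f (x + h) - f x\<bar>) < e" if "norm h < d" for h
  proof -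
    note fh = lborel_integrable_shift[OF f, of h] and gh = lborel_integrable_shift[OF g, of h]
    have "(LBINT x. \<bar>f (x + h) - f x\<bar>) \<le>
        (LBINT x. \<bar>f (x + h) - g (x + h)\<bar> + \<bar>g (x + h) - g x\<bar> + \<bar>f x - g x\<bar>)"
      using f g fh gh by (intro integral_mono) auto
    also have "\<dots> = (LBINT x. \<bar>f (x + h) - g (x + h)\<bar>) + (LBINT x. \<bar>g (x + h) - g x\<bar>)
        + (LBINT x. \<bar>f x - g x\<bar>)"
      using f g fh gh by simp
    also have "(LBINT x. \<bar>f (x + h) - g (x + h)\<bar>) = (LBINT x. \<bar>f x - g x\<bar>)"
      using lborel_integral_shift[of "\<lambda>x. \<bar>f x - g x\<bar>" h] f g by simp
    finally show ?thesis
      using fg d(2)[OF that] by linarith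
  qed
  with d(1) show "\<exists>d>0. \<forall>h. norm h < d \<longrightarrow> (LBINT x. \<bar>f (x + h) - f x\<bar>) < e"
    by blast
qed

text \<open>For h_k -> 0, openness of U gives pointwise convergence of 1_U(x) 1_U(x + h_k) to
  1_U(x); off U both sides are 0. Dominated convergence then handles the overlap, and the symmetric
  difference of U and its translate has measure 2|U| minus twice the overlap.\<close>

lemma L1_translation_cont_open:
  fixes U :: "'e::euclidean_space set"
  assumes U: "open U" "emeasure lborel U < \<infinity>"
  shows "L1_translation_cont (\<lambda>x. indicator U x * c)"
proof (rule ccontr)
  let ?I = "indicator U :: 'e \<Rightarrow> real"
  have intU: "integrable lborel ?I"
    using U by (intro integrable_real_indicator) auto
  assume "\<not> ?thesis"
  then obtain e where e: "e > 0"
    "\<forall>d>0. \<exists>h. norm h < d \<and> (LBINT x. \<bar>?I (x + h) * c - ?I x * c\<bar>) \<ge> e"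
    unfolding L1_translation_cont_def by (meson not_less)
  then have "\<exists>h. norm h < 1 / real (Suc k) \<and> (LBINT x. \<bar>?I (x + h) * c - ?I x * c\<bar>) \<ge> e" for k
    by simp
  then obtain h where h: "\<And>k. norm (h k) < 1 / real (Suc k)"
    and ge: "\<And>k. (LBINT x. \<bar>?I (x + h k) * c - ?I x * c\<bar>) \<ge> e"
    by metis
  have h0: "h \<longlonglongrightarrow> 0"
  proof (rule Lim_null_comparison)
    show "(\<lambda>k. 1 / real (Suc k)) \<longlonglongrightarrow> 0"
      by (rule LIMSEQ_1_over_Suc)
    show "\<forall>\<^sub>F k in sequentially. norm (h k) \<le> 1 / real (Suc k)"
      using h by (intro always_eventually allI less_imp_le)
  qed
  have shift: "integrable lborel (\<lambda>x. ?I (x + h k))" "(LBINT x. ?I (x + h k)) = (LBINT x. ?I x)" for k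
    using lborel_integrable_shift[OF intU] lborel_integral_shift[of ?I "h k"] U(1) by auto
  have intM: "integrable lborel (\<lambda>x. ?I x * ?I (x + h k))" for k
  proof (rule Bochner_Integration.integrable_bound[OF intU])
    have [measurable]: "U \<in> sets borel" using U(1) by simp
    show "(\<lambda>x. ?I x * ?I (x + h k)) \<in> borel_measurable lborel" by measurable
  qed (auto simp: indicator_def)
  have eq: "(LBINT x. \<bar>?I (x + h k) * c - ?I x * c\<bar>) =
      \<bar>c\<bar> * (2 * (LBINT x. ?I x) - 2 * (LBINT x. ?I x * ?I (x + h k)))" for k
  proof -
    have "(LBINT x. \<bar>?I (x + h k) * c - ?I x * c\<bar>) =
        (LBINT x. \<bar>c\<bar> * (?I (x + h k) + ?I x - 2 * (?I x * ?I (x + h k))))"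
      by (intro Bochner_Integration.integral_cong) (auto simp: indicator_def)
    also have "\<dots> = \<bar>c\<bar> * (2 * (LBINT x. ?I x) - 2 * (LBINT x. ?I x * ?I (x + h k)))"
      using intU intM[of k] shift[of k] by simp
    finally show ?thesis .
  qed
  have "(\<lambda>k. ?I x * ?I (x + h k)) \<longlonglongrightarrow> ?I x" for x
  proof (cases "x \<in> U")
    case True
    have "(\<lambda>k. x + h k) \<longlonglongrightarrow> x + 0"
      by (intro tendsto_intros h0)
    then have "\<forall>\<^sub>F k in sequentially. x + h k \<in> U"
      using True U(1) topological_tendstoD by fastforce
    then have "\<forall>\<^sub>F k in sequentially. ?I x = ?I x * ?I (x + h k)"
      by eventually_elim (use True in auto)
    then show ?thesis
      by (rule Lim_transform_eventually[OF tendsto_const])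
  qed simp
  then have lim: "AE x in lborel. (\<lambda>k. ?I x * ?I (x + h k)) \<longlonglongrightarrow> ?I x"
    by (rule AE_I2)
  have dom: "AE x in lborel. norm (?I x * ?I (x + h k)) \<le> ?I x" for k
    by (auto simp: indicator_def)
  have "(\<lambda>k. LBINT x. ?I x * ?I (x + h k)) \<longlonglongrightarrow> (LBINT x. ?I x)"
    by (rule integral_dominated_convergence[OF borel_measurable_integrable[OF intU]
        borel_measurable_integrable[OF intM] intU lim dom])
  then have "(\<lambda>k. LBINT x. \<bar>?I (x + h k) * c - ?I x * c\<bar>) \<longlonglongrightarrow>
      \<bar>c\<bar> * (2 * (LBINT x. ?I x) - 2 * (LBINT x. ?I x))"
    unfolding eq by (intro tendsto_intros)
  then have "e \<le> \<bar>c\<bar> * (2 * (LBINT x. ?I x) - 2 * (LBINT x. ?I x))"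
    using ge by (intro LIMSEQ_le_const[of _ _ e]) auto
  with e(1) show False by simp
qed

text \<open>Induction over integrable functions: measurable sets are approximated from outside by
  open ones, sums split, and a general function is an L^1 limit of simple ones.\<close>

lemma integrable_imp_L1_translation_cont:
  fixes f :: "'e::euclidean_space \<Rightarrow> real"
  assumes "integrable lborel f"
  shows "L1_translation_cont f"
  using assms
proof induction
  case (base A c)
  show ?case
  proof (rule L1_translation_cont_closure)
    show "integrable lborel (\<lambda>x. indicator A x *\<^sub>R c)"
      using base by (intro integrable_scaleR_left integrable_real_indicator) auto
    fix e :: real assume e: "e > 0"
    \<comment> \<open>The denominator |c| + 1 keeps the tolerance meaningful for c = 0 and leaves
      the error e |c| / (|c| + 1) strictly below e.\<close>
    then obtain U where U: "open U" "A \<subseteq> U" "emeasure lborel (U - A) < ennreal (e / (\<bar>c\<bar> + 1))"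
      using outer_regular_lborel[of A "e / (\<bar>c\<bar> + 1)"] base(1) by (auto simp: add_nonneg_pos)
    have A [measurable]: "A \<in> sets borel" and UA: "U - A \<in> sets lborel"
      using base(1) U(1) by auto
    have finUA: "emeasure lborel (U - A) < \<infinity>"
      using U(3) by (metis ennreal_less_top infinity_ennreal_def order.strict_trans)
    have "emeasure lborel U \<le> emeasure lborel A + emeasure lborel (U - A)"
      using emeasure_subadditive[of A lborel "U - A"] base(1) UA U(2) by (simp add: Un_absorb1 Un_Diff_cancel)
    also have "\<dots> < \<infinity>"
      using base(2) finUA by simp
    finally have finU: "emeasure lborel U < \<infinity>" .
    have "measure lborel (U - A) < e / (\<bar>c\<bar> + 1)"
      using U(3) finUA e by (simp add: measure_def enn2real_less_iff less_top)
    have "(LBINT x. \<bar>indicator A x *\<^sub>R c - indicator U x * c\<bar>) = (LBINT x. indicator (U - A) x * \<bar>c\<bar>)"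
      using U(2) by (intro Bochner_Integration.integral_cong) (auto simp: indicator_def)
    also have "\<dots> = measure lborel (U - A) * \<bar>c\<bar>"
      using finUA by simp
    also have "\<dots> \<le> e / (\<bar>c\<bar> + 1) * \<bar>c\<bar>"
      using \<open>measure lborel (U - A) < _\<close> by (intro mult_right_mono) auto
    also have "\<dots> < e"
      using e by (simp add: field_simps add_nonneg_pos)
    finally show "\<exists>g. integrable lborel g \<and> (LBINT x. \<bar>indicator A x *\<^sub>R c - g x\<bar>) < e \<and> L1_translation_cont g"
      using L1_translation_cont_open[OF U(1) finU, of c] U(1) finU
      by (intro exI[of _ "\<lambda>x. indicator U x * c"]) auto
  qed
next
  case (add f g)
  show ?case
    unfolding L1_translation_cont_def
  proof (intro allI impI)
    fix e :: real assume e: "e > 0"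
    then have e2: "e / 2 > 0" by simp
    obtain d1 where d1: "d1 > 0" "\<And>h. norm h < d1 \<Longrightarrow> (LBINT x. \<bar>f (x + h) - f x\<bar>) < e / 2"
      using add.IH(1) e2 unfolding L1_translation_cont_def by meson
    obtain d2 where d2: "d2 > 0" "\<And>h. norm h < d2 \<Longrightarrow> (LBINT x. \<bar>g (x + h) - g x\<bar>) < e / 2"
      using add.IH(2) e2 unfolding L1_translation_cont_def by meson
    have "(LBINT x. \<bar>f (x + h) + g (x + h) - (f x + g x)\<bar>) < e" if "norm h < min d1 d2" for h
    proof -
      note fh = lborel_integrable_shift[OF add.hyps(1), of h] and gh = lborel_integrable_shift[OF add.hyps(2), of h]
      have "(LBINT x. \<bar>f (x + h) + g (x + h) - (f x + g x)\<bar>) \<le>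
          (LBINT x. \<bar>f (x + h) - f x\<bar> + \<bar>g (x + h) - g x\<bar>)"
        using add.hyps fh gh by (intro integral_mono) auto
      also have "\<dots> = (LBINT x. \<bar>f (x + h) - f x\<bar>) + (LBINT x. \<bar>g (x + h) - g x\<bar>)"
        using add.hyps fh gh by simp
      finally show ?thesis using d1(2)[of h] d2(2)[of h] that by simp
    qed
    then show "\<exists>d>0. \<forall>h. norm h < d \<longrightarrow> (LBINT x. \<bar>f (x + h) + g (x + h) - (f x + g x)\<bar>) < e"
      using d1(1) d2(1) by (intro exI[of _ "min d1 d2"]) auto
  qed
next
  case (lim f s)
  show ?case
  proof (rule L1_translation_cont_closure)
    fix e :: real assume e: "e > 0"
    have "(\<lambda>i. LBINT x. \<bar>f x - s i x\<bar>) \<longlonglongrightarrow> (\<integral>x. 0 \<partial>(lborel :: 'e measure))"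
    proof (rule integral_dominated_convergence)
      \<comment> \<open>The approximants satisfy |s i x| \<le> 2 |f x|, so 3 |f| dominates the
        differences.\<close>
      show "integrable lborel (\<lambda>x. 3 * \<bar>f x\<bar>)" using lim.hyps by simp
      show "AE x in lborel. (\<lambda>i. \<bar>f x - s i x\<bar>) \<longlonglongrightarrow> 0"
      proof (rule AE_I2)
        fix x :: 'e assume "x \<in> space lborel"
        then have "(\<lambda>i. \<bar>f x - s i x\<bar>) \<longlonglongrightarrow> \<bar>f x - f x\<bar>"
          by (intro tendsto_intros lim.hyps(2))
        then show "(\<lambda>i. \<bar>f x - s i x\<bar>) \<longlonglongrightarrow> 0" by simp
      qed
      show "AE x in lborel. norm \<bar>f x - s i x\<bar> \<le> 3 * \<bar>f x\<bar>" for i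
        using lim.hyps(3)[of _ i] by (intro AE_I2) (smt (verit, best) real_norm_def)
    qed (use lim.hyps in auto)
    then have "\<forall>\<^sub>F i in sequentially. (LBINT x. \<bar>f x - s i x\<bar>) < e"
      using e by (intro order_tendstoD(2)) auto
    then obtain i where "(LBINT x. \<bar>f x - s i x\<bar>) < e"
      by (meson eventually_happens sequentially_bot)
    then show "\<exists>g. integrable lborel g \<and> (LBINT x. \<bar>f x - g x\<bar>) < e \<and> L1_translation_cont g"
      using lim.hyps(1) lim.IH by blast
  qed (use lim.hyps in auto)
qed

section \<open>Convolution with the mollifier\<close>

definition mollify :: "real \<Rightarrow> ('e::euclidean_space \<Rightarrow> real) \<Rightarrow> 'e \<Rightarrow> real" where
  "mollify \<rho> f z = (LBINT y. mollifier \<rho> (z - y) * f y)"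

definition mollify_deriv :: "real \<Rightarrow> 'e \<Rightarrow> ('e::euclidean_space \<Rightarrow> real) \<Rightarrow> 'e \<Rightarrow> real" where
  "mollify_deriv \<rho> v f z = (LBINT y. mollifier_deriv \<rho> v (z - y) * f y)"

lemma integrable_bounded_mult:
  fixes f g :: "'e::euclidean_space \<Rightarrow> real"
  assumes "integrable lborel f" "g \<in> borel_measurable borel" "\<And>x. \<bar>g x\<bar> \<le> M"
  shows "integrable lborel (\<lambda>x. g x * f x)"
proof (rule Bochner_Integration.integrable_bound)
  show "integrable lborel (\<lambda>x. M * f x)" using assms(1) by simp
  have "M \<ge> 0" using assms(3)[of undefined] by linarith
  then show "AE x in lborel. norm (g x * f x) \<le> norm (M * f x)"
    using assms(3) by (intro AE_I2) (auto simp: abs_mult intro!: mult_right_mono)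
qed (use assms in auto)

context
  fixes \<rho> :: real
  assumes \<rho>: "\<rho> > 0"
begin

lemma mollifier_abs_bounded: "\<bar>mollifier \<rho> (y::'e::euclidean_space)\<bar> \<le> 1 / bump_mass \<rho> TYPE('e)"
  using mollifier_bounded[OF \<rho>, of y] mollifier_nonneg[OF \<rho>, of y] by simp

lemma mollify_integrable:
  fixes f :: "'e::euclidean_space \<Rightarrow> real"
  assumes "integrable lborel f"
  shows "integrable lborel (\<lambda>y. mollifier \<rho> (z - y) * f y)"
  by (rule integrable_bounded_mult[OF assms _ mollifier_abs_bounded]) measurable

lemma mollify_deriv_integrable:
  fixes f :: "'e::euclidean_space \<Rightarrow> real"
  assumes "integrable lborel f"
  shows "integrable lborel (\<lambda>y. mollifier_deriv \<rho> v (z - y) * f y)"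
proof -
  obtain M where "\<And>y::'e. \<bar>mollifier_deriv \<rho> v y\<bar> \<le> M"
    using mollifier_deriv_bounded[OF \<rho>] by blast
  then show ?thesis
    by (intro integrable_bounded_mult[OF assms, of _ M]) auto
qed

lemma mollify_mono:
  fixes f g :: "'e::euclidean_space \<Rightarrow> real"
  assumes "integrable lborel f" "integrable lborel g" "\<And>y. norm (z - y) < \<rho> \<Longrightarrow> f y \<le> g y"
  shows "mollify \<rho> f z \<le> mollify \<rho> g z"
  unfolding mollify_def
proof (rule integral_mono)
  fix y :: 'e
  show "mollifier \<rho> (z - y) * f y \<le> mollifier \<rho> (z - y) * g y"
    using assms(3)[of y] mollifier_nonneg[OF \<rho>, of "z - y"] mollifier_eq_0[OF \<rho>, of "z - y"]
    by (cases "norm (z - y) < \<rho>") (auto intro: mult_left_mono)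
qed (use assms mollify_integrable in auto)

lemma mollify_add:
  fixes f g :: "'e::euclidean_space \<Rightarrow> real"
  assumes "integrable lborel f" "integrable lborel g"
  shows "mollify \<rho> (\<lambda>y. f y + g y) z = mollify \<rho> f z + mollify \<rho> g z"
  using mollify_integrable[OF assms(1), of z] mollify_integrable[OF assms(2), of z]
  by (simp add: mollify_def distrib_left)

lemma mollify_abs_le:
  fixes f :: "'e::euclidean_space \<Rightarrow> real"
  assumes "integrable lborel f"
  shows "\<bar>mollify \<rho> f z\<bar> \<le> mollify \<rho> (\<lambda>y. \<bar>f y\<bar>) z"
proof -
  have "\<bar>mollify \<rho> f z\<bar> \<le> (LBINT y. \<bar>mollifier \<rho> (z - y) * f y\<bar>)"
    unfolding mollify_def by (rule integral_abs_bound)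
  also have "\<dots> = mollify \<rho> (\<lambda>y. \<bar>f y\<bar>) z"
    by (simp add: mollify_def abs_mult mollifier_nonneg[OF \<rho>])
  finally show ?thesis .
qed

lemma mollifier_reflect_integrable: "integrable lborel (\<lambda>y. mollifier \<rho> (z - y :: 'e::euclidean_space))"
  by (rule lborel_integrable_reflect[OF mollifier_integrable[OF \<rho>]])

lemma mollifier_reflect_integral: "(LBINT y. mollifier \<rho> (z - y :: 'e::euclidean_space)) = 1"
  using lborel_integral_reflect[of "mollifier \<rho> :: 'e \<Rightarrow> real" z] mollifier_integral[OF \<rho>, where 'e='e] by simp

lemma mollify_near:
  fixes f :: "'e::euclidean_space \<Rightarrow> real"
  assumes "integrable lborel f" "\<And>y. norm (z - y) < \<rho> \<Longrightarrow> \<bar>f y - c\<bar> \<le> e"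
  shows "\<bar>mollify \<rho> f z - c\<bar> \<le> e"
proof -
  have "mollify \<rho> f z - c = (LBINT y. mollifier \<rho> (z - y) * f y - c * mollifier \<rho> (z - y))"
    using mollify_integrable[OF assms(1), of z] mollifier_reflect_integrable[of z] mollifier_reflect_integral[of z]
    by (simp add: mollify_def)
  also have "\<dots> = (LBINT y. mollifier \<rho> (z - y) * (f y - c))"
    by (intro Bochner_Integration.integral_cong) (auto simp: algebra_simps)
  finally have "\<bar>mollify \<rho> f z - c\<bar> \<le> (LBINT y. \<bar>mollifier \<rho> (z - y) * (f y - c)\<bar>)"
    by (simp add: integral_abs_bound)
  also have "\<dots> \<le> (LBINT y. e * mollifier \<rho> (z - y))"
  proof (rule integral_mono)
    show "integrable lborel (\<lambda>y. \<bar>mollifier \<rho> (z - y) * (f y - c)\<bar>)"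
      using mollify_integrable[OF assms(1), of z] mollifier_reflect_integrable[of z]
      by (simp add: right_diff_distrib)
    show "\<bar>mollifier \<rho> (z - y) * (f y - c)\<bar> \<le> e * mollifier \<rho> (z - y)" for y
      using assms(2)[of y] mollifier_nonneg[OF \<rho>, of "z - y"] mollifier_eq_0[OF \<rho>, of "z - y"]
      by (cases "norm (z - y) < \<rho>") (auto simp: abs_mult mult.commute intro: mult_right_mono)
  qed (use mollifier_reflect_integrable in auto)
  also have "\<dots> = e"
    using mollifier_reflect_integral[of z] by simp
  finally show ?thesis .
qed

lemma mollify_bounded:
  fixes f :: "'e::euclidean_space \<Rightarrow> real"
  assumes "integrable lborel f"
  obtains M where "\<And>z. \<bar>mollify \<rho> f z\<bar> \<le> M"
proof -
  have "\<bar>mollify \<rho> f z\<bar> \<le> (LBINT y. 1 / bump_mass \<rho> TYPE('e) * \<bar>f y\<bar>)" for z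
  proof -
    have "\<bar>mollify \<rho> f z\<bar> \<le> (LBINT y. \<bar>mollifier \<rho> (z - y) * f y\<bar>)"
      unfolding mollify_def by (rule integral_abs_bound)
    also have "\<dots> \<le> (LBINT y. 1 / bump_mass \<rho> TYPE('e) * \<bar>f y\<bar>)"
    proof (rule integral_mono)
      show "\<bar>mollifier \<rho> (z - y) * f y\<bar> \<le> 1 / bump_mass \<rho> TYPE('e) * \<bar>f y\<bar>" for y
        using mollifier_abs_bounded[of "z - y"] unfolding abs_mult by (rule mult_right_mono) simp
    qed (use assms mollify_integrable[OF assms, of z] in auto)
    finally show ?thesis .
  qed
  then show ?thesis using that by blast
qed

lemma mollify_deriv_bounded:
  fixes f :: "'e::euclidean_space \<Rightarrow> real"
  assumes "integrable lborel f"
  obtains M where "\<And>z. \<bar>mollify_deriv \<rho> v f z\<bar> \<le> M"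
proof -
  obtain B where B: "\<And>y::'e. \<bar>mollifier_deriv \<rho> v y\<bar> \<le> B"
    using mollifier_deriv_bounded[OF \<rho>] by blast
  have "\<bar>mollify_deriv \<rho> v f z\<bar> \<le> (LBINT y. B * \<bar>f y\<bar>)" for z
  proof -
    have "\<bar>mollify_deriv \<rho> v f z\<bar> \<le> (LBINT y. \<bar>mollifier_deriv \<rho> v (z - y) * f y\<bar>)"
      unfolding mollify_deriv_def by (rule integral_abs_bound)
    also have "\<dots> \<le> (LBINT y. B * \<bar>f y\<bar>)"
    proof (rule integral_mono)
      show "\<bar>mollifier_deriv \<rho> v (z - y) * f y\<bar> \<le> B * \<bar>f y\<bar>" for y
        using B[of "z - y"] unfolding abs_mult by (rule mult_right_mono) simp
    qed (use assms mollify_deriv_integrable[OF assms, of v z] in auto)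
    finally show ?thesis .
  qed
  then show ?thesis using that by blast
qed

text \<open>All the regularity comes from the kernel: its difference quotients are bounded by the
  supremum of its derivative, hence the integrands are dominated by a multiple of |f|.\<close>

lemma mollify_dir_deriv:
  fixes f :: "'e::euclidean_space \<Rightarrow> real"
  assumes f: "integrable lborel f"
  shows "has_dir_deriv (mollify \<rho> f) (mollify_deriv \<rho> v f z) v z"
proof -
  obtain B where B: "\<And>y::'e. \<bar>mollifier_deriv \<rho> v y\<bar> \<le> B"
    using mollifier_deriv_bounded[OF \<rho>] by blast
  have lip: "\<bar>mollifier \<rho> (x + s *\<^sub>R v) - mollifier \<rho> x\<bar> \<le> B * \<bar>s\<bar>" for x :: 'e and s
  proof -
    have "norm (mollifier \<rho> (x + s *\<^sub>R v) - mollifier \<rho> (x + 0 *\<^sub>R v)) \<le> B * norm (s - 0)"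
      by (rule field_differentiable_bound[where S=UNIV and f'="\<lambda>s. mollifier_deriv \<rho> v (x + s *\<^sub>R v)"])
        (use B has_dir_deriv_line[OF mollifier_dir_deriv] in \<open>auto intro: has_field_derivative_at_within\<close>)
    then show ?thesis by simp
  qed
  have "((\<lambda>s. (mollify \<rho> f (z + s *\<^sub>R v) - mollify \<rho> f z) / s) \<longlongrightarrow> mollify_deriv \<rho> v f z) (at 0)"
    unfolding tendsto_at_iff_sequentially
  proof (intro allI impI)
    fix X :: "nat \<Rightarrow> real"
    assume X: "\<forall>i. X i \<in> UNIV - {0}" and X0: "X \<longlonglongrightarrow> 0"
    have eq: "(mollify \<rho> f (z + X i *\<^sub>R v) - mollify \<rho> f z) / X i =
        (LBINT y. (mollifier \<rho> (z - y + X i *\<^sub>R v) - mollifier \<rho> (z - y)) / X i * f y)" for i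
    proof -
      have "mollify \<rho> f (z + X i *\<^sub>R v) - mollify \<rho> f z =
          (LBINT y. mollifier \<rho> (z + X i *\<^sub>R v - y) * f y - mollifier \<rho> (z - y) * f y)"
        using mollify_integrable[OF f] by (simp add: mollify_def)
      then have "(mollify \<rho> f (z + X i *\<^sub>R v) - mollify \<rho> f z) / X i =
          (LBINT y. (mollifier \<rho> (z + X i *\<^sub>R v - y) * f y - mollifier \<rho> (z - y) * f y) / X i)"
        by simp
      then show ?thesis
        by (simp add: algebra_simps diff_divide_distrib)
    qed
    have "(\<lambda>i. LBINT y. (mollifier \<rho> (z - y + X i *\<^sub>R v) - mollifier \<rho> (z - y)) / X i * f y)
        \<longlonglongrightarrow> (LBINT y. mollifier_deriv \<rho> v (z - y) * f y)"
    proof (rule integral_dominated_convergence)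
      show "integrable lborel (\<lambda>y. B * \<bar>f y\<bar>)" using f by simp
      show "AE y in lborel. norm ((mollifier \<rho> (z - y + X i *\<^sub>R v) - mollifier \<rho> (z - y)) / X i * f y) \<le> B * \<bar>f y\<bar>" for i
      proof (intro AE_I2)
        fix y
        have "\<bar>(mollifier \<rho> (z - y + X i *\<^sub>R v) - mollifier \<rho> (z - y)) / X i\<bar> \<le> B"
          using lip[of "z - y" "X i"] X by (simp add: abs_divide divide_le_eq)
        then show "norm ((mollifier \<rho> (z - y + X i *\<^sub>R v) - mollifier \<rho> (z - y)) / X i * f y) \<le> B * \<bar>f y\<bar>"
          unfolding real_norm_def abs_mult by (rule mult_right_mono) simp
      qed
      show "AE y in lborel. (\<lambda>i. (mollifier \<rho> (z - y + X i *\<^sub>R v) - mollifier \<rho> (z - y)) / X i * f y)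
          \<longlonglongrightarrow> mollifier_deriv \<rho> v (z - y) * f y"
      proof (intro AE_I2 tendsto_mult tendsto_const)
        fix y
        have "((\<lambda>s. (mollifier \<rho> (z - y + s *\<^sub>R v) - mollifier \<rho> (z - y)) / s) \<longlongrightarrow> mollifier_deriv \<rho> v (z - y)) (at 0)"
          using mollifier_dir_deriv[of \<rho> v "z - y"] by (simp add: has_dir_deriv_def DERIV_def)
        moreover have "filterlim X (at 0) sequentially"
          using X X0 by (auto simp: filterlim_at)
        ultimately show "(\<lambda>i. (mollifier \<rho> (z - y + X i *\<^sub>R v) - mollifier \<rho> (z - y)) / X i) \<longlonglongrightarrow> mollifier_deriv \<rho> v (z - y)"
          by (rule filterlim_compose)
      qed
    qed (use f in auto)
    then show "((\<lambda>s. (mollify \<rho> f (z + s *\<^sub>R v) - mollify \<rho> f z) / s) \<circ> X) \<longlonglongrightarrow> mollify_deriv \<rho> v f z"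
      by (simp add: comp_def eq mollify_deriv_def)
  qed
  then show ?thesis
    by (simp add: has_dir_deriv_def DERIV_def)
qed

end

lemma mollify_measurable [measurable]:
  fixes f :: "'e::euclidean_space \<Rightarrow> real"
  assumes [measurable]: "f \<in> borel_measurable borel"
  shows "mollify \<rho> f \<in> borel_measurable borel"
proof -
  have "(\<lambda>(z, y). mollifier \<rho> (z - y) * f y) \<in> borel_measurable (borel \<Otimes>\<^sub>M lborel)"
    by measurable
  then show ?thesis
    unfolding mollify_def by (rule lborel.borel_measurable_lebesgue_integral)
qed

text \<open>After the reflection y -> z - y the error at z is the average of f(z - y) - f(z) against
  the kernel in y. Swapping the integrals leaves, for each y in the support, the L^1 distance
  between f and a translate by less than d.\<close>

lemma mollify_L1:
  fixes f :: "'e::euclidean_space \<Rightarrow> real"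
  assumes f: "integrable lborel f" and e: "e > 0"
  shows "\<exists>d>0. \<forall>\<rho>. 0 < \<rho> \<and> \<rho> < d \<longrightarrow>
    integrable lborel (\<lambda>z. mollify \<rho> f z - f z) \<and> (LBINT z. \<bar>mollify \<rho> f z - f z\<bar>) \<le> e"
proof -
  have [measurable]: "f \<in> borel_measurable borel"
    using f by (simp add: borel_measurable_integrable[simplified])
  obtain d where d: "d > 0" "\<And>h. norm h < d \<Longrightarrow> (LBINT x. \<bar>f (x + h) - f x\<bar>) < e"
    using integrable_imp_L1_translation_cont[OF f] e unfolding L1_translation_cont_def by meson
  have "integrable lborel (\<lambda>z. mollify \<rho> f z - f z) \<and> (LBINT z. \<bar>mollify \<rho> f z - f z\<bar>) \<le> e"
    if \<rho>: "0 < \<rho>" "\<rho> < d" for \<rho>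
  proof -
    have eq: "mollify \<rho> f z - f z = (LBINT y. mollifier \<rho> y * (f (z - y) - f z))" for z
    proof -
      have "mollify \<rho> f z = (LBINT y. mollifier \<rho> (z - (z - y)) * f (z - y))"
        unfolding mollify_def by (subst lborel_integral_reflect[where t=z]) auto
      moreover have "integrable lborel (\<lambda>y. mollifier \<rho> (z - (z - y)) * f (z - y))"
        using lborel_integrable_reflect[OF mollify_integrable[OF \<rho>(1) f, of z], of z] .
      ultimately show ?thesis
        using mollifier_integrable[OF \<rho>(1), where 'e='e] mollifier_integral[OF \<rho>(1), where 'e='e]
        by (simp add: right_diff_distrib)
    qed
    have "(\<integral>\<^sup>+z. ennreal \<bar>mollify \<rho> f z - f z\<bar> \<partial>lborel) \<le>
        (\<integral>\<^sup>+z. \<integral>\<^sup>+y. ennreal (mollifier \<rho> y * \<bar>f (z - y) - f z\<bar>) \<partial>lborel \<partial>lborel)"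
    proof (rule nn_integral_mono)
      fix z :: 'e
      have "ennreal \<bar>mollify \<rho> f z - f z\<bar> \<le> (\<integral>\<^sup>+y. ennreal (norm (mollifier \<rho> y * (f (z - y) - f z))) \<partial>lborel)"
        unfolding eq by (subst real_norm_def[symmetric]) (rule integral_norm_bound_ennreal, 
          use lborel_integrable_reflect[OF mollify_integrable[OF \<rho>(1) f, of z], of z]
            mollifier_integrable[OF \<rho>(1), where 'e='e] in \<open>simp add: right_diff_distrib\<close>)
      then show "ennreal \<bar>mollify \<rho> f z - f z\<bar> \<le> (\<integral>\<^sup>+y. ennreal (mollifier \<rho> y * \<bar>f (z - y) - f z\<bar>) \<partial>lborel)"
        by (simp add: abs_mult mollifier_nonneg[OF \<rho>(1)])
    qed
    also have "\<dots> = (\<integral>\<^sup>+y. \<integral>\<^sup>+z. ennreal (mollifier \<rho> y * \<bar>f (z - y) - f z\<bar>) \<partial>lborel \<partial>lborel)"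
      by (rule lborel_pair.Fubini') measurable
    also have "\<dots> \<le> (\<integral>\<^sup>+(y::'e). ennreal (mollifier \<rho> y * e) \<partial>lborel)"
    proof (rule nn_integral_mono)
      fix y :: 'e
      show "(\<integral>\<^sup>+z. ennreal (mollifier \<rho> y * \<bar>f (z - y) - f z\<bar>) \<partial>lborel) \<le> ennreal (mollifier \<rho> y * e)"
      proof (cases "norm y < d")
        case True
        have int: "integrable lborel (\<lambda>z. mollifier \<rho> y * \<bar>f (z - y) - f z\<bar>)"
          using lborel_integrable_shift[OF f, of "- y"] f by simp
        have "(\<integral>\<^sup>+z. ennreal (mollifier \<rho> y * \<bar>f (z - y) - f z\<bar>) \<partial>lborel) =
            ennreal (LBINT z. mollifier \<rho> y * \<bar>f (z - y) - f z\<bar>)"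
          by (intro nn_integral_eq_integral int) (simp add: mollifier_nonneg[OF \<rho>(1)])
        also have "\<dots> \<le> ennreal (mollifier \<rho> y * e)"
          using d(2)[of "- y"] True mollifier_nonneg[OF \<rho>(1), of y]
          by (auto intro!: ennreal_leI mult_left_mono)
        finally show ?thesis .
      next
        case False
        then show ?thesis using mollifier_eq_0[OF \<rho>(1), of y] \<rho>(2) by simp
      qed
    qed
    also have "\<dots> = ennreal e"
      using mollifier_integrable[OF \<rho>(1), where 'e='e] mollifier_integral[OF \<rho>(1), where 'e='e]
        e
      by (subst nn_integral_eq_integral) (auto simp: mollifier_nonneg[OF \<rho>(1)])
    finally have le: "(\<integral>\<^sup>+z. ennreal \<bar>mollify \<rho> f z - f z\<bar> \<partial>lborel) \<le> ennreal e" .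
    then have int: "integrable lborel (\<lambda>z. mollify \<rho> f z - f z)"
      by (intro integrableI_bounded) (auto simp: le_less_trans[OF le])
    moreover have "(LBINT z. \<bar>mollify \<rho> f z - f z\<bar>) \<le> e"
    proof -
      have "ennreal (LBINT z. \<bar>mollify \<rho> f z - f z\<bar>) = (\<integral>\<^sup>+z. ennreal \<bar>mollify \<rho> f z - f z\<bar> \<partial>lborel)"
        using int by (intro nn_integral_eq_integral[symmetric]) auto
      then show ?thesis using le e by (metis ennreal_le_iff less_imp_le)
    qed
    ultimately show ?thesis ..
  qed
  then show ?thesis using d(1) by blast
qed

section \<open>Exact solutions with linear flux\<close>

lemma test_function_props:
  fixes \<phi> :: "'e::euclidean_space \<Rightarrow> real"
  assumes "\<phi> \<in> test_functions D"
  shows "\<phi> differentiable at x" "continuous_on UNIV \<phi>"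
    "continuous_on UNIV (\<lambda>x. frechet_derivative \<phi> (at x) v)"
    "\<exists>S. compact S \<and> S \<subseteq> D \<and> (\<forall>x. x \<notin> S \<longrightarrow> \<phi> x = 0 \<and> (\<forall>v. frechet_derivative \<phi> (at x) v = 0))"
proof -
  have "Ck 0 \<phi>" "Ck (Suc 0) \<phi>"
    using assms by (auto simp only: test_functions_def mem_Collect_eq)
  then show "\<phi> differentiable at x" "continuous_on UNIV \<phi>"
    "continuous_on UNIV (\<lambda>x. frechet_derivative \<phi> (at x) v)"
    by auto
  define S where "S = closure {x. \<phi> x \<noteq> 0}"
  have "compact S" "S \<subseteq> D"
    using assms by (auto simp: test_functions_def compactly_contained_def S_def)
  moreover have \<phi>0: "\<phi> x = 0" if "x \<notin> S" for x
    using that closure_subset[of "{x. \<phi> x \<noteq> 0}"] unfolding S_def by blast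
  moreover have "frechet_derivative \<phi> (at x) v = 0" if x: "x \<notin> S" for x v
  proof -
    have "((\<lambda>y::'e. 0::real) has_derivative (\<lambda>v. 0)) (at x)"
      by (rule has_derivative_const)
    then have "(\<phi> has_derivative (\<lambda>v. 0)) (at x)"
    proof (rule has_derivative_transform_within_open)
      show "open (- S)" unfolding S_def by (rule open_Compl[OF closed_closure])
      show "x \<in> - S" using x by simp
      show "0 = \<phi> y" if "y \<in> - S" for y
        using \<phi>0[of y] that by simp
    qed
    from frechet_derivative_at[OF this] show ?thesis
      by (simp only: fun_eq_iff)
  qed
  ultimately show "\<exists>S. compact S \<and> S \<subseteq> D \<and> (\<forall>x. x \<notin> S \<longrightarrow> \<phi> x = 0 \<and> (\<forall>v. frechet_derivative \<phi> (at x) v = 0))"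
    by blast
qed

lemma continuous_compact_support:
  fixes f :: "'e::euclidean_space \<Rightarrow> real"
  assumes "continuous_on UNIV f" "compact S" "\<And>x. x \<notin> S \<Longrightarrow> f x = 0"
  shows "integrable lborel f" "\<exists>M. \<forall>x. \<bar>f x\<bar> \<le> M"
proof -
  have "bounded (f ` S)"
    using assms by (intro compact_imp_bounded compact_continuous_image continuous_on_subset[OF assms(1)]) auto
  then obtain M where "\<And>x. x \<in> S \<Longrightarrow> \<bar>f x\<bar> \<le> M"
    by (metis (no_types, lifting) bounded_iff imageI real_norm_def)
  then have M: "\<bar>f x\<bar> \<le> \<bar>M\<bar>" for x
    using assms(3)[of x] by (cases "x \<in> S") (auto intro: order_trans[OF _ abs_ge_self])
  then show "\<exists>M. \<forall>x. \<bar>f x\<bar> \<le> M" by blast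
  show "integrable lborel f"
    using M assms(3) by (intro integrable_bounded_support[of f S "\<bar>M\<bar>"] borel_measurable_continuous_onI
        assms(1) compact_imp_bounded assms(2)) auto
qed

text \<open>The product F \<phi> has compact support, so the integral of its derivative along v
  vanishes. With v arbitrary, the same statement serves the space slices and the space-time
  directions (e, 0) and (0, 1).\<close>

lemma test_function_by_parts:
  fixes F F' :: "'e::euclidean_space \<Rightarrow> real"
  assumes \<phi>: "\<phi> \<in> test_functions D" and F: "continuous_on UNIV F" "continuous_on UNIV F'"
    and der: "\<And>x. has_dir_deriv F (F' x) v x"
  shows "integrable lborel (\<lambda>x. F x * frechet_derivative \<phi> (at x) v)"
    "integrable lborel (\<lambda>x. F' x * \<phi> x)"
    "(LBINT x. F x * frechet_derivative \<phi> (at x) v) = - (LBINT x. F' x * \<phi> x)"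
proof -
  note tf = test_function_props[OF \<phi>]
  obtain S where S: "compact S" "S \<subseteq> D" "\<And>x. x \<notin> S \<Longrightarrow> \<phi> x = 0"
    "\<And>x v. x \<notin> S \<Longrightarrow> frechet_derivative \<phi> (at x) v = 0"
    using tf(4) by blast
  have c: "continuous_on UNIV (\<lambda>x. F x * frechet_derivative \<phi> (at x) v)"
    "continuous_on UNIV (\<lambda>x. F' x * \<phi> x)" "continuous_on UNIV (\<lambda>x. F x * \<phi> x)"
    using F tf(2,3) by (auto intro!: continuous_intros)
  have 0: "x \<notin> S \<Longrightarrow> F x * frechet_derivative \<phi> (at x) v = 0" "x \<notin> S \<Longrightarrow> F' x * \<phi> x = 0"
    "x \<notin> S \<Longrightarrow> F x * \<phi> x = 0" for x
    using S(3,4) by auto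
  show i: "integrable lborel (\<lambda>x. F x * frechet_derivative \<phi> (at x) v)"
    "integrable lborel (\<lambda>x. F' x * \<phi> x)"
    by (rule continuous_compact_support(1)[OF c(1) S(1) 0(1)] continuous_compact_support(1)[OF c(2) S(1) 0(2)], assumption)+
  obtain M1 where M1: "\<And>x. \<bar>F x * frechet_derivative \<phi> (at x) v\<bar> \<le> M1"
    using continuous_compact_support(2)[OF c(1) S(1) 0(1)] by blast
  obtain M2 where M2: "\<And>x. \<bar>F' x * \<phi> x\<bar> \<le> M2"
    using continuous_compact_support(2)[OF c(2) S(1) 0(2)] by blast
  obtain M3 where M3: "\<And>x. \<bar>F x * \<phi> x\<bar> \<le> M3"
    using continuous_compact_support(2)[OF c(3) S(1) 0(3)] by blast
  have "(LBINT x. F' x * \<phi> x + F x * frechet_derivative \<phi> (at x) v) = 0"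
  proof (rule integral_dir_deriv_eq_0(2)[where P="\<lambda>x. F x * \<phi> x" and S=S and v=v and M=M3 and M'="M2 + M1"])
    show "bounded S" using S(1) compact_imp_bounded by blast
    show "(\<lambda>x. F x * \<phi> x) \<in> borel_measurable borel"
      using c(3) by (rule borel_measurable_continuous_onI)
    show "\<bar>F' x * \<phi> x + F x * frechet_derivative \<phi> (at x) v\<bar> \<le> M2 + M1" for x
      using M1[of x] M2[of x] by linarith
    show "has_dir_deriv (\<lambda>x. F x * \<phi> x) (F' x * \<phi> x + F x * frechet_derivative \<phi> (at x) v) v x" for x
      by (rule has_dir_deriv_mult[OF der dir_deriv_frechet[OF tf(1)]])
  qed (rule M3 0(3), assumption?)+
  then show "(LBINT x. F x * frechet_derivative \<phi> (at x) v) = - (LBINT x. F' x * \<phi> x)"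
    using i by simp
qed

text \<open>The weak formulation is written with iterated set integrals; integration by parts and
  mollification act on one space-time integral. This is the bridge between the two.\<close>

lemma iterated_set_integral:
  fixes F :: "'a::euclidean_space \<times> real \<Rightarrow> real"
  assumes "integrable lborel F" "\<And>x t. x \<notin> U \<or> t \<notin> I \<Longrightarrow> F (x, t) = 0"
  shows "(LINT t:I|lborel. LINT x:U|lborel. F (x, t)) = integral\<^sup>L lborel F"
proof -
  have "(LINT t:I|lborel. LINT x:U|lborel. F (x, t)) = (LBINT t. (LBINT x. F (x, t)))"
    unfolding set_lebesgue_integral_def
  proof (intro Bochner_Integration.integral_cong refl)
    fix t
    have 1: "indicat_real U x *\<^sub>R F (x, t) = F (x, t)" for x
      using assms(2) by (auto simp: indicator_def)
    have 2: "indicat_real I t *\<^sub>R (LBINT x. F (x, t)) = (LBINT x. F (x, t))"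
      using assms(2) by (auto simp: indicator_def)
    show "indicat_real I t *\<^sub>R (LBINT x. indicat_real U x *\<^sub>R F (x, t)) = (LBINT x. F (x, t))"
      by (simp only: 1 2)
  qed
  also have "\<dots> = integral\<^sup>L (lborel \<Otimes>\<^sub>M lborel) (case_prod (\<lambda>x t. F (x, t)))"
    by (rule lborel_pair.integral_snd) (simp add: lborel_prod assms(1))
  finally show ?thesis
    by (simp add: lborel_prod)
qed

lemma norm_powr_eq_inner: "norm (y::'a::euclidean_space) powr q = (y \<bullet> y) powr (q / 2)"
proof -
  have "(y \<bullet> y) powr (q / 2) = ((norm y) powr 2) powr (q / 2)"
    by (simp add: power2_norm_eq_inner[symmetric])
  then show ?thesis by (simp only: powr_powr) simp
qed

text \<open>At the centre the difference quotient is of order |s|^(q - 1) and tends to 0 because q >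
  1. The formula gives 0 there as well, even for q < 2, since x - a vanishes.\<close>

lemma norm_powr_dir_deriv:
  fixes x a :: "'a::euclidean_space"
  assumes q: "q > 1"
  shows "has_dir_deriv (\<lambda>x. norm (x - a) powr q) (q * norm (x - a) powr (q - 2) * ((x - a) \<bullet> v)) v x"
proof (cases "x = a")
  case False
  define y where "y = x - a"
  have pos: "y \<bullet> y > 0" using False by (simp add: y_def)
  have 1: "((\<lambda>s. ((y + s *\<^sub>R v) \<bullet> (y + s *\<^sub>R v)) powr (q / 2)) has_real_derivative
      (q / 2) * (y \<bullet> y) powr (q / 2 - 1) * (2 * (y \<bullet> v))) (at 0)"
  proof -
    have eq: "(y + s *\<^sub>R v) \<bullet> (y + s *\<^sub>R v) = y \<bullet> y + 2 * s * (y \<bullet> v) + s\<^sup>2 * (v \<bullet> v)" for s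
      by (simp add: inner_add_left inner_add_right inner_commute power2_eq_square algebra_simps)
    show ?thesis
      unfolding eq using pos by (auto intro!: derivative_eq_intros)
  qed
  have 2: "(y \<bullet> y) powr (q / 2 - 1) = norm y powr (q - 2)"
    by (simp add: norm_powr_eq_inner diff_divide_distrib)
  have 3: "(\<lambda>s. norm (x + s *\<^sub>R v - a) powr q) = (\<lambda>s. ((y + s *\<^sub>R v) \<bullet> (y + s *\<^sub>R v)) powr (q / 2))"
    by (simp add: y_def norm_powr_eq_inner algebra_simps)
  have 4: "(q / 2) * (y \<bullet> y) powr (q / 2 - 1) * (2 * (y \<bullet> v)) = q * norm (x - a) powr (q - 2) * ((x - a) \<bullet> v)"
    unfolding 2 by (simp add: y_def)
  show ?thesis
    using 1 unfolding has_dir_deriv_def 3 4 .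
next
  case True
  have "((\<lambda>s. norm v powr q * \<bar>s\<bar> powr (q - 1)) \<longlongrightarrow> norm v powr q * \<bar>0\<bar> powr (q - 1)) (at (0::real))"
    using q by (intro tendsto_intros tendsto_powr') auto
  then have "((\<lambda>s. norm (s *\<^sub>R v) powr q / s) \<longlongrightarrow> 0) (at 0)"
  proof (intro Lim_null_comparison[of "\<lambda>s. norm (s *\<^sub>R v) powr q / s" "\<lambda>s. norm v powr q * \<bar>s\<bar> powr (q - 1)"] eventuallyI)
    fix s :: real
    show "norm (norm (s *\<^sub>R v) powr q / s) \<le> norm v powr q * \<bar>s\<bar> powr (q - 1)"
      by (cases "s = 0") (auto simp: powr_mult powr_diff abs_divide mult.commute)
  qed simp
  then show ?thesis
    using True by (simp add: has_dir_deriv_def DERIV_def)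
qed

lemma continuous_norm_powr:
  assumes "q > 0"
  shows "continuous_on S (\<lambda>x::'a::euclidean_space. norm (x - a) powr q)"
  using assms by (intro continuous_on_powr' continuous_intros) auto

section \<open>Exact solutions and the linearity of their flux\<close>

definition flux_coeff :: "real \<Rightarrow> real \<Rightarrow> real" where
  "flux_coeff p \<gamma> = \<bar>p / (p - 1) * \<gamma>\<bar> powr (p - 2) * (p / (p - 1) * \<gamma>)"

text \<open>The flux of \<gamma> |x - a|^q is \<open>flux_coeff p \<gamma>\<close> times x - a,
  whose divergence is the constant \<open>real DIM('a) * flux_coeff p \<gamma>\<close>; this is the
  slope in time.\<close>

definition exact_sol :: "real \<Rightarrow> real \<Rightarrow> real \<Rightarrow> 'a::euclidean_space \<Rightarrow> 'a \<times> real \<Rightarrow> real" where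
  "exact_sol p b \<gamma> a z =
     b + real DIM('a) * flux_coeff p \<gamma> * snd z + \<gamma> * norm (fst z - a) powr (p / (p - 1))"

definition exact_grad :: "real \<Rightarrow> real \<Rightarrow> 'a::euclidean_space \<Rightarrow> 'a \<Rightarrow> 'a" where
  "exact_grad p \<gamma> a x = (p / (p - 1) * \<gamma> * norm (x - a) powr (p / (p - 1) - 2)) *\<^sub>R (x - a)"

context
  fixes p :: real
  assumes p: "p > 2"
begin

lemma exponent_gt_1: "p / (p - 1) > 1"
  using p by simp

lemma norm_exact_grad: "norm (exact_grad p \<gamma> a x) = \<bar>p / (p - 1) * \<gamma>\<bar> * norm (x - a) powr (p / (p - 1) - 1)"
proof -
  have "norm (x - a) powr (p / (p - 1) - 2) * norm (x - a) = norm (x - a) powr (1 + (p / (p - 1) - 2))"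
    by (subst mult.commute) (simp only: powr_mult_base norm_ge_zero)
  then show ?thesis by (simp add: exact_grad_def abs_mult)
qed

text \<open>For q = p/(p - 1) the powers of |x - a| cancel: (q - 1)(p - 2) + (q - 2) = 0.\<close>

lemma exact_grad_flux:
  "norm (exact_grad p \<gamma> a x) powr (p - 2) *\<^sub>R exact_grad p \<gamma> a x = flux_coeff p \<gamma> *\<^sub>R (x - a)"
proof (cases "x = a")
  case False
  let ?r = "norm (x - a)" and ?q = "p / (p - 1)"
  have r: "?r > 0" using False by simp
  have "(?q - 1) * (p - 2) + (?q - 2) = 0"
    using p by (simp add: field_simps)
  then have "?r powr ((?q - 1) * (p - 2)) * ?r powr (?q - 2) = 1"
    using r by (simp add: powr_add[symmetric])
  moreover have "norm (exact_grad p \<gamma> a x) powr (p - 2) = \<bar>?q * \<gamma>\<bar> powr (p - 2) * ?r powr ((?q - 1) * (p - 2))"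
    unfolding norm_exact_grad by (subst powr_mult) (simp_all only: powr_powr abs_ge_zero powr_ge_zero)
  ultimately show ?thesis
    by (simp add: exact_grad_def flux_coeff_def algebra_simps)
qed (simp add: exact_grad_def)

text \<open>The factor |x - a|^(q - 2) is singular at the centre because q < 2, so continuity there
  comes from the norm, a multiple of |x - a|^(q - 1).\<close>

lemma continuous_exact_grad: "continuous_on S (exact_grad p \<gamma> a)"
proof (rule continuous_at_imp_continuous_on, intro ballI)
  fix x :: 'a
  show "isCont (exact_grad p \<gamma> a) x"
  proof (cases "x = a")
    case False
    then show ?thesis
      unfolding exact_grad_def by (intro continuous_intros) auto
  next
    case True
    have "continuous_on UNIV (\<lambda>x. \<bar>p / (p - 1) * \<gamma>\<bar> * norm (x - a) powr (p / (p - 1) - 1))"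
      using exponent_gt_1 by (intro continuous_intros continuous_norm_powr) auto
    then have "isCont (\<lambda>x. norm (exact_grad p \<gamma> a x)) x"
      by (simp add: norm_exact_grad continuous_on_eq_continuous_at)
    moreover have "exact_grad p \<gamma> a x = 0"
      using True by (simp add: exact_grad_def)
    ultimately show ?thesis
      unfolding isCont_def by (metis norm_zero tendsto_norm_zero_cancel)
  qed
qed

lemma continuous_exact_sol: "continuous_on S (exact_sol p b \<gamma> a)"
  unfolding exact_sol_def using exponent_gt_1
  by (intro continuous_intros continuous_on_compose2[OF continuous_norm_powr[of "p / (p - 1)" UNIV a]]) auto

lemma exact_sol_space_deriv:
  "has_dir_deriv (exact_sol p b \<gamma> (a::'a::euclidean_space)) (exact_grad p \<gamma> a (fst z) \<bullet> v) (v, 0) z"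
proof -
  have "has_dir_deriv (\<lambda>x. norm (x - a) powr (p / (p - 1)))
      (p / (p - 1) * norm (fst z - a) powr (p / (p - 1) - 2) * ((fst z - a) \<bullet> v)) v (fst z)"
    by (rule norm_powr_dir_deriv[OF exponent_gt_1])
  then have "((\<lambda>s. (b + real DIM('a) * flux_coeff p \<gamma> * snd z) + \<gamma> * norm (fst z + s *\<^sub>R v - a) powr (p / (p - 1)))
      has_real_derivative 0 + \<gamma> * (p / (p - 1) * norm (fst z - a) powr (p / (p - 1) - 2) * ((fst z - a) \<bullet> v))) (at 0)"
    unfolding has_dir_deriv_def by (intro DERIV_add DERIV_const DERIV_cmult)
  moreover have "0 + \<gamma> * (p / (p - 1) * norm (fst z - a) powr (p / (p - 1) - 2) * ((fst z - a) \<bullet> v)) =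
      exact_grad p \<gamma> a (fst z) \<bullet> v"
    by (simp add: exact_grad_def)
  ultimately show ?thesis
    by (simp only: has_dir_deriv_def exact_sol_def fst_add snd_add fst_scaleR snd_scaleR fst_conv snd_conv
        scaleR_zero_right add_0_right)
qed

lemma exact_sol_slice_deriv: "has_dir_deriv (\<lambda>x. exact_sol p b \<gamma> a (x, t)) (exact_grad p \<gamma> a x \<bullet> v) v x"
  using exact_sol_space_deriv[of b \<gamma> a "(x, t)" v] by (simp add: has_dir_deriv_def)

lemma exact_sol_time_deriv:
  "has_dir_deriv (exact_sol p b \<gamma> (a::'a::euclidean_space)) (real DIM('a) * flux_coeff p \<gamma>) (0, 1) z"
  unfolding has_dir_deriv_def exact_sol_def by (auto intro!: derivative_eq_intros)

lemma continuous_set_integrable: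
  fixes f :: "'e::euclidean_space \<Rightarrow> real"
  assumes "continuous_on UNIV f" "open S" "bounded S"
  shows "set_integrable lborel S f"
proof (rule set_integrable_subset)
  show "set_integrable lborel (closure S) f"
    unfolding set_integrable_def using assms
    by (intro borel_integrable_compact continuous_on_subset[OF assms(1)]) auto
qed (use assms closure_subset in auto)

lemma continuous_in_Lp:
  fixes f :: "'e::euclidean_space \<Rightarrow> 'b::euclidean_space"
  assumes "continuous_on UNIV f" "open S" "bounded S"
  shows "in_Lp p S f"
  unfolding in_Lp_def
proof
  have [measurable]: "f \<in> borel_measurable borel" "S \<in> sets borel"
    using assms by (auto intro: borel_measurable_continuous_onI)
  show "set_borel_measurable lborel S f"
    unfolding set_borel_measurable_def by measurable
  show "set_integrable lborel S (\<lambda>x. norm (f x) powr p)"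
    using p by (intro continuous_set_integrable assms continuous_on_powr' continuous_intros) auto
qed

text \<open>The function is affine in time, so its squared L^2 norm over U is a quadratic polynomial
  in t. Integrating the linear flux by parts contributes one copy of
  \<open>flux_coeff p \<gamma>\<close> per basis vector, and the sum matches the time term.\<close>

lemma p_parabolic_exact_sol: "p_parabolic p \<Theta> (exact_sol p b \<gamma> (a::'a::euclidean_space))"
  unfolding p_parabolic_def
proof (intro conjI allI impI)
  show "continuous_on \<Theta> (exact_sol p b \<gamma> a)" by (rule continuous_exact_sol)
  fix U :: "'a set" and t1 t2 :: real
  assume "open U \<and> t1 < t2 \<and> compactly_contained (U \<times> {t1<..<t2}) \<Theta>"
  then have U: "open U" and t: "t1 < t2" and "bounded (U \<times> {t1<..<t2})"
    by (auto simp: compactly_contained_def compact_closure)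
  then have bU: "bounded U"
    using bounded_fst[of "U \<times> {t1<..<t2}"] t by (simp add: fst_image_times)
  have op: "open (U \<times> {t1<..<t2})" using U by (simp add: open_Times)
  have bd: "bounded (U \<times> {t1<..<t2})" using bU by (simp add: bounded_Times)
  define F where "F = (\<lambda>x. b + \<gamma> * norm (x - a) powr (p / (p - 1)))"
  define c where "c = real DIM('a) * flux_coeff p \<gamma>"
  have contF: "continuous_on UNIV F"
    unfolding F_def using exponent_gt_1 by (intro continuous_intros continuous_norm_powr) auto
  have "continuous_on {t1..t2} (\<lambda>t. (LINT x:U|lborel. (F x)\<^sup>2) + 2 * c * t * (LINT x:U|lborel. F x)
      + c\<^sup>2 * t\<^sup>2 * (LINT x:U|lborel. 1))"
    by (intro continuous_intros)
  moreover have "(LINT x:U|lborel. \<bar>exact_sol p b \<gamma> a (x, t)\<bar>\<^sup>2) =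
      (LINT x:U|lborel. (F x)\<^sup>2) + 2 * c * t * (LINT x:U|lborel. F x) + c\<^sup>2 * t\<^sup>2 * (LINT x:U|lborel. 1)" for t
  proof -
    have i: "set_integrable lborel U (\<lambda>x. (F x)\<^sup>2)" "set_integrable lborel U F" "set_integrable lborel U (\<lambda>x. 1::real)"
      using contF U bU by (auto intro!: continuous_set_integrable continuous_intros)
    have "(LINT x:U|lborel. \<bar>exact_sol p b \<gamma> a (x, t)\<bar>\<^sup>2) =
        (LINT x:U|lborel. (F x)\<^sup>2 + 2 * c * t * F x + c\<^sup>2 * t\<^sup>2 * 1)"
      by (simp add: exact_sol_def F_def c_def power2_eq_square algebra_simps)
    also have "\<dots> = (LINT x:U|lborel. (F x)\<^sup>2 + 2 * c * t * F x) + (LINT x:U|lborel. c\<^sup>2 * t\<^sup>2 * 1)"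
      using i by (intro set_integral_add set_integrable_mult_right) auto
    also have "(LINT x:U|lborel. (F x)\<^sup>2 + 2 * c * t * F x) = (LINT x:U|lborel. (F x)\<^sup>2) + (LINT x:U|lborel. 2 * c * t * F x)"
      using i by (intro set_integral_add set_integrable_mult_right) auto
    finally show ?thesis by (simp only: set_integral_mult_right)
  qed
  ultimately show "continuous_on {t1..t2} (\<lambda>t. LINT x:U|lborel. \<bar>exact_sol p b \<gamma> a (x, t)\<bar>\<^sup>2)"
    by simp
  define g where "g = (\<lambda>z::'a \<times> real. exact_grad p \<gamma> a (fst z))"
  have contg: "continuous_on UNIV g"
    unfolding g_def by (intro continuous_on_compose2[OF continuous_exact_grad[of UNIV]] continuous_intros) auto
  have slice: "sobolev_with_gradient p U (\<lambda>x. exact_sol p b \<gamma> a (x, t)) (\<lambda>x. g (x, t))" for t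
    unfolding sobolev_with_gradient_def
  proof (intro conjI ballI)
    have cs: "continuous_on UNIV (\<lambda>x. exact_sol p b \<gamma> a (x, t))" "continuous_on UNIV (\<lambda>x. g (x, t))"
      using continuous_exact_sol continuous_exact_grad
      by (auto simp: g_def intro!: continuous_on_compose2[OF continuous_exact_sol[of UNIV]] continuous_intros)
    then show "in_Lp p U (\<lambda>x. exact_sol p b \<gamma> a (x, t))" "in_Lp p U (\<lambda>x. g (x, t))"
      using U bU by (auto intro: continuous_in_Lp)
    fix \<phi> :: "'a \<Rightarrow> real" and e :: 'a
    assume \<phi>: "\<phi> \<in> test_functions U"
    have z: "\<phi> x = 0" "frechet_derivative \<phi> (at x) e = 0" if "x \<notin> U" for x
      using test_function_props(4)[OF \<phi>] that by blast+
    have "continuous_on UNIV (\<lambda>x. g (x, t) \<bullet> e)"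
      using cs(2) by (intro continuous_intros)
    then have 1: "(LBINT x. exact_sol p b \<gamma> a (x, t) * frechet_derivative \<phi> (at x) e) = - (LBINT x. (g (x, t) \<bullet> e) * \<phi> x)"
      using exact_sol_slice_deriv by (intro test_function_by_parts(3)[OF \<phi> cs(1)]) (auto simp: g_def)
    have 2: "indicat_real U x *\<^sub>R (exact_sol p b \<gamma> a (x, t) * frechet_derivative \<phi> (at x) e) = exact_sol p b \<gamma> a (x, t) * frechet_derivative \<phi> (at x) e"
      "indicat_real U x *\<^sub>R ((g (x, t) \<bullet> e) * \<phi> x) = (g (x, t) \<bullet> e) * \<phi> x" for x
      using z by (auto simp: indicator_def)
    show "(LINT x:U|lborel. exact_sol p b \<gamma> a (x, t) * frechet_derivative \<phi> (at x) e) =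
        - (LINT x:U|lborel. (g (x, t) \<bullet> e) * \<phi> x)"
      by (simp only: set_lebesgue_integral_def 1 2)
  qed
  have weak: "(LINT t:{t1<..<t2}|lborel. LINT x:U|lborel.
                 (norm (g (x, t)) powr (p - 2) *\<^sub>R g (x, t)) \<bullet> space_gradient \<phi> (x, t))
            - (LINT t:{t1<..<t2}|lborel. LINT x:U|lborel.
                 exact_sol p b \<gamma> a (x, t) * time_derivative \<phi> (x, t)) = 0"
    if \<phi>: "\<phi> \<in> test_functions (U \<times> {t1<..<t2})" for \<phi>
  proof -
    have z: "frechet_derivative \<phi> (at (x, t)) v = 0" if "x \<notin> U \<or> t \<notin> {t1<..<t2}" for x t v
      using test_function_props(4)[OF \<phi>] that by blast
    have bp: "integrable lborel (\<lambda>z. (flux_coeff p \<gamma> * ((fst z - a) \<bullet> e)) * frechet_derivative \<phi> (at z) (e, 0))"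
      "(LBINT z. (flux_coeff p \<gamma> * ((fst z - a) \<bullet> e)) * frechet_derivative \<phi> (at z) (e, 0))
        = - (LBINT z. flux_coeff p \<gamma> * \<phi> z)" if "e \<in> Basis" for e
    proof -
      have d: "has_dir_deriv (\<lambda>z. flux_coeff p \<gamma> * ((fst z - a) \<bullet> e)) (flux_coeff p \<gamma>) (e, 0) z" for z
        unfolding has_dir_deriv_def using that
        by (auto intro!: derivative_eq_intros simp: inner_diff_left inner_add_left inner_Basis)
      have c: "continuous_on UNIV (\<lambda>z. flux_coeff p \<gamma> * ((fst z - a) \<bullet> e))"
        by (intro continuous_intros)
      show "integrable lborel (\<lambda>z. (flux_coeff p \<gamma> * ((fst z - a) \<bullet> e)) * frechet_derivative \<phi> (at z) (e, 0))"
        "(LBINT z. (flux_coeff p \<gamma> * ((fst z - a) \<bullet> e)) * frechet_derivative \<phi> (at z) (e, 0))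
        = - (LBINT z. flux_coeff p \<gamma> * \<phi> z)"
        by (rule test_function_by_parts(1,3)[OF \<phi> c continuous_on_const d])+
    qed
    have eq: "(norm (g z) powr (p - 2) *\<^sub>R g z) \<bullet> space_gradient \<phi> z =
        (\<Sum>e\<in>Basis. (flux_coeff p \<gamma> * ((fst z - a) \<bullet> e)) * frechet_derivative \<phi> (at z) (e, 0))" for z
      unfolding g_def exact_grad_flux space_gradient_def
      by (simp add: inner_sum_right sum_distrib_left algebra_simps)
    have "(LINT t:{t1<..<t2}|lborel. LINT x:U|lborel.
                 (norm (g (x, t)) powr (p - 2) *\<^sub>R g (x, t)) \<bullet> space_gradient \<phi> (x, t)) =
        (LBINT z. (\<Sum>e\<in>Basis. (flux_coeff p \<gamma> * ((fst z - a) \<bullet> e)) * frechet_derivative \<phi> (at z) (e, 0)))"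
      unfolding eq
      by (intro iterated_set_integral[where F="\<lambda>z. \<Sum>e\<in>Basis. (flux_coeff p \<gamma> * ((fst z - a) \<bullet> e)) * frechet_derivative \<phi> (at z) (e, 0)"]
          Bochner_Integration.integrable_sum bp(1)) (auto simp: z)
    also have "\<dots> = (\<Sum>e\<in>(Basis::'a set). - (LBINT z. flux_coeff p \<gamma> * \<phi> z))"
      using bp by (subst Bochner_Integration.integral_sum) auto
    also have "\<dots> = - (LBINT z. c * \<phi> z)"
      by (simp add: c_def mult.assoc)
    finally have 1: "(LINT t:{t1<..<t2}|lborel. LINT x:U|lborel.
                 (norm (g (x, t)) powr (p - 2) *\<^sub>R g (x, t)) \<bullet> space_gradient \<phi> (x, t)) = - (LBINT z. c * \<phi> z)" .
    note bt = test_function_by_parts[OF \<phi> continuous_exact_sol[of UNIV b \<gamma> a] continuous_on_const exact_sol_time_deriv]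
    have "(LINT t:{t1<..<t2}|lborel. LINT x:U|lborel. exact_sol p b \<gamma> a (x, t) * time_derivative \<phi> (x, t)) =
        (LBINT z. exact_sol p b \<gamma> a z * frechet_derivative \<phi> (at z) (0, 1))"
      unfolding time_derivative_def
      by (intro iterated_set_integral[where F="\<lambda>z. exact_sol p b \<gamma> a z * frechet_derivative \<phi> (at z) (0, 1)"] bt(1)) (auto simp: z)
    then show ?thesis
      using 1 bt(3) by (simp add: c_def)
  qed
  show "\<exists>g. parabolic_sobolev_with_gradient p U t1 t2 (exact_sol p b \<gamma> a) g \<and>
        (\<forall>\<phi>\<in>test_functions (U \<times> {t1<..<t2}).
           (LINT t:{t1<..<t2}|lborel. LINT x:U|lborel.
              (norm (g (x, t)) powr (p - 2) *\<^sub>R g (x, t)) \<bullet> space_gradient \<phi> (x, t))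
         - (LINT t:{t1<..<t2}|lborel. LINT x:U|lborel.
              exact_sol p b \<gamma> a (x, t) * time_derivative \<phi> (x, t)) = 0)"
  proof (intro exI[of _ g] conjI ballI weak)
    show "parabolic_sobolev_with_gradient p U t1 t2 (exact_sol p b \<gamma> a) g"
      unfolding parabolic_sobolev_with_gradient_def
      using slice by (intro conjI continuous_in_Lp contg op bd continuous_exact_sol) simp
  qed
qed

end

section \<open>The energy identity\<close>

text \<open>From degree 2 on, powers of a positive part are differentiable across 0, so the
  truncations used for testing need no level-set argument.\<close>

lemma max_power_deriv:
  assumes "m \<ge> 1"
  shows "((\<lambda>s::real. (max 0 s) ^ Suc m) has_real_derivative real (Suc m) * (max 0 s) ^ m) (at s)"
proof -
  consider "s > 0" | "s < 0" | "s = 0" by linarith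
  then show ?thesis
  proof cases
    case 1
    have "((\<lambda>s::real. s ^ Suc m) has_real_derivative real (Suc m) * (max 0 s) ^ m) (at s)"
      using 1 DERIV_pow[of "Suc m" s UNIV] by simp
    then show ?thesis
      by (rule has_field_derivative_transform_within_open[of _ _ _ "{0<..}"]) (use 1 in auto)
  next
    case 2
    have "((\<lambda>s::real. 0) has_real_derivative real (Suc m) * (max 0 s) ^ m) (at s)"
      using 2 assms by (simp add: max_def power_0_left)
    then show ?thesis
      by (rule has_field_derivative_transform_within_open[of _ _ _ "{..<0}"]) (use 2 in auto)
  next
    case 3
    have "((\<lambda>s::real. \<bar>s\<bar> ^ m) \<longlongrightarrow> \<bar>0\<bar> ^ m) (at 0)"
      by (intro tendsto_intros)
    moreover have "\<bar>0::real\<bar> ^ m = 0"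
      using assms by (simp add: power_0_left)
    ultimately have lim: "((\<lambda>s::real. \<bar>s\<bar> ^ m) \<longlongrightarrow> 0) (at 0)"
      by (simp only:)
    have "((\<lambda>s::real. (max 0 s) ^ Suc m / s) \<longlongrightarrow> 0) (at 0)"
    proof (rule Lim_null_comparison[OF _ lim], rule always_eventually, rule allI)
      fix s :: real
      show "norm ((max 0 s) ^ Suc m / s) \<le> \<bar>s\<bar> ^ m"
        by (cases "s > 0") (auto simp: max_def)
    qed
    then show ?thesis
      using 3 assms by (simp add: DERIV_def power_0_left)
  qed
qed

text \<open>Fatou for integrands without a common lower bound: it is applied to Y n + \<Lambda> n,
  and the moving correction is removed afterwards because the integrals of \<Lambda> n converge to
  the integral of the limit.\<close>

lemma integral_limit_nonneg:
  fixes Y \<Lambda> :: "nat \<Rightarrow> 'e \<Rightarrow> real"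
  assumes Y: "\<And>n. integrable M (Y n)" and \<Lambda>: "\<And>n. integrable M (\<Lambda> n)" "integrable M \<Lambda>'"
    and nonneg: "\<And>n x. Y n x + \<Lambda> n x \<ge> 0"
    and lim: "AE x in M. (\<lambda>n. Y n x) \<longlonglongrightarrow> Y' x" "AE x in M. (\<lambda>n. \<Lambda> n x) \<longlonglongrightarrow> \<Lambda>' x"
    and Y': "AE x in M. Y' x \<ge> 0" "\<And>x. \<Lambda>' x \<ge> 0"
    and int: "(\<lambda>n. integral\<^sup>L M (\<Lambda> n)) \<longlonglongrightarrow> integral\<^sup>L M \<Lambda>'" "(\<lambda>n. integral\<^sup>L M (Y n)) \<longlonglongrightarrow> L"
  shows "L \<ge> 0"
proof -
  have "ennreal (integral\<^sup>L M \<Lambda>') = (\<integral>\<^sup>+x. ennreal (\<Lambda>' x) \<partial>M)"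
    using \<Lambda>(2) Y'(2) by (intro nn_integral_eq_integral[symmetric]) auto
  also have "\<dots> \<le> (\<integral>\<^sup>+x. liminf (\<lambda>n. ennreal (Y n x + \<Lambda> n x)) \<partial>M)"
  proof (rule nn_integral_mono_AE)
    show "AE x in M. ennreal (\<Lambda>' x) \<le> liminf (\<lambda>n. ennreal (Y n x + \<Lambda> n x))"
      using lim Y'(1)
    proof eventually_elim
      case (elim x)
      have "(\<lambda>n. ennreal (Y n x + \<Lambda> n x)) \<longlonglongrightarrow> ennreal (Y' x + \<Lambda>' x)"
        using elim by (intro tendsto_ennrealI tendsto_add)
      then have "liminf (\<lambda>n. ennreal (Y n x + \<Lambda> n x)) = ennreal (Y' x + \<Lambda>' x)"
        by (intro lim_imp_Liminf) auto
      then show ?case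
        using elim(3) by (simp add: ennreal_leI)
    qed
  qed
  also have "\<dots> \<le> liminf (\<lambda>n. \<integral>\<^sup>+x. ennreal (Y n x + \<Lambda> n x) \<partial>M)"
    using Y \<Lambda>(1) by (intro nn_integral_liminf) (auto intro!: borel_measurable_integrable)
  also have "(\<lambda>n. \<integral>\<^sup>+x. ennreal (Y n x + \<Lambda> n x) \<partial>M) = (\<lambda>n. ennreal (integral\<^sup>L M (Y n) + integral\<^sup>L M (\<Lambda> n)))"
  proof
    fix n
    have "(\<integral>\<^sup>+x. ennreal (Y n x + \<Lambda> n x) \<partial>M) = ennreal (\<integral>x. Y n x + \<Lambda> n x \<partial>M)"
      using Y \<Lambda>(1) nonneg by (intro nn_integral_eq_integral) auto
    then show "(\<integral>\<^sup>+x. ennreal (Y n x + \<Lambda> n x) \<partial>M) = ennreal (integral\<^sup>L M (Y n) + integral\<^sup>L M (\<Lambda> n))"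
      using Y \<Lambda>(1) by simp
  qed
  also have "liminf (\<lambda>n. ennreal (integral\<^sup>L M (Y n) + integral\<^sup>L M (\<Lambda> n))) = ennreal (L + integral\<^sup>L M \<Lambda>')"
    using int by (intro lim_imp_Liminf tendsto_ennrealI tendsto_add) auto
  finally have "ennreal (integral\<^sup>L M \<Lambda>') \<le> ennreal (L + integral\<^sup>L M \<Lambda>')" .
  moreover have "L + integral\<^sup>L M \<Lambda>' \<ge> 0"
  proof (rule LIMSEQ_le_const)
    show "(\<lambda>n. integral\<^sup>L M (Y n) + integral\<^sup>L M (\<Lambda> n)) \<longlonglongrightarrow> L + integral\<^sup>L M \<Lambda>'"
      using int by (intro tendsto_add) auto
    have "integral\<^sup>L M (Y n) + integral\<^sup>L M (\<Lambda> n) \<ge> 0" for n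
    proof -
      have "(\<integral>x. Y n x + \<Lambda> n x \<partial>M) \<ge> 0"
        by (rule Bochner_Integration.integral_nonneg[OF nonneg])
      then show ?thesis using Y \<Lambda>(1) by simp
    qed
    then show "\<exists>N. \<forall>n\<ge>N. 0 \<le> integral\<^sup>L M (Y n) + integral\<^sup>L M (\<Lambda> n)" by blast
  qed
  ultimately show ?thesis by (simp add: ennreal_le_iff)
qed

text \<open>For a probability density \<eta> the product of two averages is a double average of
  \<open>\<alpha> y * \<beta> y'\<close>. Averaging the two-point bound in y and then in y' gives
  the factor 2. It plays the part of Hoelder's inequality for mollified gradients and
  fluxes.\<close>

lemma integral_product_le:
  fixes \<eta> \<alpha> \<beta> A :: "'e \<Rightarrow> real"
  assumes \<eta>: "integrable M \<eta>" "integral\<^sup>L M \<eta> = 1" "\<And>y. \<eta> y \<ge> 0"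
    and i: "integrable M (\<lambda>y. \<eta> y * \<alpha> y)" "integrable M (\<lambda>y. \<eta> y * \<beta> y)" "integrable M (\<lambda>y. \<eta> y * A y)"
    and le: "\<And>y y'. \<alpha> y * \<beta> y' \<le> c * (A y + A y')"
  shows "(\<integral>y. \<eta> y * \<alpha> y \<partial>M) * (\<integral>y. \<eta> y * \<beta> y \<partial>M) \<le> 2 * c * (\<integral>y. \<eta> y * A y \<partial>M)"
proof -
  let ?a = "\<integral>y. \<eta> y * \<alpha> y \<partial>M" and ?A = "\<integral>y. \<eta> y * A y \<partial>M"
  have 1: "?a * \<beta> y' \<le> c * (?A + A y')" for y'
  proof -
    have "?a * \<beta> y' = (\<integral>y. (\<eta> y * \<alpha> y) * \<beta> y' \<partial>M)" by simp
    also have "\<dots> \<le> (\<integral>y. c * (\<eta> y * A y) + (c * A y') * \<eta> y \<partial>M)"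
    proof (rule integral_mono)
      show "(\<eta> y * \<alpha> y) * \<beta> y' \<le> c * (\<eta> y * A y) + (c * A y') * \<eta> y" for y
        using mult_left_mono[OF le[of y y'] \<eta>(3)[of y]] by (simp add: algebra_simps)
    qed (use i \<eta> in auto)
    also have "\<dots> = c * (?A + A y')"
      using i \<eta> by (simp add: algebra_simps)
    finally show ?thesis .
  qed
  have "?a * (\<integral>y. \<eta> y * \<beta> y \<partial>M) = (\<integral>y. ?a * (\<eta> y * \<beta> y) \<partial>M)" by simp
  also have "\<dots> \<le> (\<integral>y. (c * ?A) * \<eta> y + c * (\<eta> y * A y) \<partial>M)"
  proof (rule integral_mono)
    show "?a * (\<eta> y * \<beta> y) \<le> (c * ?A) * \<eta> y + c * (\<eta> y * A y)" for y
      using mult_left_mono[OF 1[of y] \<eta>(3)[of y]] by (simp add: algebra_simps)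
  qed (use i \<eta> in auto)
  also have "\<dots> = 2 * c * ?A"
    using i \<eta> by simp
  finally show ?thesis .
qed

text \<open>Cauchy-Schwarz reduces the claim to a = |u|, b = |v|, A = a^(p-2) and B = b^(p-2). What
  remains splits into a multiple of (a - b)(A - B) and a multiple of (a - b)^2, both nonnegative
  because A and B are ordered like a and b.\<close>

lemma flux_monotone:
  fixes u v :: "'a::euclidean_space"
  assumes "p > 2"
  shows "(u - v) \<bullet> (norm u powr (p - 2) *\<^sub>R u - norm v powr (p - 2) *\<^sub>R v) \<ge> 0"
proof -
  let ?a = "norm u" and ?b = "norm v" and ?A = "norm u powr (p - 2)" and ?B = "norm v powr (p - 2)"
  have mono: "(?a - ?b) * (?A - ?B) \<ge> 0"
    using assms powr_mono2[of "p - 2" ?a ?b] powr_mono2[of "p - 2" ?b ?a]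
    by (cases "?a \<le> ?b") (auto intro: mult_nonneg_nonneg mult_nonpos_nonpos)
  have cs: "u \<bullet> v \<le> ?a * ?b" by (rule norm_cauchy_schwarz)
  have "(u - v) \<bullet> (?A *\<^sub>R u - ?B *\<^sub>R v) = ?A * ?a\<^sup>2 + ?B * ?b\<^sup>2 - (?A + ?B) * (u \<bullet> v)"
    by (simp add: inner_diff_left inner_diff_right power2_norm_eq_inner inner_commute algebra_simps)
  also have "\<dots> \<ge> ?A * ?a\<^sup>2 + ?B * ?b\<^sup>2 - (?A + ?B) * (?a * ?b)"
    using mult_left_mono[OF cs, of "?A + ?B"] by simp
  also have "?A * ?a\<^sup>2 + ?B * ?b\<^sup>2 - (?A + ?B) * (?a * ?b) = (?a - ?b) * (?A - ?B) * ((?a + ?b) / 2) + (?A + ?B) / 2 * (?a - ?b)\<^sup>2"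
    by (simp add: field_simps power2_eq_square)
  also have "\<dots> \<ge> 0" using mono by simp
  finally show ?thesis .
qed

section \<open>Bounded functions and the tested divergence identity\<close>

definition bounded_fun_on :: "'e set \<Rightarrow> ('e \<Rightarrow> real) \<Rightarrow> bool" where
  "bounded_fun_on S f \<longleftrightarrow> (\<exists>M. \<forall>z\<in>S. \<bar>f z\<bar> \<le> M)"

lemma bounded_fun_on_add: "bounded_fun_on S f \<Longrightarrow> bounded_fun_on S g \<Longrightarrow> bounded_fun_on S (\<lambda>z. f z + g z)"
  unfolding bounded_fun_on_def by (meson abs_triangle_ineq add_mono order_trans)

lemma bounded_fun_on_mult: "bounded_fun_on S f \<Longrightarrow> bounded_fun_on S g \<Longrightarrow> bounded_fun_on S (\<lambda>z. f z * g z)"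
  unfolding bounded_fun_on_def abs_mult by (meson abs_ge_zero mult_mono order_trans)

lemma bounded_fun_on_diff: "bounded_fun_on S f \<Longrightarrow> bounded_fun_on S g \<Longrightarrow> bounded_fun_on S (\<lambda>z. f z - g z)"
  unfolding bounded_fun_on_def by (meson abs_triangle_ineq4 add_mono order_trans)

lemma bounded_fun_on_compose:
  assumes "bounded_fun_on S f" "continuous_on UNIV \<psi>"
  shows "bounded_fun_on S (\<lambda>z. \<psi> (f z))"
proof -
  obtain M where M: "\<And>z. z \<in> S \<Longrightarrow> \<bar>f z\<bar> \<le> M"
    using assms(1) by (auto simp: bounded_fun_on_def)
  have "bounded (\<psi> ` {- M..M})"
    by (intro compact_imp_bounded compact_continuous_image continuous_on_subset[OF assms(2)]) auto
  then obtain B where "\<And>s. s \<in> {- M..M} \<Longrightarrow> \<bar>\<psi> s\<bar> \<le> B"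
    by (metis (no_types, lifting) bounded_iff imageI real_norm_def)
  then have "\<bar>\<psi> (f z)\<bar> \<le> B" if "z \<in> S" for z
    using M[OF that] by (auto simp: abs_le_iff)
  then show ?thesis by (auto simp: bounded_fun_on_def)
qed

lemma bounded_fun_on_continuous:
  fixes f :: "'e::euclidean_space \<Rightarrow> real"
  assumes "bounded S" "continuous_on UNIV f"
  shows "bounded_fun_on S f"
proof -
  have "bounded (f ` closure S)"
    using assms by (intro compact_imp_bounded compact_continuous_image continuous_on_subset[OF assms(2)]) auto
  then have "bounded (f ` S)"
    by (rule bounded_subset) (use closure_subset in blast)
  then show ?thesis
    unfolding bounded_fun_on_def bounded_iff by auto
qed

text \<open>
  The divergence identity tested with \<open>\<kappa>(t) \<psi>(W)\<close>, where \<open>\<kappa>(t) = (T - t)\<^sub>+\<^sup>2\<close> and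
  \<open>\<psi>(s) = 3 (s - e)\<^sub>+\<^sup>2\<close>; the hypothesis on \<open>E\<close> makes the tested functions vanish near the
  boundary of \<open>D\<close>.
\<close>

lemma energy_identity:
  fixes W Wt :: "'a::euclidean_space \<times> real \<Rightarrow> real" and Wx J Jx :: "'a \<Rightarrow> 'a \<times> real \<Rightarrow> real"
    and D E :: "('a \<times> real) set" and T e :: real
  defines "A \<equiv> \<lambda>z. indicator D z * ((- 2 * max 0 (T - snd z)) * (max 0 (W z - e)) ^ 3)"
    and "B \<equiv> \<lambda>z. indicator D z * ((max 0 (T - snd z))\<^sup>2 * (6 * max 0 (W z - e)) * (\<Sum>b\<in>Basis. Wx b z * J b z))"
  assumes D: "open D" "bounded D" and E: "compact E" "E \<subseteq> D"
    and meas: "W \<in> borel_measurable borel" "\<And>b. b \<in> Basis \<Longrightarrow> J b \<in> borel_measurable borel"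
    and bd: "bounded_fun_on D W" "bounded_fun_on D Wt" "\<And>b. b \<in> Basis \<Longrightarrow> bounded_fun_on D (Wx b)"
      "\<And>b. b \<in> Basis \<Longrightarrow> bounded_fun_on D (J b)" "\<And>b. b \<in> Basis \<Longrightarrow> bounded_fun_on D (Jx b)"
    and der: "\<And>z. z \<in> D \<Longrightarrow> has_dir_deriv W (Wt z) (0, 1) z"
      "\<And>z b. z \<in> D \<Longrightarrow> b \<in> Basis \<Longrightarrow> has_dir_deriv W (Wx b z) (b, 0) z"
      "\<And>z b. z \<in> D \<Longrightarrow> b \<in> Basis \<Longrightarrow> has_dir_deriv (J b) (Jx b z) (b, 0) z"
    and eqn: "\<And>z. z \<in> D \<Longrightarrow> Wt z = (\<Sum>b\<in>Basis. Jx b z)"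
    and small: "\<And>z. z \<in> D \<Longrightarrow> z \<notin> E \<Longrightarrow> snd z \<le> T \<Longrightarrow> W z \<le> e"
  shows "integrable lborel A" "integrable lborel B" "integral\<^sup>L lborel B = integral\<^sup>L lborel A"
proof -
  define \<kappa> where "\<kappa> = (\<lambda>z::'a \<times> real. (max 0 (T - snd z))\<^sup>2)"
  define \<Psi> \<psi> \<psi>' where "\<Psi> = (\<lambda>s. (max 0 (s - e)) ^ 3)" "\<psi> = (\<lambda>s. 3 * (max 0 (s - e))\<^sup>2)" "\<psi>' = (\<lambda>s. 6 * max 0 (s - e))"
  note \<psi>_defs = \<Psi>_\<psi>_\<psi>'_def
  have shift: "((\<lambda>s. s - e) has_real_derivative 1) (at s)" for s
    by (auto intro!: derivative_eq_intros)
  have d\<Psi>: "(\<Psi> has_real_derivative \<psi> s) (at s)" for s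
    using DERIV_chain2[OF max_power_deriv[of 2 "s - e"] shift] by (simp add: \<psi>_defs eval_nat_numeral)
  have d\<psi>: "(\<psi> has_real_derivative \<psi>' s) (at s)" for s
    using DERIV_cmult[OF DERIV_chain2[OF max_power_deriv[of 1 "s - e"] shift], of 3]
    by (simp add: \<psi>_defs eval_nat_numeral)
  have c\<psi>: "continuous_on UNIV \<Psi>" "continuous_on UNIV \<psi>" "continuous_on UNIV \<psi>'"
    unfolding \<psi>_defs by (intro continuous_intros)+
  have \<kappa>c: "continuous_on UNIV \<kappa>" "continuous_on UNIV (\<lambda>z::'a \<times> real. - 2 * max 0 (T - snd z))"
    unfolding \<kappa>_def by (intro continuous_intros)+
  have b\<kappa>: "bounded_fun_on D \<kappa>" "bounded_fun_on D (\<lambda>z. - 2 * max 0 (T - snd z))"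
    using D(2) \<kappa>c by (auto intro: bounded_fun_on_continuous)
  have d\<kappa>t: "has_dir_deriv \<kappa> (- 2 * max 0 (T - snd z)) (0, 1) z" for z
  proof -
    have "((\<lambda>s. T - snd z - s) has_real_derivative - 1) (at 0)"
      by (auto intro!: derivative_eq_intros)
    from DERIV_chain2[OF max_power_deriv[of 1] this]
    show ?thesis by (simp add: has_dir_deriv_def \<kappa>_def eval_nat_numeral diff_diff_eq)
  qed
  have d\<kappa>x: "has_dir_deriv \<kappa> 0 (b, 0) z" for b z
    by (simp add: has_dir_deriv_def \<kappa>_def)
  \<comment> \<open>Off E either t > T, where \<kappa> = 0, or W \<le> e, where both truncations
    vanish.\<close>
  have vanish: "\<kappa> z * \<Psi> (W z) = 0" "\<kappa> z * \<psi> (W z) = 0" if "z \<in> D" "z \<notin> E" for z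
    using small[OF that] by (cases "snd z \<le> T"; auto simp: \<kappa>_def \<psi>_defs)+
  have b\<Psi>: "bounded_fun_on D (\<lambda>z. \<Psi> (W z))" "bounded_fun_on D (\<lambda>z. \<psi> (W z))" "bounded_fun_on D (\<lambda>z. \<psi>' (W z))"
    using bounded_fun_on_compose[OF bd(1)] c\<psi> by auto
  have [measurable]: "D \<in> sets borel" "\<kappa> \<in> borel_measurable borel" "W \<in> borel_measurable borel"
     "\<Psi> \<in> borel_measurable borel" "\<psi> \<in> borel_measurable borel"
    using D(1) \<kappa>c(1) c\<psi> meas(1) by (auto intro: borel_measurable_continuous_onI)
  \<comment> \<open>The zero extension has a derivative along v on D and on the complement of E, two
    open sets that cover the space because E lies inside D.\<close>
  have general: "integrable lborel (\<lambda>z. indicator D z * F' z)" "(LBINT z. indicator D z * F' z) = 0"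
    if F: "F \<in> borel_measurable borel" "bounded_fun_on D F" "bounded_fun_on D F'"
      "\<And>z. z \<in> D \<Longrightarrow> has_dir_deriv F (F' z) v z" "\<And>z. z \<in> D \<Longrightarrow> z \<notin> E \<Longrightarrow> F z = 0"
    for F F' :: "'a \<times> real \<Rightarrow> real" and v
  proof -
    obtain M where M: "\<And>z. z \<in> D \<Longrightarrow> \<bar>F z\<bar> \<le> M" using F(2) by (auto simp: bounded_fun_on_def)
    obtain M' where M': "\<And>z. z \<in> D \<Longrightarrow> \<bar>F' z\<bar> \<le> M'" using F(3) by (auto simp: bounded_fun_on_def)
    have der: "has_dir_deriv (\<lambda>z. indicator D z * F z) (indicator D z * F' z) v z" for z
    proof (cases "z \<in> D")
      case True
      then show ?thesis
        using has_dir_deriv_cong_open[OF F(4)[OF True] D(1) True, of "\<lambda>z. indicator D z * F z"] by simp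
    next
      case False
      have "has_dir_deriv (\<lambda>z. 0) 0 v z" by (simp add: has_dir_deriv_def)
      then have "has_dir_deriv (\<lambda>z. indicator D z * F z) 0 v z"
        by (rule has_dir_deriv_cong_open[of _ _ _ _ "- E"])
          (use False E F(5) in \<open>auto simp: compact_imp_closed indicator_def\<close>)
      then show ?thesis using False by simp
    qed
    have m: "(\<lambda>z. indicator D z * F z) \<in> borel_measurable borel" using F(1) by measurable
    have M0: "\<bar>indicator D z * F z\<bar> \<le> \<bar>M\<bar>" for z using M[of z] by (auto simp: indicator_def)
    have M0': "\<bar>indicator D z * F' z\<bar> \<le> \<bar>M'\<bar>" for z using M'[of z] by (auto simp: indicator_def)
    have z0: "indicator D z * F z = 0" if "z \<notin> D" for z using that by simp
    show "integrable lborel (\<lambda>z. indicator D z * F' z)" "(LBINT z. indicator D z * F' z) = 0"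
      using integral_dir_deriv_eq_0[OF m D(2) z0 M0 der M0'] by auto
  qed
  define Pt where "Pt = (\<lambda>z. (- 2 * max 0 (T - snd z)) * \<Psi> (W z) + \<kappa> z * (\<psi> (W z) * Wt z))"
  define Px where "Px = (\<lambda>b z. 0 * (\<psi> (W z) * J b z) + \<kappa> z * ((\<psi>' (W z) * Wx b z) * J b z + \<psi> (W z) * Jx b z))"
  have t: "integrable lborel (\<lambda>z. indicator D z * Pt z)" "(LBINT z. indicator D z * Pt z) = 0"
  proof -
    have 1: "(\<lambda>z. \<kappa> z * \<Psi> (W z)) \<in> borel_measurable borel" by measurable
    have 2: "bounded_fun_on D (\<lambda>z. \<kappa> z * \<Psi> (W z))" "bounded_fun_on D Pt"
      unfolding Pt_def by (intro bounded_fun_on_add bounded_fun_on_mult b\<kappa> b\<Psi> bd)+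
    have 3: "has_dir_deriv (\<lambda>z. \<kappa> z * \<Psi> (W z)) (Pt z) (0, 1) z" if "z \<in> D" for z
      unfolding Pt_def by (intro has_dir_deriv_mult d\<kappa>t has_dir_deriv_chain[OF der(1)[OF that] d\<Psi>])
    show "integrable lborel (\<lambda>z. indicator D z * Pt z)" "(LBINT z. indicator D z * Pt z) = 0"
      using general[OF 1 2 3 vanish(1)] by auto
  qed
  have x: "integrable lborel (\<lambda>z. indicator D z * Px b z)" "(LBINT z. indicator D z * Px b z) = 0" if b: "b \<in> Basis" for b
  proof -
    have 1: "(\<lambda>z. \<kappa> z * (\<psi> (W z) * J b z)) \<in> borel_measurable borel"
      using meas(2)[OF b] by measurable
    have 2: "bounded_fun_on D (\<lambda>z. \<kappa> z * (\<psi> (W z) * J b z))" "bounded_fun_on D (Px b)"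
      unfolding Px_def by (intro bounded_fun_on_add bounded_fun_on_mult b\<kappa> b\<Psi> bd b bounded_fun_on_continuous D(2) continuous_on_const)+
    have 3: "has_dir_deriv (\<lambda>z. \<kappa> z * (\<psi> (W z) * J b z)) (Px b z) (b, 0) z" if "z \<in> D" for z
      unfolding Px_def
      by (intro has_dir_deriv_mult d\<kappa>x has_dir_deriv_chain[OF der(2)[OF that b] d\<psi>] der(3)[OF that b])
    have 4: "\<kappa> z * (\<psi> (W z) * J b z) = 0" if "z \<in> D" "z \<notin> E" for z
      using vanish(2)[OF that] by auto
    show "integrable lborel (\<lambda>z. indicator D z * Px b z)" "(LBINT z. indicator D z * Px b z) = 0"
      using general[OF 1 2 3 4] by auto
  qed
  \<comment> \<open>The terms \<kappa> \<psi>(W) Wt and \<kappa> \<psi>(W) times the sum of the Jx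
    cancel by the equation. What remains is the derivative of the weight, in A, and the
    gradient-flux product, in B.\<close>
  have AB: "A z - B z = indicator D z * Pt z - (\<Sum>b\<in>Basis. indicator D z * Px b z)" for z
  proof (cases "z \<in> D")
    case True
    have "(\<Sum>b\<in>Basis. Px b z) = \<kappa> z * \<psi>' (W z) * (\<Sum>b\<in>Basis. Wx b z * J b z) + \<kappa> z * \<psi> (W z) * Wt z"
      unfolding eqn[OF True] Px_def by (simp add: sum_distrib_left sum.distrib algebra_simps)
    then show ?thesis
      using True by (simp add: A_def B_def Pt_def \<kappa>_def \<psi>_defs algebra_simps)
  qed (simp add: A_def B_def)
  show A: "integrable lborel A"
  proof -
    obtain M where M: "\<And>z. z \<in> D \<Longrightarrow> \<bar>(- 2 * max 0 (T - snd z)) * \<Psi> (W z)\<bar> \<le> M"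
      using bounded_fun_on_mult[OF b\<kappa>(2) b\<Psi>(1)] by (auto simp: bounded_fun_on_def)
    have "(\<lambda>z::'a \<times> real. - 2 * max 0 (T - snd z)) \<in> borel_measurable borel"
      using \<kappa>c(2) by (rule borel_measurable_continuous_onI)
    then have "(\<lambda>z. indicator D z * ((- 2 * max 0 (T - snd z)) * \<Psi> (W z))) \<in> borel_measurable borel"
      by measurable
    then have "integrable lborel (\<lambda>z. indicator D z * ((- 2 * max 0 (T - snd z)) * \<Psi> (W z)))"
    proof (rule integrable_bounded_support[OF _ D(2)])
      show "norm (indicator D z * ((- 2 * max 0 (T - snd z)) * \<Psi> (W z))) \<le> \<bar>M\<bar>" for z
        using M[of z] by (auto simp: indicator_def)
    qed simp
    then show ?thesis by (simp add: A_def \<psi>_defs)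
  qed
  have int: "integrable lborel (\<lambda>z. indicator D z * Pt z - (\<Sum>b\<in>Basis. indicator D z * Px b z))"
    using t x by (intro Bochner_Integration.integrable_diff Bochner_Integration.integrable_sum) auto
  have Beq: "B = (\<lambda>z. A z - (indicator D z * Pt z - (\<Sum>b\<in>Basis. indicator D z * Px b z)))"
    using AB by (auto simp: fun_eq_iff algebra_simps)
  show "integrable lborel B"
    unfolding Beq using A int by (rule Bochner_Integration.integrable_diff)
  have "(LBINT z. indicator D z * Pt z - (\<Sum>b\<in>Basis. indicator D z * Px b z)) = 0"
  proof -
    have "(LBINT z. (\<Sum>b\<in>Basis. indicator D z * Px b z)) = (\<Sum>b\<in>Basis. LBINT z. indicator D z * Px b z)"
      by (rule Bochner_Integration.integral_sum[OF x(1)])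
    also have "\<dots> = 0"
      using x(2) by (intro sum.neutral ballI)
    finally have "(LBINT z. (\<Sum>b\<in>Basis. indicator D z * Px b z)) = 0" .
    moreover have "(LBINT z. indicator D z * Pt z - (\<Sum>b\<in>Basis. indicator D z * Px b z)) =
        (LBINT z. indicator D z * Pt z) - (LBINT z. (\<Sum>b\<in>Basis. indicator D z * Px b z))"
      by (intro Bochner_Integration.integral_diff t(1) Bochner_Integration.integrable_sum x(1))
    ultimately show ?thesis
      using t(2) by (simp only: diff_self)
  qed
  then show "integral\<^sup>L lborel B = integral\<^sup>L lborel A"
    unfolding Beq using A int by (subst Bochner_Integration.integral_diff) auto
qed

section \<open>Comparison of weak solutions with exact solutions\<close>

lemma Lp_integrable:
  fixes g :: "'e::euclidean_space \<Rightarrow> 'b::euclidean_space" and \<phi> :: "'b \<Rightarrow> real"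
  assumes g: "in_Lp p D g" and D: "open D" "bounded D"
    and \<phi>: "\<phi> \<in> borel_measurable borel" "\<And>v. \<bar>\<phi> v\<bar> \<le> C * (1 + norm v powr p)"
  shows "integrable lborel (\<lambda>z. indicator D z * \<phi> (g z))"
proof (rule Bochner_Integration.integrable_bound)
  have "integrable lborel (\<lambda>z. indicator D z * norm (g z) powr p)"
    using g by (simp add: in_Lp_def set_integrable_def)
  moreover have "integrable lborel (indicator D :: 'e \<Rightarrow> real)"
    using D by (intro integrable_real_indicator emeasure_bounded_finite) auto
  ultimately show "integrable lborel (\<lambda>z. C * (indicator D z + indicator D z * norm (g z) powr p))"
    by simp
  \<comment> \<open>Measurability is known for g times the indicator of D only, so \<phi> is applied
    to that product and the indicator is multiplied in once more.\<close>
  have "(\<lambda>z. indicator D z *\<^sub>R g z) \<in> borel_measurable borel"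
    using g by (simp add: in_Lp_def set_borel_measurable_def)
  then have [measurable]: "(\<lambda>z. \<phi> (indicator D z *\<^sub>R g z)) \<in> borel_measurable borel"
    by (rule measurable_compose[OF _ \<phi>(1)])
  have [measurable]: "D \<in> sets borel" using D(1) by simp
  have "(\<lambda>z. indicator D z * \<phi> (indicator D z *\<^sub>R g z)) \<in> borel_measurable borel"
    by measurable
  moreover have "(\<lambda>z. indicator D z * \<phi> (indicator D z *\<^sub>R g z)) = (\<lambda>z. indicator D z * \<phi> (g z))"
    by (auto simp: indicator_def fun_eq_iff)
  ultimately show "(\<lambda>z. indicator D z * \<phi> (g z)) \<in> borel_measurable lborel"
    by simp
  show "AE z in lborel. norm (indicator D z * \<phi> (g z)) \<le> norm (C * (indicator D z + indicator D z * norm (g z) powr p))"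
  proof (rule AE_I2)
    fix z
    show "norm (indicator D z * \<phi> (g z)) \<le> norm (C * (indicator D z + indicator D z * norm (g z) powr p))"
      using \<phi>(2)[of "g z"] by (cases "z \<in> D") auto
  qed
qed

lemma integral_eq_from_slices:
  fixes F G :: "'a::euclidean_space \<times> real \<Rightarrow> real"
  assumes F: "integrable lborel F" and G: "integrable lborel G"
    and eq: "AE t in lborel. (LBINT x. F (x, t)) = (LBINT x. G (x, t))"
  shows "integral\<^sup>L lborel F = integral\<^sup>L lborel G"
proof -
  have i: "integrable (lborel \<Otimes>\<^sub>M lborel) (case_prod (\<lambda>x t. F (x, t)))"
    "integrable (lborel \<Otimes>\<^sub>M lborel) (case_prod (\<lambda>x t. G (x, t)))"
    using F G by (simp_all add: lborel_prod)
  have "(LBINT t. (LBINT x. F (x, t))) = (LBINT t. (LBINT x. G (x, t)))"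
    using eq by (intro integral_cong_AE borel_measurable_integrable lborel_pair.integrable_snd i)
  then show ?thesis
    unfolding lborel_pair.integral_snd[OF i(1)] lborel_pair.integral_snd[OF i(2)]
    by (simp add: lborel_prod)
qed

text \<open>The kernel centred at z is the test function; the sign from differentiating in y instead
  of z occurs on both sides and cancels. Gradient and flux are mollified separately, so the second
  identity contains the mollified flux, not the flux of the mollified gradient.\<close>

lemma mollified_weak_solution:
  fixes h :: "'a::euclidean_space \<times> real \<Rightarrow> real" and g :: "'a \<times> real \<Rightarrow> 'a"
    and U :: "'a set" and s1 s2 :: real
  defines "D \<equiv> U \<times> {s1<..<s2}"
  assumes U: "open U" and \<rho>: "\<rho> > 0" "cball z \<rho> \<subseteq> D"
    and par: "parabolic_sobolev_with_gradient p U s1 s2 h g"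
    and weak: "\<And>\<phi>. \<phi> \<in> test_functions D \<Longrightarrow>
        (LINT t:{s1<..<s2}|lborel. LINT x:U|lborel.
                 (norm (g (x, t)) powr (p - 2) *\<^sub>R g (x, t)) \<bullet> space_gradient \<phi> (x, t))
            - (LINT t:{s1<..<s2}|lborel. LINT x:U|lborel.
                 h (x, t) * time_derivative \<phi> (x, t)) = 0"
    and hi: "integrable lborel (\<lambda>y. indicator D y * h y)"
    and gi: "\<And>b. b \<in> Basis \<Longrightarrow> integrable lborel (\<lambda>y. indicator D y * (g y \<bullet> b))"
    and Gi: "\<And>b. b \<in> Basis \<Longrightarrow>
      integrable lborel (\<lambda>y. indicator D y * ((norm (g y) powr (p - 2) *\<^sub>R g y) \<bullet> b))"
  shows "b \<in> Basis \<Longrightarrow> mollify_deriv \<rho> (b, 0) (\<lambda>y. indicator D y * h y) z =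
      mollify \<rho> (\<lambda>y. indicator D y * (g y \<bullet> b)) z"
    and "mollify_deriv \<rho> (0, 1) (\<lambda>y. indicator D y * h y) z =
      (\<Sum>b\<in>Basis. mollify_deriv \<rho> (b, 0) (\<lambda>y. indicator D y * ((norm (g y) powr (p - 2) *\<^sub>R g y) \<bullet> b)) z)"
proof -
  show "mollify_deriv \<rho> (b, 0) (\<lambda>y. indicator D y * h y) z =
      mollify \<rho> (\<lambda>y. indicator D y * (g y \<bullet> b)) z" if b: "b \<in> Basis"
    unfolding mollify_deriv_def mollify_def
  proof (rule integral_eq_from_slices)
    show "integrable lborel (\<lambda>y. mollifier_deriv \<rho> (b, 0) (z - y) * (indicator D y * h y))"
      by (rule mollify_deriv_integrable[OF \<rho>(1) hi])
    show "integrable lborel (\<lambda>y. mollifier \<rho> (z - y) * (indicator D y * (g y \<bullet> b)))"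
      by (rule mollify_integrable[OF \<rho>(1) gi[OF b]])
    have "AE t in lborel. t \<in> {s1<..<s2} \<longrightarrow> sobolev_with_gradient p U (\<lambda>x. h (x, t)) (\<lambda>x. g (x, t))"
      using par by (simp add: parabolic_sobolev_with_gradient_def)
    then show "AE t in lborel. (LBINT x. mollifier_deriv \<rho> (b, 0) (z - (x, t)) * (indicator D (x, t) * h (x, t))) =
        (LBINT x. mollifier \<rho> (z - (x, t)) * (indicator D (x, t) * (g (x, t) \<bullet> b)))"
    proof eventually_elim
      case (elim t)
      show ?case
      proof (cases "t \<in> {s1<..<s2}")
        case True
        have "(\<lambda>x. mollifier \<rho> (z - (x, t))) \<in> test_functions U"
          using \<rho>(2) by (intro mollifier_slice_test_function \<rho>(1)) (auto simp: D_def)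
        then have "(LINT x:U|lborel. h (x, t) * frechet_derivative (\<lambda>x. mollifier \<rho> (z - (x, t))) (at x) b) =
            - (LINT x:U|lborel. (g (x, t) \<bullet> b) * mollifier \<rho> (z - (x, t)))"
          using elim True b unfolding sobolev_with_gradient_def by blast
        then have "(LBINT x. - (mollifier_deriv \<rho> (b, 0) (z - (x, t)) * (indicator D (x, t) * h (x, t)))) =
            - (LBINT x. mollifier \<rho> (z - (x, t)) * (indicator D (x, t) * (g (x, t) \<bullet> b)))"
          using True unfolding set_lebesgue_integral_def mollifier_slice_derivative D_def
          by (simp add: indicator_times mult_ac)
        then show ?thesis by simp
      qed (simp add: D_def)
    qed
  qed
  have \<phi>: "(\<lambda>y. mollifier \<rho> (z - y)) \<in> test_functions D"
    by (rule mollifier_test_function[OF \<rho>])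
  let ?G = "\<lambda>b y. indicator D y * ((norm (g y) powr (p - 2) *\<^sub>R g y) \<bullet> b)"
  have i1: "integrable lborel (\<lambda>y. \<Sum>b\<in>Basis. - (mollifier_deriv \<rho> (b, 0) (z - y) * ?G b y))"
    using mollify_deriv_integrable[OF \<rho>(1) Gi] by (intro Bochner_Integration.integrable_sum) auto
  have i2: "integrable lborel (\<lambda>y. - (mollifier_deriv \<rho> (0, 1) (z - y) * (indicator D y * h y)))"
    using mollify_deriv_integrable[OF \<rho>(1) hi] by simp
  have sg: "(norm (g y) powr (p - 2) *\<^sub>R g y) \<bullet> space_gradient (\<lambda>y. mollifier \<rho> (z - y)) y =
      (\<Sum>b\<in>Basis. - (mollifier_deriv \<rho> (b, 0) (z - y) * ?G b y))" if "y \<in> D" for y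
    using that unfolding space_gradient_def mollifier_frechet
    by (simp add: inner_sum_right sum_distrib_left mult_ac sum_negf)
  have "(LINT t:{s1<..<s2}|lborel. LINT x:U|lborel.
        (norm (g (x, t)) powr (p - 2) *\<^sub>R g (x, t)) \<bullet> space_gradient (\<lambda>y. mollifier \<rho> (z - y)) (x, t)) =
      (LINT t:{s1<..<s2}|lborel. LINT x:U|lborel. (\<Sum>b\<in>Basis. - (mollifier_deriv \<rho> (b, 0) (z - (x, t)) * ?G b (x, t))))"
    using U sg by (intro set_lebesgue_integral_cong allI impI) (auto simp: D_def)
  also have "\<dots> = (LBINT y. (\<Sum>b\<in>Basis. - (mollifier_deriv \<rho> (b, 0) (z - y) * ?G b y)))"
    by (rule iterated_set_integral[OF i1]) (auto simp: D_def)
  also have "\<dots> = - (\<Sum>b\<in>Basis. mollify_deriv \<rho> (b, 0) (?G b) z)"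
    using mollify_deriv_integrable[OF \<rho>(1) Gi]
    by (subst Bochner_Integration.integral_sum) (auto simp: mollify_deriv_def sum_negf)
  finally have 1: "(LINT t:{s1<..<s2}|lborel. LINT x:U|lborel.
        (norm (g (x, t)) powr (p - 2) *\<^sub>R g (x, t)) \<bullet> space_gradient (\<lambda>y. mollifier \<rho> (z - y)) (x, t)) =
      - (\<Sum>b\<in>Basis. mollify_deriv \<rho> (b, 0) (?G b) z)" .
  have "(LINT t:{s1<..<s2}|lborel. LINT x:U|lborel. h (x, t) * time_derivative (\<lambda>y. mollifier \<rho> (z - y)) (x, t)) =
      (LINT t:{s1<..<s2}|lborel. LINT x:U|lborel. - (mollifier_deriv \<rho> (0, 1) (z - (x, t)) * (indicator D (x, t) * h (x, t))))"
    using U unfolding time_derivative_def mollifier_frechet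
    by (intro set_lebesgue_integral_cong allI impI) (auto simp: D_def)
  also have "\<dots> = (LBINT y. - (mollifier_deriv \<rho> (0, 1) (z - y) * (indicator D y * h y)))"
    by (rule iterated_set_integral[OF i2]) (auto simp: D_def)
  also have "\<dots> = - mollify_deriv \<rho> (0, 1) (\<lambda>y. indicator D y * h y) z"
    by (simp add: mollify_deriv_def)
  finally show "mollify_deriv \<rho> (0, 1) (\<lambda>y. indicator D y * h y) z = (\<Sum>b\<in>Basis. mollify_deriv \<rho> (b, 0) (?G b) z)"
    using 1 weak[OF \<phi>] by simp
qed

section \<open>Simultaneous convergence along one sequence of radii\<close>

lemma mollify_L1_eventually:
  fixes f :: "'e::euclidean_space \<Rightarrow> real"
  assumes "integrable lborel f" "e > 0"
  shows "\<forall>\<^sub>F \<rho> in at_right 0. integrable lborel (\<lambda>z. mollify \<rho> f z - f z) \<and>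
    (LBINT z. \<bar>mollify \<rho> f z - f z\<bar>) \<le> e"
proof -
  obtain d where "d > 0" "\<forall>\<rho>. 0 < \<rho> \<and> \<rho> < d \<longrightarrow>
    integrable lborel (\<lambda>z. mollify \<rho> f z - f z) \<and> (LBINT z. \<bar>mollify \<rho> f z - f z\<bar>) \<le> e"
    using mollify_L1[OF assms] by blast
  then show ?thesis
    unfolding eventually_at_right_field by (intro exI[of _ d]) auto
qed

text \<open>Summing the errors over the finite family gives one function that tends to 0 in L^1, so
  a single subsequence works almost everywhere for all members. The condition P survives because it
  is monotone in e and the n-th chosen index is at least n.\<close>

lemma mollify_sequence:
  fixes Fam :: "('e::euclidean_space \<Rightarrow> real) set"
  assumes fin: "finite Fam" and int: "\<And>f. f \<in> Fam \<Longrightarrow> integrable lborel f"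
    and ev: "\<And>e. e > 0 \<Longrightarrow> \<forall>\<^sub>F \<rho> in at_right 0. P e \<rho>"
    and mono: "\<And>e e' \<rho>. P e \<rho> \<Longrightarrow> e \<le> e' \<Longrightarrow> P e' \<rho>"
  shows "\<exists>\<rho>. (\<forall>n. \<rho> n > 0 \<and> P (1 / real (Suc n)) (\<rho> n)) \<and>
    (\<forall>f\<in>Fam. (\<lambda>n. LBINT z. \<bar>mollify (\<rho> n) f z - f z\<bar>) \<longlonglongrightarrow> 0) \<and>
    (\<forall>f\<in>Fam. \<forall>n. integrable lborel (mollify (\<rho> n) f)) \<and>
    (AE z in lborel. \<forall>f\<in>Fam. (\<lambda>n. mollify (\<rho> n) f z) \<longlonglongrightarrow> f z)"
proof -
  have "\<forall>\<^sub>F \<rho> in at_right 0. \<rho> > 0 \<and> P (1 / real (Suc n)) \<rho> \<and>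
      (\<forall>f\<in>Fam. integrable lborel (\<lambda>z. mollify \<rho> f z - f z) \<and> (LBINT z. \<bar>mollify \<rho> f z - f z\<bar>) \<le> 1 / real (Suc n))" for n
    using fin int by (intro eventually_conj ev eventually_ball_finite ballI mollify_L1_eventually
        eventually_at_right_less) auto
  then have "\<exists>\<rho>. \<rho> > 0 \<and> P (1 / real (Suc n)) \<rho> \<and>
      (\<forall>f\<in>Fam. integrable lborel (\<lambda>z. mollify \<rho> f z - f z) \<and> (LBINT z. \<bar>mollify \<rho> f z - f z\<bar>) \<le> 1 / real (Suc n))" for n
    by (rule eventually_happens'[rotated]) (simp add: trivial_limit_at_right_real)
  then obtain r where r: "\<And>n. r n > 0" "\<And>n. P (1 / real (Suc n)) (r n)"
      "\<And>n f. f \<in> Fam \<Longrightarrow> integrable lborel (\<lambda>z. mollify (r n) f z - f z)"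
      "\<And>n f. f \<in> Fam \<Longrightarrow> (LBINT z. \<bar>mollify (r n) f z - f z\<bar>) \<le> 1 / real (Suc n)"
    by metis
  have lim0: "(\<lambda>n. 1 / real (Suc n)) \<longlonglongrightarrow> 0"
    by (rule LIMSEQ_1_over_Suc)
  have L1: "(\<lambda>n. LBINT z. \<bar>mollify (r n) f z - f z\<bar>) \<longlonglongrightarrow> 0" if "f \<in> Fam" for f
    by (rule Lim_null_comparison[OF _ lim0]) (use r(4)[OF that] in auto)
  define S where "S = (\<lambda>n z. \<Sum>f\<in>Fam. \<bar>mollify (r n) f z - f z\<bar>)"
  have "integrable lborel (S n)" for n
    unfolding S_def using r(3) by (intro Bochner_Integration.integrable_sum integrable_abs)
  moreover have "(\<lambda>n. LBINT z. norm (S n z)) \<longlonglongrightarrow> 0"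
  proof -
    have "(LBINT z. norm (S n z)) = (\<Sum>f\<in>Fam. LBINT z. \<bar>mollify (r n) f z - f z\<bar>)" for n
    proof -
      have "norm (S n z) = S n z" for z by (simp add: S_def sum_nonneg)
      then show ?thesis
        unfolding S_def using r(3) by (simp only:) (intro Bochner_Integration.integral_sum integrable_abs)
    qed
    moreover have "(\<lambda>n. \<Sum>f\<in>Fam. LBINT z. \<bar>mollify (r n) f z - f z\<bar>) \<longlonglongrightarrow> (\<Sum>f\<in>Fam. 0)"
      using L1 by (intro tendsto_sum)
    ultimately show ?thesis by simp
  qed
  ultimately obtain \<sigma> :: "nat \<Rightarrow> nat" where \<sigma>: "strict_mono \<sigma>" "AE z in lborel. (\<lambda>n. S (\<sigma> n) z) \<longlonglongrightarrow> 0"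
    using tendsto_L1_AE_subseq[of lborel S] by blast
  have "P (1 / real (Suc n)) (r (\<sigma> n))" for n
    using seq_suble[OF \<sigma>(1), of n] by (intro mono[OF r(2)[of "\<sigma> n"]]) (simp add: frac_le)
  moreover have "(\<lambda>n. LBINT z. \<bar>mollify (r (\<sigma> n)) f z - f z\<bar>) \<longlonglongrightarrow> 0" if "f \<in> Fam" for f
    using LIMSEQ_subseq_LIMSEQ[OF L1[OF that] \<sigma>(1)] by (simp add: comp_def)
  moreover have "integrable lborel (mollify (r (\<sigma> n)) f)" if "f \<in> Fam" for f n
    using Bochner_Integration.integrable_add[OF r(3)[OF that, of "\<sigma> n"] int[OF that]] by simp
  moreover have "AE z in lborel. \<forall>f\<in>Fam. (\<lambda>n. mollify (r (\<sigma> n)) f z) \<longlonglongrightarrow> f z"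
    using \<sigma>(2)
  proof eventually_elim
    case (elim z)
    show ?case
    proof
      fix f assume f: "f \<in> Fam"
      have "(\<lambda>n. mollify (r (\<sigma> n)) f z - f z) \<longlonglongrightarrow> 0"
      proof (rule Lim_null_comparison[OF _ elim], rule always_eventually, rule allI)
        fix n
        show "norm (mollify (r (\<sigma> n)) f z - f z) \<le> S (\<sigma> n) z"
          unfolding S_def using member_le_sum[OF f, of "\<lambda>f. \<bar>mollify (r (\<sigma> n)) f z - f z\<bar>"] fin by simp
      qed
      then show "(\<lambda>n. mollify (r (\<sigma> n)) f z) \<longlonglongrightarrow> f z" by (rule LIM_zero_cancel)
    qed
  qed
  ultimately show ?thesis
    using r(1) by (intro exI[of _ "r \<circ> \<sigma>"]) (auto simp: comp_def)
qed

section \<open>Growth bounds for gradients and fluxes\<close>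

lemma norm_flux: "norm (norm v powr (p - 2) *\<^sub>R v) = norm (v :: 'b::euclidean_space) powr (p - 1)"
proof -
  have "norm v powr (p - 2) * norm v = norm v powr (1 + (p - 2))"
    by (subst mult.commute) (simp only: powr_mult_base norm_ge_zero)
  then show ?thesis by simp
qed

lemma powr_le_1_plus_powr:
  fixes s :: real
  assumes "s \<ge> 0" "0 \<le> a" "a \<le> b"
  shows "s powr a \<le> 1 + s powr b"
proof (cases "s \<le> 1")
  case True
  then have "s powr a \<le> 1" using assms powr_mono2[of a s 1] by simp
  then show ?thesis using powr_ge_zero[of s b] by linarith
next
  case False
  then have "s powr a \<le> s powr b" using assms by (intro powr_mono) auto
  then show ?thesis by simp
qed

text \<open>Both factors are controlled by m = max s s' + R \<ge> 1: the first is at most m, the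
  second at most 2 m^(p - 1). The two arguments are independent, as the two-point hypothesis of
  \<open>integral_product_le\<close> requires.\<close>

lemma young_cross:
  fixes s s' R :: real
  assumes p: "p > 2" and R: "R \<ge> 1" and s: "s \<ge> 0" "s' \<ge> 0"
  shows "(s + R) * (s' powr (p - 1) + R) \<le> 2 * ((s + R) powr p + (s' + R) powr p)"
proof -
  let ?m = "max s s' + R"
  have m: "?m \<ge> 1" using R s by simp
  have "s' powr (p - 1) \<le> ?m powr (p - 1)"
    using p s R by (intro powr_mono2) auto
  moreover have "R \<le> ?m powr (p - 1)"
  proof -
    have "R \<le> ?m powr 1" using s R by simp
    also have "\<dots> \<le> ?m powr (p - 1)" using p m by (intro powr_mono) auto
    finally show ?thesis .
  qed
  ultimately have "(s + R) * (s' powr (p - 1) + R) \<le> ?m * (2 * ?m powr (p - 1))"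
    using R s by (intro mult_mono add_nonneg_nonneg) auto
  also have "\<dots> = 2 * ?m powr p"
  proof -
    have "?m * ?m powr (p - 1) = ?m powr (1 + (p - 1))"
      using m by (intro powr_mult_base) auto
    then show ?thesis by simp
  qed
  also have "?m powr p \<le> (s + R) powr p + (s' + R) powr p"
    by (cases "s \<le> s'") (auto simp: max_def)
  finally show ?thesis by simp
qed

lemma Lp_integrable_components:
  fixes g :: "'e::euclidean_space \<Rightarrow> 'a::euclidean_space"
  assumes "p > 2" "in_Lp p D g" "open D" "bounded D" "b \<in> Basis"
  shows "integrable lborel (\<lambda>y. indicator D y * (g y \<bullet> b))"
    "integrable lborel (\<lambda>y. indicator D y * ((norm (g y) powr (p - 2) *\<^sub>R g y) \<bullet> b))"
proof -
  have le: "norm v \<le> 1 + norm v powr p" "norm v powr (p - 1) \<le> 1 + norm v powr p" for v :: 'a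
    using powr_le_1_plus_powr[of "norm v" 1 p] powr_le_1_plus_powr[of "norm v" "p - 1" p] assms(1) by auto
  show "integrable lborel (\<lambda>y. indicator D y * (g y \<bullet> b))"
  proof (rule Lp_integrable[OF assms(2-4), of "\<lambda>v. v \<bullet> b" 1])
    show "\<bar>v \<bullet> b\<bar> \<le> 1 * (1 + norm v powr p)" for v
      using order_trans[OF Basis_le_norm[OF assms(5)] le(1)] by simp
  qed simp
  show "integrable lborel (\<lambda>y. indicator D y * ((norm (g y) powr (p - 2) *\<^sub>R g y) \<bullet> b))"
  proof (rule Lp_integrable[OF assms(2-4), of "\<lambda>v. (norm v powr (p - 2) *\<^sub>R v) \<bullet> b" 1])
    show "\<bar>(norm v powr (p - 2) *\<^sub>R v) \<bullet> b\<bar> \<le> 1 * (1 + norm v powr p)" for v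
      using order_trans[OF Basis_le_norm[OF assms(5), of "norm v powr (p - 2) *\<^sub>R v", unfolded norm_flux] le(2)] by simp
  qed simp
qed

lemma uniformly_continuous_integrable:
  fixes h :: "'e::euclidean_space \<Rightarrow> real"
  assumes "open D" "bounded D" "uniformly_continuous_on D h" "bounded (h ` D)"
  shows "integrable lborel (\<lambda>y. indicator D y * h y)"
proof -
  obtain M where M: "\<And>z. z \<in> D \<Longrightarrow> \<bar>h z\<bar> \<le> M"
    using assms(4) by (metis (no_types, lifting) bounded_iff imageI real_norm_def)
  show ?thesis
  proof (rule integrable_bounded_support[OF _ assms(2)])
    have "(\<lambda>y. indicator D y *\<^sub>R h y) \<in> borel_measurable borel"
      using uniformly_continuous_imp_continuous[OF assms(3)] assms(1)
      by (intro borel_measurable_continuous_on_indicator) auto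
    then show "(\<lambda>y. indicator D y * h y) \<in> borel_measurable borel" by simp
    show "norm (indicator D y * h y) \<le> \<bar>M\<bar>" for y
      using M[of y] by (auto simp: indicator_def)
  qed simp
qed

text \<open>The energy identity at level 2 \<epsilon> equates the integral of a gradient-flux term
  with minus that of a weighted cube of the truncated difference. In the limit the former is
  nonnegative by monotonicity, whereas the latter is strictly negative if h exceeds k by more than 2
  \<epsilon> at \<xi>. Only h is mollified; the flux of k is linear and is differentiated
  directly.\<close>

lemma comparison_core:
  fixes h :: "'a::euclidean_space \<times> real \<Rightarrow> real" and g :: "'a \<times> real \<Rightarrow> 'a"
    and D D' E :: "('a \<times> real) set" and p c \<gamma> :: real and a :: 'a
  defines "hD \<equiv> \<lambda>y. indicator D y * h y"
    and "gD \<equiv> \<lambda>b y. indicator D y * (g y \<bullet> b)"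
    and "GD \<equiv> \<lambda>b y. indicator D y * ((norm (g y) powr (p - 2) *\<^sub>R g y) \<bullet> b)"
    and "k \<equiv> exact_sol p c \<gamma> a"
  assumes p: "p > 2" and D: "open D" "bounded D" and D': "open D'" "D' \<noteq> {}" and r: "r > 0" "\<And>z. z \<in> D' \<Longrightarrow> cball z r \<subseteq> D"
    and E: "compact E" "E \<subseteq> D'"
    and h: "uniformly_continuous_on D h" "bounded (h ` D)"
    and g: "in_Lp p D g"
    and eq1: "\<And>\<rho> z b. 0 < \<rho> \<Longrightarrow> \<rho> \<le> r \<Longrightarrow> z \<in> D' \<Longrightarrow> b \<in> Basis \<Longrightarrow>
        mollify_deriv \<rho> (b, 0) hD z = mollify \<rho> (gD b) z"
    and eq2: "\<And>\<rho> z. 0 < \<rho> \<Longrightarrow> \<rho> \<le> r \<Longrightarrow> z \<in> D' \<Longrightarrow>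
        mollify_deriv \<rho> (0, 1) hD z = (\<Sum>b\<in>Basis. mollify_deriv \<rho> (b, 0) (GD b) z)"
    and small: "\<And>z. z \<in> D' \<Longrightarrow> z \<notin> E \<Longrightarrow> snd z \<le> T \<Longrightarrow> h z - k z \<le> \<epsilon>"
    and \<epsilon>: "\<epsilon> > 0" and \<xi>: "\<xi> \<in> D'" "snd \<xi> < T"
  shows "h \<xi> - k \<xi> \<le> 2 * \<epsilon>"
proof (rule ccontr)
  assume contra: "\<not> h \<xi> - k \<xi> \<le> 2 * \<epsilon>"
  have sub: "D' \<subseteq> D" using r by (meson centre_in_cball less_imp_le subsetD subsetI)
  have bD': "bounded D'" using D(2) sub bounded_subset by blast
  obtain Mh where Mh: "\<And>z. z \<in> D \<Longrightarrow> \<bar>h z\<bar> \<le> Mh"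
    using h(2) by (metis (no_types, lifting) bounded_iff imageI real_norm_def)
  have ck: "continuous_on UNIV k" unfolding k_def by (rule continuous_exact_sol[OF p])
  obtain Mk where Mk: "\<And>z. z \<in> D' \<Longrightarrow> \<bar>k z\<bar> \<le> Mk"
    using bounded_fun_on_continuous[OF bD' ck] by (auto simp: bounded_fun_on_def)
  define q where "q = (\<lambda>z::'a \<times> real. exact_grad p \<gamma> a (fst z))"
  define Q where "Q = (\<lambda>z::'a \<times> real. flux_coeff p \<gamma> *\<^sub>R (fst z - a))"
  have qQ: "norm (q z) powr (p - 2) *\<^sub>R q z = Q z" for z
    unfolding q_def Q_def by (rule exact_grad_flux[OF p])
  have cq: "continuous_on UNIV q" unfolding q_def
    by (rule continuous_on_compose2[OF continuous_exact_grad[OF p, of UNIV]]) (auto intro!: continuous_intros)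
  have cQ: "continuous_on UNIV Q" unfolding Q_def by (intro continuous_intros)
  obtain Rq where Rq: "\<And>z. z \<in> D' \<Longrightarrow> \<bar>norm (q z)\<bar> \<le> Rq"
    using bounded_fun_on_continuous[OF bD' continuous_on_norm[OF cq]] by (auto simp: bounded_fun_on_def)
  obtain RQ where RQ: "\<And>z. z \<in> D' \<Longrightarrow> \<bar>norm (Q z)\<bar> \<le> RQ"
    using bounded_fun_on_continuous[OF bD' continuous_on_norm[OF cQ]] by (auto simp: bounded_fun_on_def)
  \<comment> \<open>One constant bounds the gradient q and the flux Q of k on D'. Below, the
    mollifications of \<open>\<alpha>\<close> and \<open>\<beta>\<close> dominate \<open>Wx\<close>
    and \<open>J\<close>, and that of \<open>A\<close> dominates their product.\<close>
  define R where "R = max 1 (max Rq RQ)"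
  have R: "R \<ge> 1" "\<And>z. z \<in> D' \<Longrightarrow> norm (q z) \<le> R" "\<And>z. z \<in> D' \<Longrightarrow> norm (Q z) \<le> R"
    using Rq RQ by (fastforce simp: R_def)+
  define \<alpha> where "\<alpha> = (\<lambda>y. indicator D y * (norm (g y) + R))"
  define \<beta> where "\<beta> = (\<lambda>y. indicator D y * (norm (g y) powr (p - 1) + R))"
  define A where "A = (\<lambda>y. indicator D y * (norm (g y) + R) powr p)"
  have [measurable]: "D \<in> sets borel" "D' \<in> sets borel" using D(1) D'(1) by auto
  have Lp1: "norm v \<le> 1 + norm v powr p" "norm v powr (p - 1) \<le> 1 + norm v powr p" for v :: 'a
    using powr_le_1_plus_powr[of "norm v" 1 p] powr_le_1_plus_powr[of "norm v" "p - 1" p] p by auto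
  have int_gD: "integrable lborel (gD b)" and int_GD: "integrable lborel (GD b)" if "b \<in> Basis" for b
    unfolding gD_def GD_def using Lp_integrable_components[OF p g D that] by auto
  have exp: "(1 + R) * (1 + norm v powr p) \<ge> 1 + R + norm v powr p" for v :: 'a
    using R(1) by (simp add: algebra_simps)
  have int_\<alpha>: "integrable lborel \<alpha>"
    unfolding \<alpha>_def
  proof (rule Lp_integrable[OF g D, of "\<lambda>v. norm v + R" "1 + R"])
    show "\<bar>norm v + R\<bar> \<le> (1 + R) * (1 + norm v powr p)" for v :: 'a
      using Lp1(1)[of v] R(1) exp[of v] norm_ge_zero[of v] by linarith
  qed simp
  have int_\<beta>: "integrable lborel \<beta>"
    unfolding \<beta>_def
  proof (rule Lp_integrable[OF g D, of "\<lambda>v. norm v powr (p - 1) + R" "1 + R"])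
    show "\<bar>norm v powr (p - 1) + R\<bar> \<le> (1 + R) * (1 + norm v powr p)" for v :: 'a
      using Lp1(2)[of v] R(1) exp[of v] powr_ge_zero[of "norm v" "p - 1"] by linarith
  qed simp
  have int_A: "integrable lborel A"
    unfolding A_def
  proof (rule Lp_integrable[OF g D, of "\<lambda>v. (norm v + R) powr p" "(2 * R) powr p"])
    show "\<bar>(norm v + R) powr p\<bar> \<le> (2 * R) powr p * (1 + norm v powr p)" for v :: 'a
    proof -
      have "norm v + R \<le> 2 * R * max 1 (norm v)"
      proof (cases "norm v \<le> 1")
        case False
        have "R * 1 \<le> R * norm v" "1 * norm v \<le> R * norm v"
          using R(1) False by (intro mult_left_mono mult_right_mono; simp)+
        then show ?thesis using False by simp
      qed (use R(1) in simp)
      then have "(norm v + R) powr p \<le> (2 * R * max 1 (norm v)) powr p"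
        using p R(1) by (intro powr_mono2) auto
      also have "\<dots> = (2 * R) powr p * max 1 (norm v) powr p"
        using R(1) by (subst powr_mult) auto
      also have "max 1 (norm v) powr p \<le> 1 + norm v powr p"
        by (auto simp: max_def)
      finally show ?thesis by (simp add: mult_left_mono)
    qed
  qed simp
  have m_hD: "integrable lborel hD"
    unfolding hD_def by (rule uniformly_continuous_integrable[OF D h])
  \<comment> \<open>The components of gradient and flux are needed for the almost everywhere limit
    of Y, and A for the convergence of its lower bound.\<close>
  define Fam where "Fam = insert A (gD ` Basis \<union> GD ` Basis)"
  \<comment> \<open>The bound \<epsilon> keeps W at most 2 \<epsilon> off E for every n, up to time
    T; the bound e gives uniform convergence on D'. The restriction \<rho> \<le> r keeps the kernels
    inside D.\<close>
  define P where "P = (\<lambda>e \<rho>. \<rho> \<le> r \<and> (\<forall>z\<in>D'. \<bar>mollify \<rho> hD z - h z\<bar> \<le> min \<epsilon> e))"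
  have "\<exists>\<rho>. (\<forall>n. \<rho> n > 0 \<and> P (1 / real (Suc n)) (\<rho> n)) \<and>
    (\<forall>f\<in>Fam. (\<lambda>n. LBINT z. \<bar>mollify (\<rho> n) f z - f z\<bar>) \<longlonglongrightarrow> 0) \<and>
    (\<forall>f\<in>Fam. \<forall>n. integrable lborel (mollify (\<rho> n) f)) \<and>
    (AE z in lborel. \<forall>f\<in>Fam. (\<lambda>n. mollify (\<rho> n) f z) \<longlonglongrightarrow> f z)"
  proof (rule mollify_sequence)
    show "finite Fam" by (simp add: Fam_def)
    show "integrable lborel f" if "f \<in> Fam" for f
      using that int_A int_gD int_GD by (auto simp: Fam_def)
    show "P e' \<rho>" if "P e \<rho>" "e \<le> e'" for e e' \<rho>
      using that by (force simp: P_def)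
    fix e :: real assume e: "e > 0"
    then obtain d where d: "d > 0" "\<And>x y. x \<in> D \<Longrightarrow> y \<in> D \<Longrightarrow> dist y x < d \<Longrightarrow> dist (h y) (h x) < min \<epsilon> e"
      using h(1) \<epsilon> unfolding uniformly_continuous_on_def by (metis min_less_iff_conj)
    have "P e \<rho>" if "0 < \<rho>" "\<rho> < min d r" for \<rho>
      unfolding P_def
    proof (intro conjI ballI)
      fix z assume z: "z \<in> D'"
      show "\<bar>mollify \<rho> hD z - h z\<bar> \<le> min \<epsilon> e"
      proof (rule mollify_near[OF that(1) m_hD])
        fix y assume y: "norm (z - y) < \<rho>"
        then have "y \<in> D" using r(2)[OF z] that by (auto simp: dist_norm)
        then show "\<bar>hD y - h z\<bar> \<le> min \<epsilon> e"
          using d(2)[of z y] z sub y that by (auto simp: hD_def dist_norm norm_minus_commute)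
      qed
    qed (use that in auto)
    then show "\<forall>\<^sub>F \<rho> in at_right 0. P e \<rho>"
      unfolding eventually_at_right_field using d(1) r(1) by (intro exI[of _ "min d r"]) auto
  qed
  then obtain \<rho> where \<rho>: "\<And>n. \<rho> n > 0" "\<And>n. P (1 / real (Suc n)) (\<rho> n)"
    "\<And>f. f \<in> Fam \<Longrightarrow> (\<lambda>n. LBINT z. \<bar>mollify (\<rho> n) f z - f z\<bar>) \<longlonglongrightarrow> 0"
    "\<And>f n. f \<in> Fam \<Longrightarrow> integrable lborel (mollify (\<rho> n) f)"
    "AE z in lborel. \<forall>f\<in>Fam. (\<lambda>n. mollify (\<rho> n) f z) \<longlonglongrightarrow> f z"
    by blast
  have \<rho>r: "\<rho> n \<le> r" for n using \<rho>(2)[of n] by (simp add: P_def)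
  have near: "\<bar>mollify (\<rho> n) hD z - h z\<bar> \<le> \<epsilon>" "\<bar>mollify (\<rho> n) hD z - h z\<bar> \<le> 1 / real (Suc n)" if "z \<in> D'" for n z
    using \<rho>(2)[of n] that by (auto simp: P_def)
  have famA: "A \<in> Fam" and famg: "\<And>b. b \<in> Basis \<Longrightarrow> gD b \<in> Fam" and famG: "\<And>b. b \<in> Basis \<Longrightarrow> GD b \<in> Fam"
    by (auto simp: Fam_def)
  define W where "W = (\<lambda>n z. mollify (\<rho> n) hD z - k z)"
  define Wt where "Wt = (\<lambda>n z. mollify_deriv (\<rho> n) (0, 1) hD z - real DIM('a) * flux_coeff p \<gamma>)"
  define Wx where "Wx = (\<lambda>n b z. mollify (\<rho> n) (gD b) z - q z \<bullet> b)"
  define J where "J = (\<lambda>n b z. mollify (\<rho> n) (GD b) z - Q z \<bullet> b)"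
  define Jx where "Jx = (\<lambda>n b z. mollify_deriv (\<rho> n) (b, 0) (GD b) z - flux_coeff p \<gamma>)"
  define X where "X = (\<lambda>n z. indicator D' z * ((- 2 * max 0 (T - snd z)) * (max 0 (W n z - 2 * \<epsilon>)) ^ 3))"
  define Y where "Y = (\<lambda>n z. indicator D' z * ((max 0 (T - snd z))\<^sup>2 * (6 * max 0 (W n z - 2 * \<epsilon>)) * (\<Sum>b\<in>Basis. Wx n b z * J n b z)))"
  have XY: "integrable lborel (X n)" "integrable lborel (Y n)" "integral\<^sup>L lborel (Y n) = integral\<^sup>L lborel (X n)" for n
  proof -
    note m = borel_measurable_integrable[OF m_hD, simplified]
    have 1: "W n \<in> borel_measurable borel"
      unfolding W_def by (intro borel_measurable_diff mollify_measurable m borel_measurable_continuous_onI[OF ck])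
    have 2: "J n b \<in> borel_measurable borel" if "b \<in> Basis" for b
    proof -
      have "(\<lambda>z. Q z \<bullet> b) \<in> borel_measurable borel"
        using cQ by (intro borel_measurable_continuous_onI continuous_intros)
      then show ?thesis
        unfolding J_def using borel_measurable_integrable[OF int_GD[OF that]]
        by (intro borel_measurable_diff mollify_measurable) auto
    qed
    have b0: "bounded_fun_on D' (mollify (\<rho> n) f)" if "integrable lborel f" for f :: "'a \<times> real \<Rightarrow> real"
      using mollify_bounded[OF \<rho>(1) that] unfolding bounded_fun_on_def by metis
    have b1: "bounded_fun_on D' (mollify_deriv (\<rho> n) v f)" if "integrable lborel f" for f :: "'a \<times> real \<Rightarrow> real" and v
      using mollify_deriv_bounded[OF \<rho>(1) that] unfolding bounded_fun_on_def by metis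
    have bc: "bounded_fun_on D' f" if "continuous_on UNIV f" for f
      using that by (rule bounded_fun_on_continuous[OF bD'])
    have 3: "bounded_fun_on D' (W n)" "bounded_fun_on D' (Wt n)"
      unfolding W_def Wt_def by (intro bounded_fun_on_diff b0 b1 bc m_hD ck continuous_on_const)+
    have 4: "bounded_fun_on D' (Wx n b)" "bounded_fun_on D' (J n b)" "bounded_fun_on D' (Jx n b)" if "b \<in> Basis" for b
      unfolding Wx_def J_def Jx_def
      by (intro bounded_fun_on_diff b0 b1 bc int_gD int_GD that continuous_intros cq cQ)+
    have 5: "has_dir_deriv (W n) (Wt n z) (0, 1) z" for z
      unfolding W_def Wt_def k_def
      by (intro has_dir_deriv_diff mollify_dir_deriv \<rho>(1) m_hD exact_sol_time_deriv[OF p])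
    have 6: "has_dir_deriv (W n) (Wx n b z) (b, 0) z" if z: "z \<in> D'" and b: "b \<in> Basis" for z b
    proof -
      have "has_dir_deriv (W n) (mollify_deriv (\<rho> n) (b, 0) hD z - q z \<bullet> b) (b, 0) z"
        unfolding W_def q_def k_def
        by (intro has_dir_deriv_diff mollify_dir_deriv \<rho>(1) m_hD exact_sol_space_deriv[OF p])
      then show ?thesis
        by (simp add: Wx_def eq1[OF \<rho>(1) \<rho>r z b])
    qed
    have 7: "has_dir_deriv (J n b) (Jx n b z) (b, 0) z" if b: "b \<in> Basis" for z b
    proof -
      have "has_dir_deriv (\<lambda>z. Q z \<bullet> b) (flux_coeff p \<gamma>) (b, 0) z"
        unfolding has_dir_deriv_def Q_def using b
        by (auto intro!: derivative_eq_intros simp: inner_diff_left inner_add_left inner_Basis)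
      then show ?thesis
        unfolding J_def Jx_def by (intro has_dir_deriv_diff mollify_dir_deriv \<rho>(1) int_GD[OF b])
    qed
    have 8: "Wt n z = (\<Sum>b\<in>Basis. Jx n b z)" if "z \<in> D'" for z
      unfolding Wt_def Jx_def eq2[OF \<rho>(1) \<rho>r that] by (simp add: sum_subtractf)
    have 9: "W n z \<le> 2 * \<epsilon>" if "z \<in> D'" "z \<notin> E" "snd z \<le> T" for z
      using small[OF that] near(1)[OF that(1), of n] unfolding W_def by linarith
    note ei = energy_identity[where W="W n" and Wt="Wt n" and Wx="Wx n" and J="J n" and Jx="Jx n" and T=T and e="2 * \<epsilon>",
        OF D'(1) bD' E 1 2 3 4 5 6 7 8 9]
    show "integrable lborel (X n)" "integrable lborel (Y n)" "integral\<^sup>L lborel (Y n) = integral\<^sup>L lborel (X n)"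
      unfolding X_def Y_def by (rule ei; assumption)+
  qed
  define w where "w = (\<lambda>z. h z - k z)"
  have Wlim: "(\<lambda>n. W n z) \<longlonglongrightarrow> w z" if "z \<in> D'" for z
  proof -
    have "(\<lambda>n. mollify (\<rho> n) hD z - h z) \<longlonglongrightarrow> 0"
    proof (rule Lim_null_comparison)
      show "(\<lambda>n. 1 / real (Suc n)) \<longlonglongrightarrow> 0"
        by (rule LIMSEQ_1_over_Suc)
      show "\<forall>\<^sub>F n in sequentially. norm (mollify (\<rho> n) hD z - h z) \<le> 1 / real (Suc n)"
        using near(2)[OF that] by simp
    qed
    then have "(\<lambda>n. mollify (\<rho> n) hD z) \<longlonglongrightarrow> h z" by (rule LIM_zero_cancel)
    then show ?thesis unfolding W_def w_def by (intro tendsto_intros)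
  qed
  define X' where "X' = (\<lambda>z. indicator D' z * ((- 2 * max 0 (T - snd z)) * (max 0 (w z - 2 * \<epsilon>)) ^ 3))"
  have Xlim: "(\<lambda>n. X n z) \<longlonglongrightarrow> X' z" for z
  proof (cases "z \<in> D'")
    case True
    then show ?thesis unfolding X_def X'_def by (intro tendsto_intros Wlim)
  qed (simp add: X_def X'_def)
  define MW where "MW = Mh + Mk + \<epsilon>"
  have MW: "\<bar>W n z\<bar> \<le> MW" if "z \<in> D'" for n z
    using near(1)[OF that, of n] Mh[of z] Mk[OF that] that sub unfolding W_def MW_def by (smt (verit) subsetD)
  have MW0: "MW \<ge> 0" using MW[OF \<xi>(1), of 0] by linarith
  obtain ST where ST: "\<And>z. z \<in> D' \<Longrightarrow> \<bar>T - snd z\<bar> \<le> ST"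
    using bounded_fun_on_continuous[OF bD', of "\<lambda>z. T - snd z", OF continuous_on_diff[OF continuous_on_const continuous_on_snd[OF continuous_on_id]]]
    unfolding bounded_fun_on_def by blast
  have ST0: "ST \<ge> 0" using ST[OF \<xi>(1)] by linarith
  have mx: "max 0 (T - snd z) \<le> ST" "max 0 (W n z - 2 * \<epsilon>) \<le> MW" if "z \<in> D'" for n z
    using ST[OF that] MW[OF that, of n] ST0 MW0 \<epsilon> by auto
  have X'_int: "integrable lborel X'" "(\<lambda>n. integral\<^sup>L lborel (X n)) \<longlonglongrightarrow> integral\<^sup>L lborel X'"
  proof -
    have w: "integrable lborel (\<lambda>z. indicator D' z * (2 * ST * MW ^ 3))"
      using bD' by (intro integrable_mult_left integrable_real_indicator emeasure_bounded_finite) auto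
    have dom: "AE z in lborel. norm (X n z) \<le> indicator D' z * (2 * ST * MW ^ 3)" for n
    proof (rule AE_I2)
      fix z :: "'a \<times> real"
      show "norm (X n z) \<le> indicator D' z * (2 * ST * MW ^ 3)"
      proof (cases "z \<in> D'")
        case True
        have "max 0 (T - snd z) * max 0 (W n z - 2 * \<epsilon>) ^ 3 \<le> ST * MW ^ 3"
          using mx(1)[OF True] mx(2)[OF True, of n] ST0 by (intro mult_mono power_mono) auto
        then show ?thesis
          using True by (simp add: X_def abs_mult)
      qed (simp add: X_def)
    qed
    have lim: "AE z in lborel. (\<lambda>n. X n z) \<longlonglongrightarrow> X' z" using Xlim by simp
    have meas: "X n \<in> borel_measurable lborel" for n using XY(1) by (rule borel_measurable_integrable)
    have meas': "X' \<in> borel_measurable lborel"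
      by (rule borel_measurable_LIMSEQ_real[OF Xlim meas])
    show "integrable lborel X'"
      by (rule integrable_dominated_convergence[OF meas' meas w lim dom])
    show "(\<lambda>n. integral\<^sup>L lborel (X n)) \<longlonglongrightarrow> integral\<^sup>L lborel X'"
      by (rule integral_dominated_convergence[OF meas' meas w lim dom])
  qed
  \<comment> \<open>ST^2 (6 MW) bounds the weight in Y, and each of the \<open>DIM('a)\<close>
    products contributes at most 4 times the mollification of A.\<close>
  define C where "C = ST\<^sup>2 * (6 * MW) * (4 * real DIM('a))"
  have C0: "C \<ge> 0" using ST0 MW0 by (simp add: C_def)
  have molA: "mollify (\<rho> n) A z \<ge> 0" for n z
    unfolding mollify_def A_def by (intro Bochner_Integration.integral_nonneg mult_nonneg_nonneg mollifier_nonneg \<rho>(1)) auto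
  \<comment> \<open>Subtracting s costs at most R, and R is the value at z of the mollified function
    R 1_D, because the kernel at z is supported in D.\<close>
  have shiftR: "\<bar>mollify (\<rho> n) f z - s\<bar> \<le> mollify (\<rho> n) (\<lambda>y. indicator D y * (F y + R)) z"
    if z: "z \<in> D'" and f: "integrable lborel f" "integrable lborel (\<lambda>y. indicator D y * (F y + R))"
      and le: "\<And>y. \<bar>f y\<bar> \<le> indicator D y * F y" and s: "\<bar>s\<bar> \<le> R" for n f F s z
  proof -
    have i: "integrable lborel (\<lambda>y. \<bar>f y\<bar>)" "integrable lborel (\<lambda>y. indicator D y * R :: real)"
      using f(1) D by (auto intro!: integrable_mult_left integrable_real_indicator emeasure_bounded_finite)
    have "\<bar>mollify (\<rho> n) (\<lambda>y. indicator D y * R) z - R\<bar> \<le> 0"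
    proof (rule mollify_near[OF \<rho>(1) i(2)])
      fix y assume "norm (z - y) < \<rho> n"
      then have "y \<in> cball z r" using \<rho>r[of n] by (simp add: dist_norm)
      then have "y \<in> D" using r(2)[OF z] by blast
      then show "\<bar>indicator D y * R - R\<bar> \<le> 0" by simp
    qed
    then have R: "mollify (\<rho> n) (\<lambda>y. indicator D y * R) z = R" by simp
    have "\<bar>mollify (\<rho> n) f z - s\<bar> \<le> mollify (\<rho> n) (\<lambda>y. \<bar>f y\<bar>) z + R"
      using mollify_abs_le[OF \<rho>(1) f(1), of n z] s by linarith
    also have "\<dots> = mollify (\<rho> n) (\<lambda>y. \<bar>f y\<bar> + indicator D y * R) z"
      using mollify_add[OF \<rho>(1) i, of n z] R by simp
    also have "\<dots> \<le> mollify (\<rho> n) (\<lambda>y. indicator D y * (F y + R)) z"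
      using le i f by (intro mollify_mono[OF \<rho>(1)]) (auto simp: distrib_left)
    finally show ?thesis .
  qed
  have prod: "\<bar>Wx n b z * J n b z\<bar> \<le> 4 * mollify (\<rho> n) A z" if z: "z \<in> D'" and b: "b \<in> Basis" for n b z
  proof -
    have "\<bar>Wx n b z\<bar> \<le> mollify (\<rho> n) \<alpha> z"
      unfolding Wx_def \<alpha>_def
    proof (rule shiftR[OF z int_gD[OF b] int_\<alpha>[unfolded \<alpha>_def]])
      show "\<bar>gD b y\<bar> \<le> indicator D y * norm (g y)" for y
        using Basis_le_norm[OF b, of "g y"] by (simp add: gD_def indicator_def)
      show "\<bar>q z \<bullet> b\<bar> \<le> R"
        using Basis_le_norm[OF b, of "q z"] R(2)[OF z] by linarith
    qed
    moreover have "\<bar>J n b z\<bar> \<le> mollify (\<rho> n) \<beta> z"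
      unfolding J_def \<beta>_def
    proof (rule shiftR[OF z int_GD[OF b] int_\<beta>[unfolded \<beta>_def]])
      show "\<bar>GD b y\<bar> \<le> indicator D y * norm (g y) powr (p - 1)" for y
        using Basis_le_norm[OF b, of "norm (g y) powr (p - 2) *\<^sub>R g y"] unfolding norm_flux
        by (simp add: GD_def indicator_def)
      show "\<bar>Q z \<bullet> b\<bar> \<le> R"
        using Basis_le_norm[OF b, of "Q z"] R(3)[OF z] by linarith
    qed
    ultimately have "\<bar>Wx n b z * J n b z\<bar> \<le> mollify (\<rho> n) \<alpha> z * mollify (\<rho> n) \<beta> z"
      unfolding abs_mult by (intro mult_mono) auto
    also have "\<dots> \<le> 2 * 2 * mollify (\<rho> n) A z"
      unfolding mollify_def
    proof (rule integral_product_le)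
      show "\<alpha> y * \<beta> y' \<le> 2 * (A y + A y')" for y y'
        using young_cross[OF p R(1), of "norm (g y)" "norm (g y')"]
        by (auto simp: \<alpha>_def \<beta>_def A_def indicator_def)
    qed (use mollifier_reflect_integrable[OF \<rho>(1)] mollifier_reflect_integral[OF \<rho>(1)] mollifier_nonneg[OF \<rho>(1)]
        mollify_integrable[OF \<rho>(1) int_\<alpha>] mollify_integrable[OF \<rho>(1) int_\<beta>] mollify_integrable[OF \<rho>(1) int_A] in auto)
    finally show ?thesis by simp
  qed
  define Y' where "Y' = (\<lambda>z. indicator D' z * ((max 0 (T - snd z))\<^sup>2 * (6 * max 0 (w z - 2 * \<epsilon>)) *
      (\<Sum>b\<in>Basis. (gD b z - q z \<bullet> b) * (GD b z - Q z \<bullet> b))))"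
  have "integral\<^sup>L lborel X' \<ge> 0"
  proof (rule integral_limit_nonneg[where M=lborel and Y=Y and \<Lambda>="\<lambda>n z. C * mollify (\<rho> n) A z" and \<Lambda>'="\<lambda>z. C * A z" and Y'=Y'])
    show "integrable lborel (Y n)" for n by (rule XY(2))
    show "integrable lborel (\<lambda>z. C * mollify (\<rho> n) A z)" for n
      using \<rho>(4)[OF famA] by simp
    show "integrable lborel (\<lambda>z. C * A z)" using int_A by simp
    show "Y n z + C * mollify (\<rho> n) A z \<ge> 0" for n z
    proof (cases "z \<in> D'")
      case True
      let ?m = "(max 0 (T - snd z))\<^sup>2 * (6 * max 0 (W n z - 2 * \<epsilon>))"
      let ?S = "\<Sum>b\<in>Basis. Wx n b z * J n b z"
      have m: "0 \<le> ?m" "?m \<le> ST\<^sup>2 * (6 * MW)"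
        using mx(1)[OF True] mx(2)[OF True, of n] by (auto intro!: mult_mono power_mono)
      have "\<bar>?S\<bar> \<le> (\<Sum>b\<in>(Basis::'a set). 4 * mollify (\<rho> n) A z)"
        using prod[OF True] by (intro order_trans[OF sum_abs] sum_mono) auto
      then have S: "\<bar>?S\<bar> \<le> 4 * real DIM('a) * mollify (\<rho> n) A z" by simp
      have "\<bar>?m * ?S\<bar> \<le> (ST\<^sup>2 * (6 * MW)) * (4 * real DIM('a) * mollify (\<rho> n) A z)"
        unfolding abs_mult[of ?m] using m S ST0 MW0
        by (intro mult_mono mult_nonneg_nonneg) (auto intro: order_trans[OF m(1)])
      then show ?thesis using True by (simp add: Y_def C_def mult.assoc)
    next
      case False
      then show ?thesis using C0 molA by (simp add: Y_def)
    qed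
    show "AE z in lborel. (\<lambda>n. Y n z) \<longlonglongrightarrow> Y' z"
      using \<rho>(5)
    proof eventually_elim
      case (elim z)
      show ?case
      proof (cases "z \<in> D'")
        case True
        have "(\<lambda>n. Wx n b z) \<longlonglongrightarrow> gD b z - q z \<bullet> b" "(\<lambda>n. J n b z) \<longlonglongrightarrow> GD b z - Q z \<bullet> b" if "b \<in> Basis" for b
          using elim famg[OF that] famG[OF that] unfolding Wx_def J_def by (auto intro!: tendsto_diff)
        then show ?thesis
          unfolding Y_def Y'_def by (intro tendsto_intros Wlim[OF True]) auto
      qed (simp add: Y_def Y'_def)
    qed
    show "AE z in lborel. (\<lambda>n. C * mollify (\<rho> n) A z) \<longlonglongrightarrow> C * A z"
      using \<rho>(5) by eventually_elim (use famA in \<open>auto intro!: tendsto_mult\<close>)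
    show "AE z in lborel. Y' z \<ge> 0"
    proof (rule AE_I2)
      fix z :: "'a \<times> real"
      show "Y' z \<ge> 0"
      proof (cases "z \<in> D'")
        case True
        then have "z \<in> D" using sub by blast
        have "0 \<le> (g z - q z) \<bullet> (norm (g z) powr (p - 2) *\<^sub>R g z - norm (q z) powr (p - 2) *\<^sub>R q z)"
          by (rule flux_monotone[OF p])
        also have "\<dots> = (\<Sum>b\<in>Basis. ((g z - q z) \<bullet> b) * ((norm (g z) powr (p - 2) *\<^sub>R g z - Q z) \<bullet> b))"
          unfolding qQ by (rule euclidean_inner)
        also have "\<dots> = (\<Sum>b\<in>Basis. (gD b z - q z \<bullet> b) * (GD b z - Q z \<bullet> b))"
          using \<open>z \<in> D\<close> by (simp add: gD_def GD_def inner_diff_left)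
        finally show ?thesis
          unfolding Y'_def by (intro mult_nonneg_nonneg) auto
      qed (simp add: Y'_def)
    qed
    show "C * A z \<ge> 0" for z using C0 by (simp add: A_def)
    show "(\<lambda>n. LBINT z. C * mollify (\<rho> n) A z) \<longlonglongrightarrow> (LBINT z. C * A z)"
    proof -
      have "(\<lambda>n. integral\<^sup>L lborel (mollify (\<rho> n) A) - integral\<^sup>L lborel A) \<longlonglongrightarrow> 0"
      proof (rule Lim_null_comparison[OF _ \<rho>(3)[OF famA]], rule always_eventually, rule allI)
        fix n
        have "integral\<^sup>L lborel (mollify (\<rho> n) A) - integral\<^sup>L lborel A = (LBINT z. mollify (\<rho> n) A z - A z)"
          using \<rho>(4)[OF famA] int_A by (intro Bochner_Integration.integral_diff[symmetric])
        then show "norm (integral\<^sup>L lborel (mollify (\<rho> n) A) - integral\<^sup>L lborel A) \<le> (LBINT z. \<bar>mollify (\<rho> n) A z - A z\<bar>)"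
          by (simp add: integral_abs_bound)
      qed
      then have "(\<lambda>n. integral\<^sup>L lborel (mollify (\<rho> n) A)) \<longlonglongrightarrow> integral\<^sup>L lborel A" by (rule LIM_zero_cancel)
      then show ?thesis by (simp add: tendsto_mult)
    qed
    show "(\<lambda>n. integral\<^sup>L lborel (Y n)) \<longlonglongrightarrow> integral\<^sup>L lborel X'"
      unfolding XY(3) by (rule X'_int(2))
  qed
  moreover have "integral\<^sup>L lborel X' < 0"
  proof -
    \<comment> \<open>Near \<xi> one has w - 2 \<epsilon> > \<delta> and T - t larger than half of T
      - \<open>snd \<xi>\<close>. There X' is at most -\<kappa>, and nowhere is it positive.\<close>
    define \<delta> where "\<delta> = (w \<xi> - 2 * \<epsilon>) / 2"
    have \<delta>: "\<delta> > 0" using contra by (simp add: \<delta>_def w_def)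
    have cw: "continuous_on D' w"
      unfolding w_def using uniformly_continuous_imp_continuous[OF h(1)] ck sub
      by (intro continuous_intros) (auto intro: continuous_on_subset)
    have "open ({z \<in> D'. w z > 2 * \<epsilon> + \<delta>} \<inter> {z. snd z < (T + snd \<xi>) / 2})"
    proof (intro open_Int)
      have "open (D' \<inter> w -` {2 * \<epsilon> + \<delta> <..})"
        using cw D'(1) by (intro continuous_open_preimage) auto
      moreover have "D' \<inter> w -` {2 * \<epsilon> + \<delta> <..} = {z \<in> D'. w z > 2 * \<epsilon> + \<delta>}" by auto
      ultimately show "open {z \<in> D'. w z > 2 * \<epsilon> + \<delta>}" by simp
      show "open {z::'a \<times> real. snd z < (T + snd \<xi>) / 2}"
        by (intro open_Collect_less continuous_intros)
    qed
    moreover have "\<xi> \<in> {z \<in> D'. w z > 2 * \<epsilon> + \<delta>} \<inter> {z. snd z < (T + snd \<xi>) / 2}"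
      using \<xi> \<delta> by (auto simp: \<delta>_def field_simps)
    ultimately obtain d where d: "d > 0" "ball \<xi> d \<subseteq> {z \<in> D'. w z > 2 * \<epsilon> + \<delta>} \<inter> {z. snd z < (T + snd \<xi>) / 2}"
      unfolding open_contains_ball by meson
    define \<kappa> where "\<kappa> = (T - snd \<xi>) * \<delta> ^ 3"
    have \<kappa>: "\<kappa> > 0" using \<xi>(2) \<delta> by (simp add: \<kappa>_def)
    have "X' z \<le> - \<kappa> * indicator (ball \<xi> d) z" for z
    proof (cases "z \<in> ball \<xi> d")
      case True
      then have z: "z \<in> D'" "w z > 2 * \<epsilon> + \<delta>" "snd z < (T + snd \<xi>) / 2" using d(2) by auto
      have "(T - snd \<xi>) / 2 * \<delta> ^ 3 \<le> max 0 (T - snd z) * max 0 (w z - 2 * \<epsilon>) ^ 3"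
        using z(2,3) \<delta> \<xi>(2) by (intro mult_mono power_mono) auto
      then show ?thesis using z True by (simp add: X'_def \<kappa>_def)
    next
      case False
      have "0 \<le> max 0 (T - snd z) * max 0 (w z - 2 * \<epsilon>) ^ 3" by simp
      then show ?thesis using False by (simp add: X'_def indicator_def)
    qed
    then have "integral\<^sup>L lborel X' \<le> (LBINT z. - \<kappa> * indicator (ball \<xi> d) z)"
      using X'_int(1) by (intro integral_mono integrable_mult_right integrable_real_indicator emeasure_bounded_finite) auto
    also have "\<dots> < 0"
      using \<kappa> content_ball_pos[OF d(1), of \<xi>] by simp
    finally show ?thesis .
  qed
  ultimately show False by simp
qed

text \<open>The set E where the excess is at least \<epsilon>, up to a time T < t2, avoids the
  parabolic boundary and is compact in the open cylinder. It may reach the time T, and its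
  neighbourhoods may extend past T: the weight (T - t)_+^2 vanishes from there on.\<close>

theorem exact_sol_comparison:
  fixes Q :: "'a::euclidean_space set" and h :: "'a \<times> real \<Rightarrow> real"
  assumes p: "p > 2" and Q: "open Q" "bounded Q" and t12: "t1 < t2"
    and par: "p_parabolic p (Q \<times> {t1<..<t2}) h"
    and cont: "continuous_on (closure (Q \<times> {t1<..<t2})) h"
    and bdry: "\<And>\<zeta>. \<zeta> \<in> parabolic_boundary Q t1 t2 \<Longrightarrow> h \<zeta> \<le> exact_sol p c \<gamma> a \<zeta>"
    and \<xi>: "\<xi> \<in> Q \<times> {t1<..<t2}"
  shows "h \<xi> \<le> exact_sol p c \<gamma> a \<xi>"
proof (rule ccontr)
  let ?k = "exact_sol p c \<gamma> a"
  assume contra: "\<not> h \<xi> \<le> ?k \<xi>"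
  \<comment> \<open>A quarter of the excess at \<xi>, so that the bound 2 \<epsilon> from
    \<open>comparison_core\<close> contradicts the value 4 \<epsilon>.\<close>
  define \<epsilon> where "\<epsilon> = (h \<xi> - ?k \<xi>) / 4"
  have \<epsilon>: "\<epsilon> > 0" using contra by (simp add: \<epsilon>_def)
  define T where "T = (snd \<xi> + t2) / 2"
  have T: "snd \<xi> < T" "t1 < T" "T < t2" using \<xi> by (auto simp: T_def)
  define \<Omega> where "\<Omega> = Q \<times> {t1<..<t2}"
  have cl: "closure \<Omega> = closure Q \<times> {t1..t2}"
    using t12 by (simp add: \<Omega>_def closure_Times)
  define K where "K = closure Q \<times> {t1..T}"
  have compK: "compact K" using Q(2) by (simp add: K_def compact_Times compact_closure)
  have KO: "K \<subseteq> closure \<Omega>" using T unfolding cl K_def by auto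
  have cw: "continuous_on K (\<lambda>z. h z - ?k z)"
    using cont KO unfolding \<Omega>_def[symmetric]
    by (intro continuous_on_diff continuous_exact_sol[OF p]) (rule continuous_on_subset)
  define E where "E = {z \<in> K. h z - ?k z \<ge> \<epsilon>}"
  have "closed (K \<inter> (\<lambda>z. h z - ?k z) -` {\<epsilon>..})"
    using cw compact_imp_closed[OF compK] by (intro continuous_closed_preimage) auto
  moreover have E_eq: "E = K \<inter> (\<lambda>z. h z - ?k z) -` {\<epsilon>..}" by (auto simp: E_def)
  ultimately have compE: "compact E"
    using compact_Int_closed[OF compK, of E] by (metis E_eq inf.idem inf.left_commute inf_commute)
  have E\<Omega>: "E \<subseteq> \<Omega>"
  proof
    fix z assume z: "z \<in> E"
    then have w: "h z > ?k z" and zK: "fst z \<in> closure Q" "t1 \<le> snd z" "snd z \<le> T"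
      using \<epsilon> by (auto simp: E_def K_def)
    have nb: "z \<notin> parabolic_boundary Q t1 t2" using bdry[of z] w by auto
    then have "snd z \<noteq> t1" using zK by (cases z) (auto simp: parabolic_boundary_def)
    then have t: "t1 < snd z" "snd z < t2" using zK T by auto
    then have "fst z \<notin> frontier Q" using nb by (cases z) (auto simp: parabolic_boundary_def)
    then have "fst z \<in> Q" using zK(1) Q(1) by (auto simp: frontier_def interior_open)
    then show "z \<in> \<Omega>" using t by (cases z) (auto simp: \<Omega>_def)
  qed
  have \<xi>E: "\<xi> \<in> E"
    using \<xi> T \<epsilon> closure_subset[of Q] by (cases \<xi>) (auto simp: E_def K_def \<epsilon>_def)
  have open\<Omega>: "open \<Omega>" using Q(1) by (simp add: \<Omega>_def open_Times)
  obtain r0 where r0_pos: "r0 > 0" and r0_sub: "(\<Union>x\<in>E. cball x r0) \<subseteq> \<Omega>"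
    by (rule compact_subset_open_imp_cball_epsilon_subset[OF compE open\<Omega> E\<Omega>])
  have r0: "r0 > 0" "\<And>e. e \<in> E \<Longrightarrow> cball e r0 \<subseteq> \<Omega>"
    using r0_pos r0_sub by auto
  \<comment> \<open>A quarter of the margin r0: one r for the neighbourhood D' of E, one for the
    mollification, and the rest keeps the closure of D inside the cylinder. D is a product because
    the weak formulation is given on products.\<close>
  define r where "r = r0 / 4"
  have r: "r > 0" using r0 by (simp add: r_def)
  define U where "U = (\<Union>x\<in>fst ` E. ball x (2 * r))"
  define s1 s2 where "s1 = t1 + r" and "s2 = t2 - r"
  define D where "D = U \<times> {s1<..<s2}"
  define D' where "D' = (\<Union>e\<in>E. ball e r)"
  have Et: "snd e - 4 * r > t1" "snd e + 4 * r < t2" if "e \<in> E" for e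
  proof -
    have "(fst e, snd e - 4 * r) \<in> cball e r0" "(fst e, snd e + 4 * r) \<in> cball e r0"
      using r0(1) by (cases e; simp add: dist_prod_def r_def dist_real_def)+
    then show "snd e - 4 * r > t1" "snd e + 4 * r < t2" using r0(2)[OF that] by (auto simp: \<Omega>_def)
  qed
  have s12: "s1 < s2" using Et[OF \<xi>E] r by (simp add: s1_def s2_def)
  have openU: "open U" unfolding U_def by blast
  have clU: "closure U \<subseteq> Q"
  proof
    fix y assume "y \<in> closure U"
    then obtain u where u: "u \<in> U" "dist u y < r"
      using r unfolding closure_approachable by blast
    then obtain e where e: "e \<in> E" "dist (fst e) u < 2 * r" by (auto simp: U_def)
    have "dist (fst e) y \<le> dist (fst e) u + dist u y" by (rule dist_triangle)
    then have "dist (fst e) y \<le> r0" using u e(2) r by (simp add: r_def)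
    then have "(y, snd e) \<in> cball e r0" by (cases e) (simp add: dist_prod_def)
    then show "y \<in> Q" using r0(2)[OF e(1)] by (auto simp: \<Omega>_def)
  qed
  then have UQ: "U \<subseteq> Q" using closure_subset by blast
  have bU: "bounded U" using bounded_subset[OF Q(2) UQ] .
  have clD: "closure D = closure U \<times> {s1..s2}" using s12 by (simp add: D_def closure_Times)
  have "closure D \<subseteq> \<Omega>" unfolding clD \<Omega>_def using clU r by (auto simp: s1_def s2_def)
  moreover have "compact (closure D)" unfolding clD using bU by (simp add: compact_Times compact_closure)
  ultimately have cc: "compactly_contained D \<Omega>" by (simp add: compactly_contained_def)
  then obtain g where g: "parabolic_sobolev_with_gradient p U s1 s2 h g"
    and weak: "\<forall>\<phi>\<in>test_functions D.
        (LINT t:{s1<..<s2}|lborel. LINT x:U|lborel.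
                 (norm (g (x, t)) powr (p - 2) *\<^sub>R g (x, t)) \<bullet> space_gradient \<phi> (x, t))
            - (LINT t:{s1<..<s2}|lborel. LINT x:U|lborel.
                 h (x, t) * time_derivative \<phi> (x, t)) = 0"
    using par[unfolded p_parabolic_def, THEN conjunct2, rule_format, of U s1 s2, THEN conjunct2,
        folded D_def, folded \<Omega>_def] openU s12 by blast
  have gLp: "in_Lp p D g" using g by (simp add: parabolic_sobolev_with_gradient_def D_def)
  have openD: "open D" using openU by (simp add: D_def open_Times)
  have bD: "bounded D" using bU by (simp add: D_def bounded_Times)
  have D\<Omega>: "D \<subseteq> closure \<Omega>" using UQ closure_subset[of Q] r unfolding cl D_def s1_def s2_def by auto
  have comp\<Omega>: "compact (closure \<Omega>)" unfolding cl using Q(2) by (simp add: compact_Times compact_closure)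
  have uc: "uniformly_continuous_on D h"
    using compact_uniformly_continuous[OF cont[folded \<Omega>_def] comp\<Omega>] D\<Omega>
    unfolding uniformly_continuous_on_def by (meson subsetD)
  have bh: "bounded (h ` D)"
    using compact_imp_bounded[OF compact_continuous_image[OF cont[folded \<Omega>_def] comp\<Omega>]] D\<Omega>
    by (meson bounded_subset image_mono)
  have D'D: "cball z r \<subseteq> D" if zD': "z \<in> D'" for z
  proof
    fix y assume "y \<in> cball z r"
    moreover obtain e where e: "e \<in> E" "dist e z < r" using zD' unfolding D'_def UN_iff mem_ball by blast
    ultimately have ey: "dist e y < 2 * r" using dist_triangle[of e y z] by simp
    have "dist (fst e) (fst y) < 2 * r" "dist (snd e) (snd y) < 2 * r"
      using ey dist_fst_le[of e y] dist_snd_le[of e y] by linarith+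
    then have "fst y \<in> U" "s1 < snd y" "snd y < s2"
      using e(1) Et[OF e(1)] r by (auto simp: U_def s1_def s2_def dist_real_def)
    then show "y \<in> D" by (cases y) (auto simp: D_def)
  qed
  have ED': "E \<subseteq> D'" using r centre_in_ball unfolding D'_def by blast
  have openD': "open D'" unfolding D'_def by blast
  let ?G = "\<lambda>b y. indicator D y * ((norm (g y) powr (p - 2) *\<^sub>R g y) \<bullet> b)"
  note hi = uniformly_continuous_integrable[OF openD bD uc bh]
  note comps = Lp_integrable_components[OF p gLp openD bD]
  have weak': "(LINT t:{s1<..<s2}|lborel. LINT x:U|lborel.
                 (norm (g (x, t)) powr (p - 2) *\<^sub>R g (x, t)) \<bullet> space_gradient \<phi> (x, t))
            - (LINT t:{s1<..<s2}|lborel. LINT x:U|lborel.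
                 h (x, t) * time_derivative \<phi> (x, t)) = 0" if "\<phi> \<in> test_functions (U \<times> {s1<..<s2})" for \<phi>
    using weak that unfolding D_def by blast
  have sub: "cball z \<rho> \<subseteq> U \<times> {s1<..<s2}" if "\<rho> \<le> r" "z \<in> D'" for z \<rho>
    using D'D[OF that(2)] that(1) unfolding D_def by (meson order_trans subset_cball)
  have eq1: "mollify_deriv \<rho> (b, 0) (\<lambda>y. indicator D y * h y) z = mollify \<rho> (\<lambda>y. indicator D y * (g y \<bullet> b)) z"
    if "0 < \<rho>" "\<rho> \<le> r" "z \<in> D'" "b \<in> Basis" for \<rho> z b
    unfolding D_def
    by (rule mollified_weak_solution(1)[OF openU that(1) sub[OF that(2,3)] g weak' hi[unfolded D_def] comps[unfolded D_def] that(4)])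
  have eq2: "mollify_deriv \<rho> (0, 1) (\<lambda>y. indicator D y * h y) z = (\<Sum>b\<in>Basis. mollify_deriv \<rho> (b, 0) (?G b) z)"
    if "0 < \<rho>" "\<rho> \<le> r" "z \<in> D'" for \<rho> z
    unfolding D_def
    by (rule mollified_weak_solution(2)[OF openU that(1) sub[OF that(2,3)] g weak' hi[unfolded D_def] comps[unfolded D_def]])
  have small: "h z - ?k z \<le> \<epsilon>" if "z \<in> D'" "z \<notin> E" "snd z \<le> T" for z
  proof -
    have "z \<in> D" using D'D[OF that(1)] r by auto
    then have "z \<in> K" using that(3) D\<Omega> unfolding cl K_def by (cases z) auto
    then show ?thesis using that(2) by (auto simp: E_def)
  qed
  have "h \<xi> - ?k \<xi> \<le> 2 * \<epsilon>"
    by (rule comparison_core[where D=D and D'=D' and E=E and g=g and r=r and T=T, OF p openD bD openD' _ r D'D compE ED' uc bh gLp eq1 eq2 small \<epsilon> _ T(1)])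
      (use ED' \<xi>E in auto)
  then show False using \<epsilon> by (simp add: \<epsilon>_def)
qed

section \<open>The barrier\<close>

lemma powr_diff_le:
  fixes x y e :: real
  assumes "0 < y" "y \<le> x" "e \<le> 1"
  shows "\<bar>x powr e - y powr e\<bar> \<le> \<bar>e\<bar> * y powr (e - 1) * (x - y)"
proof (cases "x = y")
  case False
  then have "y < x" using assms by simp
  moreover have "((\<lambda>s. s powr e) has_real_derivative e * s powr (e - 1)) (at s)" if "y \<le> s" for s
    using assms(1) that by (intro has_real_derivative_powr) auto
  ultimately obtain z where z: "z > y" "z < x" "x powr e - y powr e = (x - y) * (e * z powr (e - 1))"
    using MVT2[of y x "\<lambda>s. s powr e" "\<lambda>s. e * s powr (e - 1)"] by blast
  \<comment> \<open>As e \<le> 1, the slope of s^e is largest in absolute value at the lower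
    endpoint, for negative e as well.\<close>
  have "z powr (e - 1) \<le> y powr (e - 1)"
    using z(1) assms by (intro powr_mono2') auto
  then have "(x - y) * (\<bar>e\<bar> * z powr (e - 1)) \<le> (x - y) * (\<bar>e\<bar> * y powr (e - 1))"
    using assms by (intro mult_left_mono) auto
  then show ?thesis
    using assms z(3) by (simp add: abs_mult mult.commute)
qed simp

lemma powr_tangent_strict:
  fixes s c q :: real
  assumes q: "q > 1" and c: "c > 0" and s: "s \<ge> 0" "s \<noteq> c"
  shows "s powr q > c powr q + q * c powr (q - 1) * (s - c)"
\<comment> \<open>The derivative rule for powers covers positive arguments; at s = 0 the tangent
  line has the value (1 - q) c^q < 0.\<close>
proof (cases "s = 0")
  case True
  have "c * c powr (q - 1) = c powr (1 + (q - 1))" using c by (intro powr_mult_base) simp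
  then have "c powr q = c powr (q - 1) * c" by (simp add: mult.commute)
  then have "c powr q + q * c powr (q - 1) * (s - c) = (1 - q) * (c powr (q - 1) * c)"
    using True by (simp add: algebra_simps)
  also have "\<dots> < 0" using q c by (intro mult_neg_pos) auto
  finally show ?thesis using True q by simp
next
  case False
  then have s0: "s > 0" using s by simp
  have der: "((\<lambda>x. x powr q) has_real_derivative q * x powr (q - 1)) (at x)" if "x > 0" for x
    using that by (intro has_real_derivative_powr)
  show ?thesis
  proof (cases "c < s")
    case True
    then obtain z where z: "z > c" "z < s" "s powr q - c powr q = (s - c) * (q * z powr (q - 1))"
      using MVT2[of c s "\<lambda>s. s powr q" "\<lambda>s. q * s powr (q - 1)"] der c by auto
    have "z powr (q - 1) > c powr (q - 1)" using z(1) q c by (intro powr_less_mono2) auto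
    then have "(s - c) * (q * z powr (q - 1)) > (s - c) * (q * c powr (q - 1))"
      using True q by (intro mult_strict_left_mono) auto
    then show ?thesis using z(3) by (simp add: mult_ac)
  next
    case False
    then have "s < c" using s by simp
    then obtain z where z: "z > s" "z < c" "c powr q - s powr q = (c - s) * (q * z powr (q - 1))"
      using MVT2[of s c "\<lambda>s. s powr q" "\<lambda>s. q * s powr (q - 1)"] der s0 by auto
    have "z powr (q - 1) < c powr (q - 1)" using z s0 q by (intro powr_less_mono2) auto
    then have "(c - s) * (q * z powr (q - 1)) < (c - s) * (q * c powr (q - 1))"
      using \<open>s < c\<close> q by (intro mult_strict_left_mono) auto
    then show ?thesis using z(3) by (simp add: algebra_simps)
  qed
qed

text \<open>Strict Jensen for |.|^q with weights 1/m and (m - 1)/m, multiplied by m. If the norms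
  differ, strictness comes from the tangent line at the mean norm c; if they agree, from the strict
  triangle inequality for distinct vectors of equal norm.\<close>

lemma norm_powr_strict_convex:
  fixes x y :: "'a::euclidean_space"
  assumes q: "q > 1" and m: "m > 1" and ne: "x \<noteq> y"
  shows "m powr (1 - q) * norm (x + (m - 1) *\<^sub>R y) powr q < norm x powr q + (m - 1) * norm y powr q"
proof -
  let ?r = "norm x" and ?s = "norm y"
  define c where "c = (?r + (m - 1) * ?s) / m"
  have mc: "m * c = ?r + (m - 1) * ?s" using m by (simp add: c_def)
  have c0: "c \<ge> 0" using m by (simp add: c_def)
  have le: "norm (x + (m - 1) *\<^sub>R y) \<le> m * c"
    using norm_triangle_ineq[of x "(m - 1) *\<^sub>R y"] m unfolding mc by simp
  have mcq: "m powr (1 - q) * (m * c) powr q = m * c powr q"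
  proof -
    have "m powr (1 - q) * m powr q = m" using m by (simp add: powr_add[symmetric])
    moreover have "(m * c) powr q = m powr q * c powr q" using m c0 by (simp add: powr_mult)
    ultimately show ?thesis by (simp add: mult.assoc[symmetric])
  qed
  have mpos: "m powr (1 - q) > 0" using m by simp
  show ?thesis
  proof (cases "?r = ?s")
    case False
    then have cpos: "c > 0"
    proof -
      have "?r + (m - 1) * ?s > 0"
      proof (cases "?r = 0")
        case True
        then show ?thesis using False m by (auto intro!: mult_pos_pos)
      next
        case False
        then show ?thesis using m by (intro add_pos_nonneg) auto
      qed
      then show ?thesis using m by (simp add: c_def)
    qed
    have rc: "?r \<noteq> c" "?s \<noteq> c"
    proof -
      have "m * (?r - c) = (m - 1) * (?r - ?s)" "m * (?s - c) = ?s - ?r"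
        unfolding right_diff_distrib mc by (simp_all add: algebra_simps)
      then show "?r \<noteq> c" "?s \<noteq> c" using False m by auto
    qed
    have "m powr (1 - q) * norm (x + (m - 1) *\<^sub>R y) powr q \<le> m powr (1 - q) * (m * c) powr q"
      using q le mpos by (intro mult_left_mono powr_mono2) auto
    also have "\<dots> = m * c powr q" by (rule mcq)
    also have "m * c powr q = (c powr q + q * c powr (q - 1) * (?r - c)) + (m - 1) * (c powr q + q * c powr (q - 1) * (?s - c))"
    proof -
      have "(?r - c) + (m - 1) * (?s - c) = 0" using mc by (simp add: algebra_simps)
      then have "q * c powr (q - 1) * ((?r - c) + (m - 1) * (?s - c)) = 0" by simp
      then show ?thesis by (simp add: algebra_simps)
    qed
    also have "\<dots> < ?r powr q + (m - 1) * ?s powr q"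
      using powr_tangent_strict[OF q cpos norm_ge_zero rc(1)] powr_tangent_strict[OF q cpos norm_ge_zero rc(2)] m
      by (intro add_strict_mono mult_strict_left_mono) auto
    finally show ?thesis .
  next
    case True
    have "norm (x + (m - 1) *\<^sub>R y) \<noteq> m * c"
    proof
      assume "norm (x + (m - 1) *\<^sub>R y) = m * c"
      then have "norm (x + (m - 1) *\<^sub>R y) = norm x + norm ((m - 1) *\<^sub>R y)"
        unfolding mc using m by simp
      then have "norm x *\<^sub>R ((m - 1) *\<^sub>R y) = norm ((m - 1) *\<^sub>R y) *\<^sub>R x"
        by (simp only: norm_triangle_eq)
      moreover have "norm ((m - 1) *\<^sub>R y) = (m - 1) * norm x"
        using m True by simp
      ultimately have "(norm x * (m - 1)) *\<^sub>R (y - x) = 0"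
        by (simp add: scaleR_diff_right mult.commute)
      then show False using ne True m by auto
    qed
    then have "norm (x + (m - 1) *\<^sub>R y) powr q < (m * c) powr q"
      using le q by (intro powr_less_mono2) auto
    then have "m powr (1 - q) * norm (x + (m - 1) *\<^sub>R y) powr q < m * c powr q"
      using mpos mult_strict_left_mono[of _ "(m * c) powr q" "m powr (1 - q)"] unfolding mcq[symmetric] by blast
    also have "m * c powr q = ?r powr q + (m - 1) * ?s powr q"
    proof -
      have "c = ?r" using True m by (simp add: c_def field_simps)
      then show ?thesis using True by (simp add: algebra_simps)
    qed
    finally show ?thesis .
  qed
qed

section \<open>The barrier and its estimates on the cusp\<close>

definition barrier :: "real \<Rightarrow> real \<Rightarrow> real \<Rightarrow> real \<Rightarrow> 'a::euclidean_space \<times> real \<Rightarrow> real" where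
  "barrier p \<beta> K B z = 2 * B * K * (- snd z) powr \<beta> -
     B * (- snd z) powr (- ((1 - \<beta>) / (p - 1))) * norm (fst z) powr (p / (p - 1))"

text \<open>By \<open>cusp_exponent\<close> the power of -t is \<beta> + (1 - \<beta>)/(p - 1),
  which keeps the negative term of the barrier at most half of the positive one.\<close>

definition cusp :: "real \<Rightarrow> real \<Rightarrow> real \<Rightarrow> ('a::euclidean_space \<times> real) set" where
  "cusp p \<beta> K = {(x, t). t < 0 \<and> norm x powr (p / (p - 1)) \<le> K * (- t) powr ((1 + \<beta> * (p - 2)) / (p - 1))}"

lemma flux_coeff_pos: "p > 2 \<Longrightarrow> \<gamma> > 0 \<Longrightarrow> flux_coeff p \<gamma> = (p / (p - 1) * \<gamma>) powr (p - 1)"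
  unfolding flux_coeff_def using powr_mult_base[of "p / (p - 1) * \<gamma>" "p - 2"]
  by (simp add: mult.commute)

lemma flux_coeff_minus: "flux_coeff p (- \<gamma>) = - flux_coeff p \<gamma>"
  by (simp add: flux_coeff_def)

text \<open>The parameter \<open>ty\<close> only fixes the space, hence the dimension in \<open>large\<close>.\<close>

locale barrier_data =
  fixes p \<beta> K B :: real and ty :: "'a::euclidean_space itself"
  assumes p: "p > 2" and \<beta>: "0 < \<beta>" "\<beta> < 1" and K: "K > 0" and B: "B > 0"
    and large: "B * K * (2 * \<beta> + (1 - \<beta>) / (p - 1)) < real DIM('a) * (p / (p - 1) * (B / 2)) powr (p - 1)"
begin

abbreviation w :: "'a \<times> real \<Rightarrow> real" where "w \<equiv> barrier p \<beta> K B"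

text \<open>An upper bound for minus the time derivative of w at the points of the cusp, with |x|^q
  replaced by its largest value at time t.\<close>

definition speed :: "real \<Rightarrow> real" where
  "speed t = B * K * (2 * \<beta> + (1 - \<beta>) / (p - 1)) * (- t) powr (\<beta> - 1)"

text \<open>The time slope of the exact solution with coefficient \<open>coeff t / 2\<close>, see
  \<open>flux_coeff_half\<close>. Both \<open>speed\<close> and \<open>rate\<close> carry the same
  power of -t, so comparing them is the assumption \<open>large\<close> on constants.\<close>

definition rate :: "real \<Rightarrow> real" where
  "rate t = real DIM('a) * (p / (p - 1) * (B / 2)) powr (p - 1) * (- t) powr (\<beta> - 1)"

definition coeff :: "real \<Rightarrow> real" where
  "coeff t = B * (- t) powr (- ((1 - \<beta>) / (p - 1)))"

lemma barrier_eq: "w z = 2 * B * K * (- snd z) powr \<beta> - coeff (snd z) * norm (fst z) powr (p / (p - 1))"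
  by (simp add: barrier_def coeff_def)

lemma cusp_exponent: "(1 + \<beta> * (p - 2)) / (p - 1) = \<beta> + (1 - \<beta>) / (p - 1)"
proof -
  have "1 + \<beta> * (p - 2) = \<beta> * (p - 1) + (1 - \<beta>)" by (simp add: algebra_simps)
  then have "(1 + \<beta> * (p - 2)) / (p - 1) = (\<beta> * (p - 1) + (1 - \<beta>)) / (p - 1)"
    by (simp only:)
  also have "\<dots> = \<beta> + (1 - \<beta>) / (p - 1)"
    using p by (subst add_divide_distrib) simp
  finally show ?thesis .
qed

lemma coeff_pos: "t < 0 \<Longrightarrow> coeff t > 0"
  using B by (simp add: coeff_def)

lemma coeff_cusp_le:
  assumes "(x, t) \<in> cusp p \<beta> K"
  shows "coeff t * norm x powr (p / (p - 1)) \<le> B * K * (- t) powr \<beta>"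
proof -
  have t: "t < 0" and x: "norm x powr (p / (p - 1)) \<le> K * (- t) powr ((1 + \<beta> * (p - 2)) / (p - 1))"
    using assms by (auto simp: cusp_def)
  have "- ((1 - \<beta>) / (p - 1)) + (1 + \<beta> * (p - 2)) / (p - 1) = \<beta>"
    by (simp add: cusp_exponent)
  then have e: "(- t) powr (- ((1 - \<beta>) / (p - 1))) * (- t) powr ((1 + \<beta> * (p - 2)) / (p - 1)) = (- t) powr \<beta>"
    using t by (simp add: powr_add[symmetric])
  have "coeff t * norm x powr (p / (p - 1)) \<le> coeff t * (K * (- t) powr ((1 + \<beta> * (p - 2)) / (p - 1)))"
    using x coeff_pos[OF t] by (intro mult_left_mono) auto
  also have "\<dots> = B * K * (- t) powr \<beta>"
    unfolding e[symmetric] coeff_def by (simp add: mult_ac)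
  finally show ?thesis .
qed

lemma barrier_ge: "z \<in> cusp p \<beta> K \<Longrightarrow> w z \<ge> B * K * (- snd z) powr \<beta>"
  using coeff_cusp_le[of "fst z" "snd z"] by (simp add: barrier_eq)

lemma barrier_le: "snd z < 0 \<Longrightarrow> w z \<le> 2 * B * K * (- snd z) powr \<beta>"
  using coeff_pos[of "snd z"] by (simp add: barrier_eq)

lemma barrier_nonneg: "z \<in> cusp p \<beta> K \<Longrightarrow> w z \<ge> 0"
  using barrier_ge[of z] B K by (smt (verit) mult_nonneg_nonneg powr_ge_zero)

text \<open>Both powers of -t have an exponent at most 1, so going backward from t0 their slopes are
  largest in absolute value at t0. One constant thus bounds the growth at all earlier times, without
  a smallness condition.\<close>

lemma barrier_backward:
  assumes x: "(x, t0) \<in> cusp p \<beta> K" and t: "t \<le> t0"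
  shows "w (x, t) \<le> w (x, t0) + speed t0 * (t0 - t)"
proof -
  have t0: "t0 < 0" and xn: "norm x powr (p / (p - 1)) \<le> K * (- t0) powr ((1 + \<beta> * (p - 2)) / (p - 1))"
    using x by (auto simp: cusp_def)
  let ?b = "(1 - \<beta>) / (p - 1)" and ?N = "norm x powr (p / (p - 1))"
  have b: "?b > 0" using p \<beta> by simp
  have 1: "(- t) powr \<beta> - (- t0) powr \<beta> \<le> \<beta> * (- t0) powr (\<beta> - 1) * (t0 - t)"
    using powr_diff_le[of "- t0" "- t" \<beta>] t t0 \<beta> by simp
  have 2: "(- t0) powr (- ?b) - (- t) powr (- ?b) \<le> ?b * (- t0) powr (- ?b - 1) * (t0 - t)"
    using powr_diff_le[of "- t0" "- t" "- ?b"] t t0 b by (simp add: abs_if split: if_splits)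
  have e: "(- t0) powr (- ?b - 1) * (- t0) powr ((1 + \<beta> * (p - 2)) / (p - 1)) = (- t0) powr (\<beta> - 1)"
  proof -
    have "- ?b - 1 + (1 + \<beta> * (p - 2)) / (p - 1) = \<beta> - 1"
      by (simp add: cusp_exponent)
    then show ?thesis by (simp only: powr_add[symmetric])
  qed
  have "w (x, t) - w (x, t0) = 2 * B * K * ((- t) powr \<beta> - (- t0) powr \<beta>) + B * ((- t0) powr (- ?b) - (- t) powr (- ?b)) * ?N"
    by (simp add: barrier_def algebra_simps)
  also have "\<dots> \<le> 2 * B * K * (\<beta> * (- t0) powr (\<beta> - 1) * (t0 - t)) + B * (?b * (- t0) powr (- ?b - 1) * (t0 - t)) * ?N"
    using 1 2 B K by (intro add_mono mult_left_mono mult_right_mono) auto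
  also have "B * (?b * (- t0) powr (- ?b - 1) * (t0 - t)) * ?N \<le>
      B * (?b * (- t0) powr (- ?b - 1) * (t0 - t)) * (K * (- t0) powr ((1 + \<beta> * (p - 2)) / (p - 1)))"
    using xn B b t by (intro mult_left_mono mult_nonneg_nonneg) auto
  also have "\<dots> = B * K * ?b * (t0 - t) * ((- t0) powr (- ?b - 1) * (- t0) powr ((1 + \<beta> * (p - 2)) / (p - 1)))"
    by (simp only: mult_ac)
  also have "\<dots> = B * K * ?b * (t0 - t) * (- t0) powr (\<beta> - 1)"
    unfolding e ..
  finally show ?thesis by (simp add: speed_def algebra_simps)
qed

text \<open>As t grows, (-t)^\<beta> decreases and the coefficient of |x|^q increases. This controls
  the short piece of a box after the touching time.\<close>

lemma barrier_antimono:
  assumes "t0 \<le> t" "t < 0"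
  shows "w (x, t) \<le> w (x, t0)"
proof -
  let ?b = "(1 - \<beta>) / (p - 1)"
  have b: "?b > 0" using p \<beta> by simp
  have "(- t) powr \<beta> \<le> (- t0) powr \<beta>"
    using assms \<beta> by (intro powr_mono2) auto
  moreover have "(- t0) powr (- ?b) \<le> (- t) powr (- ?b)"
    using assms b by (intro powr_mono2') auto
  ultimately show ?thesis
    unfolding barrier_def using B K by (intro diff_mono mult_left_mono mult_right_mono) (auto intro: mult_right_mono)
qed

lemma continuous_barrier: "continuous_on {z. snd z < 0} w"
  unfolding barrier_def using p
  by (intro continuous_intros continuous_on_powr' continuous_on_compose2[OF continuous_norm_powr[of "p / (p - 1)" UNIV 0, unfolded diff_0_right]]) auto

lemma speed_less_rate: "t < 0 \<Longrightarrow> speed t < rate t"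
  unfolding speed_def rate_def using large by (intro mult_strict_right_mono) auto

lemma flux_coeff_half: "t < 0 \<Longrightarrow> real DIM('a) * flux_coeff p (coeff t / 2) = rate t"
proof -
  assume t: "t < 0"
  have "flux_coeff p (coeff t / 2) = (p / (p - 1) * (coeff t / 2)) powr (p - 1)"
    using coeff_pos[OF t] by (intro flux_coeff_pos p) simp
  also have "p / (p - 1) * (coeff t / 2) = (p / (p - 1) * (B / 2)) * (- t) powr (- ((1 - \<beta>) / (p - 1)))"
    by (simp add: coeff_def)
  also have "\<dots> powr (p - 1) = (p / (p - 1) * (B / 2)) powr (p - 1) * ((- t) powr (- ((1 - \<beta>) / (p - 1)))) powr (p - 1)"
    by (rule powr_mult)
  also have "((- t) powr (- ((1 - \<beta>) / (p - 1)))) powr (p - 1) = (- t) powr (\<beta> - 1)"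
    using p by (simp add: powr_powr)
  finally show ?thesis by (simp add: rate_def)
qed

text \<open>The full coefficient diffuses at least as fast as the halved one, so the assumption
  \<open>large\<close>, stated with B / 2, covers the upper barrier as well as the lower
  one.\<close>

lemma flux_coeff_neg: "t < 0 \<Longrightarrow> real DIM('a) * flux_coeff p (- coeff t) \<le> - rate t"
proof -
  assume t: "t < 0"
  have "p / (p - 1) * (coeff t / 2) \<le> p / (p - 1) * coeff t"
    using p coeff_pos[OF t] by (intro mult_left_mono) auto
  then have "flux_coeff p (coeff t / 2) \<le> flux_coeff p (coeff t)"
    using p coeff_pos[OF t] by (simp only: flux_coeff_pos half_gt_zero) (intro powr_mono2; simp)
  then have "real DIM('a) * flux_coeff p (coeff t / 2) \<le> real DIM('a) * flux_coeff p (coeff t)"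
    by (intro mult_left_mono) auto
  then show ?thesis
    unfolding flux_coeff_half[OF t] flux_coeff_minus by simp
qed

end

lemma p_parabolic_subset: "p_parabolic p \<Omega> h \<Longrightarrow> \<Omega>' \<subseteq> \<Omega> \<Longrightarrow> p_parabolic p \<Omega>' h"
  unfolding p_parabolic_def compactly_contained_def by (meson continuous_on_subset order_trans)

section \<open>Comparison properties of the barrier\<close>

context barrier_data
begin

lemma exact_sol_at_slice:
  fixes a :: 'a
  shows "exact_sol p (c - real DIM('a) * flux_coeff p \<gamma> * t0) \<gamma> a (x, t) =
    c + real DIM('a) * flux_coeff p \<gamma> * (t - t0) + \<gamma> * norm (x - a) powr (p / (p - 1))"
  using p by (simp add: exact_sol_def algebra_simps)

text \<open>
  The exact solution that has the spatial profile of the barrier at time \<open>t0\<close> dominates the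
  barrier before \<open>t0\<close>, so comparison on \<open>(t1, t0)\<close> controls the values at time \<open>t0\<close>.
\<close>

lemma barrier_superparabolic:
  fixes \<Theta> :: "('a \<times> real) set"
  assumes \<Theta>: "open \<Theta>" "\<Theta> \<subseteq> cusp p \<beta> K"
  shows "p_superparabolic p \<Theta> (\<lambda>z. ereal (d + w z))"
  unfolding p_superparabolic_def
proof (intro conjI ballI allI impI)
  have cw: "continuous_on \<Theta> w"
    using \<Theta>(2) by (intro continuous_on_subset[OF continuous_barrier]) (auto simp: cusp_def)
  show "lower_semicontinuous_on \<Theta> (\<lambda>z. ereal (d + w z))"
    unfolding lower_semicontinuous_on_def
  proof
    fix \<xi> assume \<xi>: "\<xi> \<in> \<Theta>"
    have lim: "((\<lambda>z. ereal (d + w z)) \<longlongrightarrow> ereal (d + w \<xi>)) (at \<xi> within \<Theta>)"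
      using cw \<xi> by (intro tendsto_intros) (auto simp: continuous_on_def)
    have "at \<xi> within \<Theta> \<noteq> bot"
      using at_within_open[OF \<xi> \<Theta>(1)] by simp
    from lim_imp_Liminf[OF this lim]
    show "ereal (d + w \<xi>) \<le> Liminf (at \<xi> within \<Theta>) (\<lambda>z. ereal (d + w z))"
      by simp
  qed
  show "\<Theta> \<subseteq> closure {\<xi> \<in> \<Theta>. ereal (d + w \<xi>) < \<infinity>}"
    using closure_subset by simp
  fix a b :: 'a and t1 t2 :: real and h :: "'a \<times> real \<Rightarrow> real" and \<xi> :: "'a \<times> real"
  let ?Q = "box a b"
  assume as: "(\<forall>i\<in>Basis. a \<bullet> i < b \<bullet> i) \<and> t1 < t2 \<and>
        compactly_contained (?Q \<times> {t1<..<t2}) \<Theta> \<and>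
        p_parabolic p (?Q \<times> {t1<..<t2}) h \<and>
        continuous_on (closure (?Q \<times> {t1<..<t2})) h \<and>
        (\<forall>\<xi>\<in>parabolic_boundary ?Q t1 t2. ereal (h \<xi>) \<le> ereal (d + w \<xi>))"
    and \<xi>: "\<xi> \<in> ?Q \<times> {t1<..<t2}"
  have hp: "p_parabolic p (?Q \<times> {t1<..<t2}) h"
    and hc: "continuous_on (closure (?Q \<times> {t1<..<t2})) h"
    and hb: "\<And>\<zeta>. \<zeta> \<in> parabolic_boundary ?Q t1 t2 \<Longrightarrow> h \<zeta> \<le> d + w \<zeta>"
    using as by auto
  obtain x0 t0 where \<xi>_eq: "\<xi> = (x0, t0)" by (cases \<xi>)
  have x0: "x0 \<in> ?Q" and t0: "t1 < t0" "t0 < t2" using \<xi> \<xi>_eq by auto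
  have cl: "closure (?Q \<times> {t1<..<t2}) = closure ?Q \<times> {t1..t2}"
    using t0 by (simp add: closure_Times)
  have cl0: "closure (?Q \<times> {t1<..<t0}) = closure ?Q \<times> {t1..t0}"
    using t0 by (simp add: closure_Times)
  have slice: "(x, t0) \<in> cusp p \<beta> K" if "x \<in> closure ?Q" for x
  proof -
    have "(x, t0) \<in> closure ?Q \<times> {t1..t2}" using that t0 by simp
    then show ?thesis
      using as \<Theta>(2) unfolding compactly_contained_def cl by (meson subsetD)
  qed
  have t0neg: "t0 < 0" using slice[of x0] x0 closure_subset[of ?Q] by (auto simp: cusp_def)
  \<comment> \<open>Minus the full coefficient at t0: the spatial profile is exactly that of the
    barrier, and the slope F \<le> -\<open>speed t0\<close> makes the exact solution grow backward
    at least as fast as the barrier can.\<close>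
  define \<gamma> where "\<gamma> = - coeff t0"
  define F where "F = real DIM('a) * flux_coeff p \<gamma>"
  have F: "F \<le> - speed t0"
    using flux_coeff_neg[OF t0neg] speed_less_rate[OF t0neg] by (simp add: F_def \<gamma>_def)
  define k where "k = exact_sol p (d + 2 * B * K * (- t0) powr \<beta> - F * t0) \<gamma> (0::'a)"
  have k: "k (x, t) = d + w (x, t0) + F * (t - t0)" for x t
    unfolding k_def F_def exact_sol_at_slice by (simp add: barrier_eq \<gamma>_def)
  have dom: "d + w (x, t) \<le> k (x, t)" if "x \<in> closure ?Q" "t \<le> t0" for x t
  proof -
    have "w (x, t) \<le> w (x, t0) + speed t0 * (t0 - t)"
      using barrier_backward[OF slice[OF that(1)] that(2)] .
    moreover have "speed t0 * (t0 - t) \<le> - F * (t0 - t)"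
      using F that(2) by (intro mult_right_mono) auto
    ultimately show ?thesis by (simp add: k algebra_simps)
  qed
  have hc0: "continuous_on (closure (?Q \<times> {t1<..<t0})) h"
    by (rule continuous_on_subset[OF hc]) (use t0 in \<open>auto simp: cl cl0\<close>)
  have "h \<zeta> \<le> k \<zeta>" if "\<zeta> \<in> ?Q \<times> {t1<..<t0}" for \<zeta>
    unfolding k_def
  proof (rule exact_sol_comparison[OF p _ _ t0(1) _ _ _ that])
    show "p_parabolic p (?Q \<times> {t1<..<t0}) h"
      by (rule p_parabolic_subset[OF hp]) (use t0 in auto)
    show "continuous_on (closure (?Q \<times> {t1<..<t0})) h"
      using hc0 .
    fix \<zeta> assume \<zeta>: "\<zeta> \<in> parabolic_boundary ?Q t1 t0"
    then have "\<zeta> \<in> parabolic_boundary ?Q t1 t2" using t0 by (auto simp: parabolic_boundary_def)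
    then have "h \<zeta> \<le> d + w \<zeta>" by (rule hb)
    also have "d + w \<zeta> \<le> k \<zeta>"
      using \<zeta> t0 dom[of "fst \<zeta>" "snd \<zeta>"] by (cases \<zeta>) (auto simp: parabolic_boundary_def frontier_def)
    finally show "h \<zeta> \<le> exact_sol p (d + 2 * B * K * (- t0) powr \<beta> - F * t0) \<gamma> 0 \<zeta>"
      by (simp add: k_def)
  qed auto
  \<comment> \<open>Comparison holds for times before t0; it extends by continuity to \<xi>, which
    lies on the top of that cylinder.\<close>
  moreover have "continuous_on (closure (?Q \<times> {t1<..<t0})) (\<lambda>\<zeta>. h \<zeta> - k \<zeta>)"
    unfolding k_def by (intro continuous_on_diff continuous_exact_sol[OF p] hc0)
  moreover have "\<xi> \<in> closure (?Q \<times> {t1<..<t0})"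
    unfolding cl0 \<xi>_eq using x0 t0 closure_subset[of ?Q] by auto
  ultimately have "h \<xi> - k \<xi> \<le> 0"
    by (intro continuous_le_on_closure[of "?Q \<times> {t1<..<t0}" "\<lambda>\<zeta>. h \<zeta> - k \<zeta>" \<xi> 0]) auto
  then show "ereal (h \<xi>) \<le> ereal (d + w \<xi>)"
    by (simp add: \<xi>_eq k)
qed auto

text \<open>
  Halving the coefficient of the spatial profile leaves strictness; the shift of the centre to \<open>y\<close>
  matches the gradients at \<open>x0\<close>, because \<open>(|x0 - y| / |x0|)\<^bsup>1/(p-1)\<^esup> = 2\<close>.
\<close>

lemma slice_touching:
  fixes x x0 :: 'a
  assumes "t0 < 0" "x \<noteq> x0"
  defines "y \<equiv> - ((2 powr (p - 1) - 1) *\<^sub>R x0)"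
  shows "coeff t0 / 2 * (norm (x - y) powr (p / (p - 1)) - norm (x0 - y) powr (p / (p - 1)))
    < w (x0, t0) - w (x, t0)"
proof -
  let ?q = "p / (p - 1)"
  \<comment> \<open>Here x0 - y = m x0, and m^(1 - q) = 1/2 turns the halved coefficient into the
    factor in \<open>norm_powr_strict_convex\<close>.\<close>
  define m where "m = (2::real) powr (p - 1)"
  have m: "m > 1" unfolding m_def using p by (intro gr_one_powr) auto
  have m2: "m powr (1 - ?q) = 1 / 2"
  proof -
    have "(p - 1) * (1 - ?q) = -1" using p by (simp add: field_simps)
    then show ?thesis by (simp add: m_def powr_powr powr_minus)
  qed
  have "x0 - y = m *\<^sub>R x0" by (simp add: y_def m_def algebra_simps)
  then have "norm (x0 - y) powr ?q = m powr ?q * norm x0 powr ?q"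
    using m by (simp add: powr_mult)
  moreover have "m powr (1 - ?q) * m powr ?q = m" using m by (simp add: powr_add[symmetric])
  ultimately have 1: "1 / 2 * norm (x0 - y) powr ?q = m * norm x0 powr ?q"
    unfolding m2[symmetric] by simp
  have xy: "x - y = x + (m - 1) *\<^sub>R x0" by (simp add: y_def m_def)
  have "1 / 2 * norm (x - y) powr ?q < norm x powr ?q + (m - 1) * norm x0 powr ?q"
    unfolding xy m2[symmetric] by (rule norm_powr_strict_convex[OF exponent_gt_1[OF p] m assms(2)])
  then have "1 / 2 * norm (x - y) powr ?q - 1 / 2 * norm (x0 - y) powr ?q < norm x powr ?q - norm x0 powr ?q"
    unfolding 1 by (simp add: algebra_simps)
  then have "coeff t0 * (1 / 2 * norm (x - y) powr ?q - 1 / 2 * norm (x0 - y) powr ?q)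
      < coeff t0 * (norm x powr ?q - norm x0 powr ?q)"
    using coeff_pos[OF assms(1)] by (intro mult_strict_left_mono)
  then show ?thesis
    by (simp add: barrier_eq algebra_simps)
qed

text \<open>If u touched \<mu> - w at \<zeta>, an exact solution through the same point that is
  strictly below \<mu> - w on the parabolic boundary of a small box could be raised by the gap d'
  and still be admissible, which forces u above the touching value. The box has to continue past the
  time of \<zeta>, because the comparison property speaks of interior points.\<close>

lemma no_negative_minimum:
  fixes \<Theta> :: "('a \<times> real) set"
  assumes \<Theta>: "open \<Theta>" "\<Theta> \<subseteq> cusp p \<beta> K"
    and u: "p_superparabolic p \<Theta> u" and \<zeta>: "\<zeta> \<in> \<Theta>"
    and min: "\<And>z. z \<in> \<Theta> \<Longrightarrow> ereal (\<mu> - w z) \<le> u z"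
  shows "ereal (\<mu> - w \<zeta>) < u \<zeta>"
proof (rule ccontr)
  assume contra: "\<not> ereal (\<mu> - w \<zeta>) < u \<zeta>"
  obtain x0 t0 where \<zeta>_eq: "\<zeta> = (x0, t0)" by (cases \<zeta>)
  obtain e where e: "e > 0" "cball \<zeta> e \<subseteq> \<Theta>"
    using \<Theta>(1) \<zeta> open_contains_cball by blast
  have inT: "(x, t) \<in> \<Theta>" if "dist x x0 \<le> e / 2" "\<bar>t - t0\<bar> \<le> e / 2" for x t
  proof -
    have "dist (x0, t0) (x, t) \<le> dist x0 x + dist t0 t"
      unfolding dist_prod_def by (simp add: sqrt_sum_squares_le_sum)
    also have "\<dots> \<le> e" using that unfolding dist_real_def dist_commute[of x0 x] by linarith
    finally show ?thesis using e(2) unfolding \<zeta>_eq by auto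
  qed
  have t0: "t0 < 0" and t0e: "t0 + e / 2 < 0"
    using inT[of x0 t0] inT[of x0 "t0 + e / 2"] e(1) \<Theta>(2) by (auto simp: cusp_def)
  obtain a b where ab: "x0 \<in> box a b" "box a b \<subseteq> ball x0 (e / 2)"
    using rational_boxes[of "e / 2" x0] e(1) by auto
  let ?Q = "box a b"
  have "closure ?Q \<subseteq> cball x0 (e / 2)"
    using ab(2) by (meson ball_subset_cball closed_cball closure_minimal order_trans)
  then have clQ: "dist x x0 \<le> e / 2" if "x \<in> closure ?Q" for x
    using that by (auto simp: dist_commute)
  have abi: "a \<bullet> i < b \<bullet> i" if "i \<in> Basis" for i
    using ab(1) that unfolding mem_box by (meson less_trans)
  define y where "y = - ((2 powr (p - 1) - 1) *\<^sub>R x0)"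
  define \<gamma> where "\<gamma> = coeff t0 / 2"
  define N where "N = (\<lambda>x. norm (x - y) powr (p / (p - 1)))"
  have F: "real DIM('a) * flux_coeff p \<gamma> = rate t0"
    unfolding \<gamma>_def by (rule flux_coeff_half[OF t0])
  define C where "C = - w (x0, t0) - \<gamma> * N x0"
  define k where "k = (\<lambda>z. - w (x0, t0) + \<gamma> * (N (fst z) - N x0) + rate t0 * (snd z - t0))"
  \<comment> \<open>The gap between -w and k at time t0: zero at x0 and positive elsewhere by
    \<open>slice_touching\<close>. Its minimum over the lateral boundary is the margin d.\<close>
  define \<psi> where "\<psi> = (\<lambda>x. - w (x, t0) + w (x0, t0) - \<gamma> * (N x - N x0))"
  have \<psi>: "\<psi> x > 0" if "x \<noteq> x0" for x
    using slice_touching[OF t0 that] by (simp add: \<psi>_def \<gamma>_def N_def y_def)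
  have \<psi>0: "\<psi> x \<ge> 0" for x
    using \<psi>[of x] by (cases "x = x0") (auto simp: \<psi>_def)
  have c\<psi>: "continuous_on (frontier ?Q) \<psi>"
  proof -
    have "continuous_on (frontier ?Q) (\<lambda>x. w (x, t0))"
      by (rule continuous_on_compose2[OF continuous_barrier]) (use t0 in \<open>auto intro!: continuous_intros\<close>)
    moreover have "continuous_on (frontier ?Q) N"
      unfolding N_def using exponent_gt_1[OF p] by (intro continuous_norm_powr) simp
    ultimately show ?thesis unfolding \<psi>_def by (intro continuous_intros)
  qed
  obtain d where d: "d > 0" "\<And>x. x \<in> frontier ?Q \<Longrightarrow> d \<le> \<psi> x"
  proof (cases "frontier ?Q = {}")
    case True
    then show ?thesis using that[of 1] by auto
  next
    case False
    have "compact (frontier ?Q)" by (simp add: compact_frontier_bounded)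
    then obtain xm where xm: "xm \<in> frontier ?Q" "\<And>x. x \<in> frontier ?Q \<Longrightarrow> \<psi> xm \<le> \<psi> x"
      using continuous_attains_inf[OF _ False c\<psi>] by blast
    have "xm \<noteq> x0" using xm(1) ab(1) by (auto simp: frontier_def interior_open[OF open_box])
    then show ?thesis using that[of "\<psi> xm"] xm(2) \<psi> by auto
  qed
  have rs: "rate t0 - speed t0 > 0" "rate t0 > 0" "speed t0 \<ge> 0"
  proof -
    show 1: "rate t0 - speed t0 > 0" using speed_less_rate[OF t0] by simp
    show 2: "speed t0 \<ge> 0"
      unfolding speed_def using B K \<beta> p by (intro mult_nonneg_nonneg add_nonneg_nonneg) auto
    show "rate t0 > 0" using 1 2 by linarith
  qed
  define s1 where "s1 = t0 - e / 2"
  \<comment> \<open>After t0 the function k rises with slope \<open>rate t0\<close> while -w does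
    not decrease; stopping after at most d / (2 \<open>rate t0\<close>) costs at most half of the
    lateral gap d.\<close>
  define s2 where "s2 = t0 + min (e / 2) (d / (2 * rate t0))"
  have s: "s1 < t0" "t0 < s2" "s2 \<le> t0 + e / 2" "rate t0 * (s2 - t0) \<le> d / 2"
  proof -
    show "s1 < t0" "t0 < s2" "s2 \<le> t0 + e / 2" using e(1) d(1) rs by (auto simp: s1_def s2_def)
    have "rate t0 * (s2 - t0) \<le> rate t0 * (d / (2 * rate t0))"
      using rs by (intro mult_left_mono) (auto simp: s2_def)
    then show "rate t0 * (s2 - t0) \<le> d / 2" using rs by simp
  qed
  have s12: "s1 < s2" using s by linarith
  have past: "- w (x, t) - k (x, t) \<ge> \<psi> x + (rate t0 - speed t0) * (t0 - t)"
    if "x \<in> closure ?Q" "t \<le> t0" for x t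
  proof -
    have "(x, t0) \<in> cusp p \<beta> K" using inT[OF clQ[OF that(1)], of t0] e(1) \<Theta>(2) by auto
    from barrier_backward[OF this that(2)]
    show ?thesis by (simp add: k_def \<psi>_def algebra_simps)
  qed
  have future: "- w (x, t) - k (x, t) \<ge> \<psi> x - rate t0 * (t - t0)" if "t0 \<le> t" "t < 0" for x t
    using barrier_antimono[OF that, of x] by (simp add: k_def \<psi>_def algebra_simps)
  \<comment> \<open>The lateral gap that is left after t0, and the gap at the bottom, which lies a
    time e/2 before t0.\<close>
  define d' where "d' = min (d / 2) ((rate t0 - speed t0) * (e / 2))"
  have d': "d' > 0" using d(1) rs e(1) by (simp add: d'_def)
  have gap: "k z + d' \<le> - w z" if zin: "z \<in> parabolic_boundary ?Q s1 s2" for z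
  proof -
    obtain x t where z: "z = (x, t)" by (cases z)
    consider "x \<in> closure ?Q" "t = s1" | "x \<in> frontier ?Q" "s1 < t" "t \<le> s2"
      using zin unfolding z parabolic_boundary_def by auto
    then show ?thesis
    proof cases
      case 1
      then have "- w (x, t) - k (x, t) \<ge> \<psi> x + (rate t0 - speed t0) * (e / 2)"
        using past[of x t] s by (simp add: s1_def)
      then show ?thesis using \<psi>0[of x] unfolding z d'_def by linarith
    next
      case 2
      have xcl: "x \<in> closure ?Q" using 2(1) by (simp add: frontier_def)
      show ?thesis
      proof (cases "t \<le> t0")
        case True
        have "(rate t0 - speed t0) * (t0 - t) \<ge> 0" using rs True by simp
        then show ?thesis
          using past[OF xcl True] d(2)[OF 2(1)] d(1) unfolding z d'_def by linarith
      next
        case False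
        have "rate t0 * (t - t0) \<le> rate t0 * (s2 - t0)"
          using 2(3) rs by (intro mult_left_mono) auto
        then show ?thesis
          using future[of t x] False 2(3) s t0e d(2)[OF 2(1)] unfolding z d'_def by linarith
      qed
    qed
  qed
  define H where "H = exact_sol p (C - rate t0 * t0 + d' + \<mu>) \<gamma> y"
  have H: "H z = k z + d' + \<mu>" for z
    unfolding H_def exact_sol_def F by (simp add: k_def C_def N_def algebra_simps)
  have inTheta: "z \<in> \<Theta>" if "z \<in> closure ?Q \<times> {s1..s2}" for z
  proof -
    have "dist (fst z) x0 \<le> e / 2" "t0 - e / 2 \<le> snd z" "snd z \<le> s2"
      using that clQ by (auto simp: s1_def)
    moreover have "\<bar>snd z - t0\<bar> \<le> e / 2"
      using calculation(2,3) s(3) by linarith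
    ultimately show ?thesis using inT[of "fst z" "snd z"] by simp
  qed
  have cl: "closure (?Q \<times> {s1<..<s2}) = closure ?Q \<times> {s1..s2}"
    using s12 by (simp add: closure_Times)
  have cc: "compactly_contained (?Q \<times> {s1<..<s2}) \<Theta>"
    unfolding compactly_contained_def cl using inTheta by (auto simp: compact_Times compact_closure)
  have "\<forall>z\<in>?Q \<times> {s1<..<s2}. ereal (H z) \<le> u z"
  proof -
    have "\<forall>z\<in>parabolic_boundary ?Q s1 s2. ereal (H z) \<le> u z"
    proof
      fix z assume z: "z \<in> parabolic_boundary ?Q s1 s2"
      then have "z \<in> closure ?Q \<times> {s1..s2}"
        using s12 by (auto simp: parabolic_boundary_def frontier_def)
      from min[OF inTheta[OF this]] gap[OF z]
      show "ereal (H z) \<le> u z"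
        unfolding H by (elim order_trans[rotated]) simp
    qed
    moreover have "p_parabolic p (?Q \<times> {s1<..<s2}) H"
      unfolding H_def by (rule p_parabolic_exact_sol[OF p])
    moreover have "continuous_on (closure (?Q \<times> {s1<..<s2})) H"
      unfolding H_def by (rule continuous_exact_sol[OF p])
    ultimately show ?thesis
      using u abi s12 cc unfolding p_superparabolic_def by blast
  qed
  then have "ereal (H \<zeta>) \<le> u \<zeta>" using ab(1) s by (auto simp: \<zeta>_eq)
  then have "ereal (H \<zeta>) \<le> ereal (\<mu> - w \<zeta>)" using contra by (meson not_less order_trans)
  then show False using d' by (simp add: H k_def \<zeta>_eq)
qed

end

section \<open>Regularity\<close>

text \<open>A minimising sequence for u - v, with v = c - 2 e - w, clusters in the closure. At the
  frontier the boundary condition keeps u above v, so the cluster point is interior; there lower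
  semicontinuity yields a minimum, which \<open>no_negative_minimum\<close> excludes. One e pays for
  the boundary inequality, the other for passing from the liminf to values.\<close>

lemma (in barrier_data) upper_class_lower_bound:
  fixes \<Theta> :: "('a \<times> real) set"
  assumes \<Theta>: "open \<Theta>" "bounded \<Theta>" "\<Theta> \<subseteq> cusp p \<beta> K" and e: "e > 0"
    and bd: "\<And>\<zeta>. \<zeta> \<in> frontier \<Theta> \<Longrightarrow> \<forall>\<^sub>F z in at \<zeta> within \<Theta>. f \<zeta> \<ge> c - w z - e"
    and u: "u \<in> upper_class p \<Theta> f" and z0: "z0 \<in> \<Theta>"
  shows "ereal (c - 2 * e - w z0) \<le> u z0"
proof (rule ccontr)
  assume contra: "\<not> ereal (c - 2 * e - w z0) \<le> u z0"
  define v where "v = (\<lambda>z. c - 2 * e - w z)"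
  have sup: "p_superparabolic p \<Theta> u" using u by (simp add: upper_class_def)
  obtain mu where mu: "\<And>\<eta>. \<eta> \<in> \<Theta> \<Longrightarrow> ereal mu \<le> u \<eta>"
    using u by (auto simp: upper_class_def)
  have w0: "w z \<ge> 0" if "z \<in> \<Theta>" for z using barrier_nonneg that \<Theta>(3) by blast
  \<comment> \<open>As u may be infinite, the infimum of u - v is taken over the reals s with u < v
    + s at some point.\<close>
  define S where "S = {s::real. \<exists>z\<in>\<Theta>. u z < ereal (v z + s)}"
  define m where "m = Inf S"
  have bdd: "bdd_below S"
  proof (rule bdd_belowI)
    fix s assume "s \<in> S"
    then obtain z where z: "z \<in> \<Theta>" "u z < ereal (v z + s)" by (auto simp: S_def)
    then have "mu < v z + s" using mu[OF z(1)] by (metis ereal_less_eq(3) not_le order_trans)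
    then show "mu - (c - 2 * e) \<le> s" using w0[OF z(1)] by (simp add: v_def)
  qed
  have 0: "0 \<in> S" using contra z0 by (auto simp: S_def v_def not_le)
  have m_neg: "m < 0"
  proof -
    have "u z0 < ereal (v z0)" using contra by (simp add: v_def not_le)
    then obtain y where y: "u z0 < y" "y < ereal (v z0)" using dense by blast
    moreover have "\<bar>y\<bar> \<noteq> \<infinity>" using y mu[OF z0] by auto
    ultimately obtain y' where "u z0 < ereal y'" "y' < v z0" by (cases y) auto
    then have "y' - v z0 \<in> S" unfolding S_def using z0 by (intro CollectI bexI[of _ z0]) auto
    then have "m \<le> y' - v z0" unfolding m_def using bdd by (rule cInf_lower)
    then show ?thesis using \<open>y' < v z0\<close> by simp
  qed
  have lower: "ereal (v z + m) \<le> u z" if "z \<in> \<Theta>" for z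
  proof (rule ccontr)
    assume "\<not> ereal (v z + m) \<le> u z"
    then have "u z < ereal (v z + m)" by simp
    then obtain y where y: "u z < y" "y < ereal (v z + m)" using dense by blast
    moreover have "\<bar>y\<bar> \<noteq> \<infinity>" using y mu[OF that] by auto
    ultimately obtain y' where y': "u z < ereal y'" "y' < v z + m" by (cases y) auto
    then have "y' - v z \<in> S" unfolding S_def using that by (intro CollectI bexI[of _ z]) auto
    then have "m \<le> y' - v z" unfolding m_def using bdd by (rule cInf_lower)
    then show False using y'(2) by simp
  qed
  have "\<exists>z\<in>\<Theta>. u z < ereal (v z + m + 1 / real (Suc n))" for n
  proof -
    have "Inf S < m + 1 / real (Suc n)" by (simp add: m_def)
    then obtain s where s: "s \<in> S" "s < m + 1 / real (Suc n)"
      using 0 bdd cInf_less_iff[of S] by blast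
    then obtain z where z: "z \<in> \<Theta>" "u z < ereal (v z + s)" by (auto simp: S_def)
    moreover have "ereal (v z + s) \<le> ereal (v z + m + 1 / real (Suc n))" using s(2) by simp
    ultimately show ?thesis by (meson less_le_trans)
  qed
  then obtain X where X: "\<And>n. X n \<in> \<Theta>" "\<And>n. u (X n) < ereal (v (X n) + m + 1 / real (Suc n))"
    by metis
  have "compact (closure \<Theta>)" using \<Theta>(2) by simp
  then obtain \<zeta> \<sigma> where \<zeta>: "\<zeta> \<in> closure \<Theta>" and \<sigma>: "strict_mono (\<sigma> :: nat \<Rightarrow> nat)" and lim: "(X \<circ> \<sigma>) \<longlonglongrightarrow> \<zeta>"
    using X(1) closure_subset[of \<Theta>] unfolding compact_def by (meson subsetD)
  have inv: "(\<lambda>n. 1 / real (Suc (\<sigma> n))) \<longlonglongrightarrow> 0"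
    using LIMSEQ_subseq_LIMSEQ[OF LIMSEQ_inverse_real_of_nat \<sigma>] by (simp add: comp_def inverse_eq_divide)
  \<comment> \<open>Near the cluster point u cannot stay above v + s for any s > m. This is applied
    with s = 0 at the frontier and with s = m + d inside.\<close>
  have key: False if ev: "\<forall>\<^sub>F z in nhds \<zeta>. z \<in> \<Theta> \<longrightarrow> ereal (v z + s) \<le> u z" and s: "m < s" for s
  proof -
    have "\<forall>\<^sub>F n in sequentially. X (\<sigma> n) \<in> \<Theta> \<longrightarrow> ereal (v (X (\<sigma> n)) + s) \<le> u (X (\<sigma> n))"
      using lim ev unfolding comp_def by (rule filterlim_iff[THEN iffD1, rule_format])
    moreover have "\<forall>\<^sub>F n in sequentially. 1 / real (Suc (\<sigma> n)) < s - m"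
      using inv s by (intro order_tendstoD(2)) auto
    ultimately have "\<forall>\<^sub>F n in sequentially. False"
    proof eventually_elim
      case (elim n)
      have "ereal (v (X (\<sigma> n)) + s) < ereal (v (X (\<sigma> n)) + m + 1 / real (Suc (\<sigma> n)))"
        using elim(1) X(1,2)[of "\<sigma> n"] by (meson le_less_trans)
      then show False using elim(2) by simp
    qed
    then show False by simp
  qed
  have \<zeta>\<Theta>: "\<zeta> \<in> \<Theta>"
  proof (rule ccontr)
    assume n: "\<zeta> \<notin> \<Theta>"
    then have fr: "\<zeta> \<in> frontier \<Theta>" using \<zeta> \<Theta>(1) by (simp add: frontier_def interior_open)
    then have "ereal (f \<zeta>) \<le> Liminf (at \<zeta> within \<Theta>) u"
      using u by (auto simp: upper_class_def)
    moreover have "ereal (f \<zeta> - e) < ereal (f \<zeta>)" using e by simp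
    ultimately have "ereal (f \<zeta> - e) < Liminf (at \<zeta> within \<Theta>) u"
      by (rule less_le_trans[rotated])
    then have "\<forall>\<^sub>F z in at \<zeta> within \<Theta>. ereal (f \<zeta> - e) < u z" by (rule less_LiminfD)
    with bd[OF fr] have "\<forall>\<^sub>F z in at \<zeta> within \<Theta>. ereal (v z + 0) \<le> u z"
    proof eventually_elim
      case (elim z)
      have "ereal (v z + 0) \<le> ereal (f \<zeta> - e)" using elim(1) by (simp add: v_def)
      then show ?case using elim(2) by (meson less_imp_le order_trans)
    qed
    then have "\<forall>\<^sub>F z in nhds \<zeta>. z \<in> \<Theta> \<longrightarrow> ereal (v z + 0) \<le> u z"
      unfolding eventually_at_filter by eventually_elim (use n in auto)
    then show False using key m_neg by blast
  qed
  have "u \<zeta> \<le> ereal (v \<zeta> + m)"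
  proof (rule ccontr)
    assume "\<not> u \<zeta> \<le> ereal (v \<zeta> + m)"
    then have "ereal (v \<zeta> + m) < u \<zeta>" by (simp only: not_le)
    then obtain y where y: "ereal (v \<zeta> + m) < y" "y < u \<zeta>" using dense by blast
    then obtain y' where y': "v \<zeta> + m < y'" "ereal y' < u \<zeta>" by (cases y) auto
    define d where "d = (y' - (v \<zeta> + m)) / 2"
    have d: "d > 0" using y'(1) by (simp add: d_def)
    have "u \<zeta> \<le> Liminf (at \<zeta> within \<Theta>) u"
      using sup \<zeta>\<Theta> by (auto simp: p_superparabolic_def lower_semicontinuous_on_def)
    then have "ereal y' < Liminf (at \<zeta> within \<Theta>) u" using y'(2) by (rule less_le_trans[rotated])
    then have "\<forall>\<^sub>F z in at \<zeta> within \<Theta>. ereal y' < u z" by (rule less_LiminfD)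
    then have ev1: "\<forall>\<^sub>F z in nhds \<zeta>. z \<in> \<Theta> \<longrightarrow> ereal y' < u z"
      unfolding eventually_at_filter by eventually_elim (use y'(2) in auto)
    have "continuous_on \<Theta> w"
      using \<Theta>(3) by (intro continuous_on_subset[OF continuous_barrier]) (auto simp: cusp_def)
    then have "isCont w \<zeta>" using \<Theta>(1) \<zeta>\<Theta> by (simp add: continuous_on_eq_continuous_at)
    then have "isCont v \<zeta>" unfolding v_def by (intro continuous_intros)
    then have "(v \<longlongrightarrow> v \<zeta>) (nhds \<zeta>)" by (simp only: isCont_def tendsto_at_iff_tendsto_nhds)
    then have "\<forall>\<^sub>F z in nhds \<zeta>. v z < v \<zeta> + d"
      using d by (intro order_tendstoD(2)) auto
    with ev1 have "\<forall>\<^sub>F z in nhds \<zeta>. z \<in> \<Theta> \<longrightarrow> ereal (v z + (m + d)) \<le> u z"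
    proof eventually_elim
      case (elim z)
      have "ereal (v z + (m + d)) \<le> ereal y'" using elim(2) by (simp add: d_def field_simps)
      then show ?case using elim(1) by (meson less_imp_le order_trans)
    qed
    then show False by (rule key) (use d in simp)
  qed
  moreover have "ereal (v \<zeta> + m) < u \<zeta>"
  proof -
    have "ereal ((c - 2 * e + m) - w \<zeta>) < u \<zeta>"
    proof (rule no_negative_minimum[OF \<Theta>(1,3) sup \<zeta>\<Theta>])
      show "ereal ((c - 2 * e + m) - w z) \<le> u z" if "z \<in> \<Theta>" for z
        using lower[OF that] by (simp add: v_def algebra_simps)
    qed
    then show ?thesis by (simp add: v_def algebra_simps)
  qed
  ultimately show False by simp
qed

text \<open>With B = 2 x the requirement follows from 2 K s < x^(p - 2), because p/(p - 1) > 1 and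
  the dimension is at least 1. Since p > 2, the right side is unbounded in x.\<close>

lemma barrier_size_exists:
  fixes p \<beta> K B0 :: real
  assumes p: "p > 2" and K: "K > 0" and \<beta>: "0 < \<beta>" "\<beta> < 1"
  shows "\<exists>B>0. B \<ge> B0 \<and> barrier_data TYPE('a::euclidean_space) p \<beta> K B"
proof -
  define s where "s = 2 * \<beta> + (1 - \<beta>) / (p - 1)"
  have s: "s > 0" unfolding s_def using p \<beta> by (intro add_pos_pos divide_pos_pos) auto
  define x where "x = max (B0 / 2) ((2 * K * s + 1) powr (1 / (p - 2)))"
  have Ks: "2 * K * s > 0" using K s by simp
  have "(2 * K * s + 1) powr (1 / (p - 2)) > 0" using Ks by simp
  then have x: "x > 0" by (simp add: x_def less_max_iff_disj)
  have "2 * K * s + 1 = ((2 * K * s + 1) powr (1 / (p - 2))) powr (p - 2)"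
    using p Ks by (simp add: powr_powr)
  also have "\<dots> \<le> x powr (p - 2)"
    using p by (intro powr_mono2) (auto simp: x_def)
  finally have "2 * K * s < x powr (p - 2)" by simp
  then have "x * (2 * K * s) < x * x powr (p - 2)"
    using x by (intro mult_strict_left_mono)
  also have "\<dots> = x powr (p - 1)"
    using powr_mult_base[of x "p - 2"] x by simp
  also have "\<dots> \<le> (p / (p - 1) * x) powr (p - 1)"
  proof (intro powr_mono2)
    have "1 * x \<le> p / (p - 1) * x" using exponent_gt_1[OF p] x by (intro mult_right_mono) auto
    then show "x \<le> p / (p - 1) * x" by simp
  qed (use p x in auto)
  also have "\<dots> \<le> real DIM('a) * (p / (p - 1) * x) powr (p - 1)"
  proof -
    have "1 * (p / (p - 1) * x) powr (p - 1) \<le> real DIM('a) * (p / (p - 1) * x) powr (p - 1)"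
      using DIM_positive[where 'a='a] by (intro mult_right_mono) auto
    then show ?thesis by simp
  qed
  finally have "2 * x * K * s < real DIM('a) * (p / (p - 1) * (2 * x / 2)) powr (p - 1)"
    by (simp add: mult_ac)
  then have "barrier_data TYPE('a) p \<beta> K (2 * x)"
    using p K \<beta> x unfolding s_def by unfold_locales auto
  moreover have "2 * x \<ge> B0" by (simp add: x_def)
  ultimately show ?thesis using x by (intro exI[of _ "2 * x"]) auto
qed

text \<open>Near the origin the boundary values are within e of f(0,0). Farther away the narrowing
  of the cusp keeps -t bounded below, and a large B lifts w above 2 M, a bound for the oscillation
  of f. For this fixed B the barrier is still smaller than e close to the origin.\<close>

theorem cusp_regular:
  fixes \<Theta> :: "('a::euclidean_space \<times> real) set"
  assumes p: "p > 2" and K: "K > 0" and \<beta>: "0 < \<beta>" "\<beta> < 1"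
    and \<Theta>: "open \<Theta>" "bounded \<Theta>" "\<Theta> \<subseteq> cusp p \<beta> K" and origin: "(0, 0) \<in> frontier \<Theta>"
  shows "regular_point p \<Theta> (0, 0)"
  unfolding regular_point_def
proof (intro conjI origin allI impI)
  fix f :: "'a \<times> real \<Rightarrow> real" assume f: "continuous_on (frontier \<Theta>) f"
  let ?o = "(0, 0) :: 'a \<times> real"
  let ?q = "p / (p - 1)" and ?\<theta> = "(1 + \<beta> * (p - 2)) / (p - 1)"
  have \<theta>: "?\<theta> > 0" using p \<beta> by (intro divide_pos_pos add_pos_pos mult_pos_pos) auto
  have q: "?q > 1" using exponent_gt_1[OF p] .
  have comp: "compact (frontier \<Theta>)" using \<Theta>(2) by (simp add: compact_frontier_bounded)
  then obtain M where M: "\<And>\<zeta>. \<zeta> \<in> frontier \<Theta> \<Longrightarrow> \<bar>f \<zeta>\<bar> \<le> M"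
    using compact_imp_bounded[OF compact_continuous_image[OF f]]
    by (metis (no_types, lifting) bounded_iff imageI real_norm_def)
  have main: "\<forall>\<^sub>F z in at ?o within \<Theta>. ereal (f ?o - 3 * e) \<le> upper_perron p \<Theta> f z \<and>
      upper_perron p \<Theta> f z \<le> ereal (f ?o + 3 * e)" if e: "e > 0" for e
  proof -
    obtain \<delta> where \<delta>: "\<delta> > 0" "\<And>\<zeta>. \<zeta> \<in> frontier \<Theta> \<Longrightarrow> dist \<zeta> ?o < \<delta> \<Longrightarrow> \<bar>f \<zeta> - f ?o\<bar> < e"
      using f origin e unfolding continuous_on_iff dist_real_def by meson
    have "((\<lambda>\<tau>::real. (K * \<tau> powr ?\<theta>) powr (1 / ?q) + \<tau>) \<longlongrightarrow> (K * 0 powr ?\<theta>) powr (1 / ?q) + 0) (at_right 0)"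
      using \<theta> p K by (intro tendsto_intros tendsto_powr') (auto simp: eventually_at_right_field intro!: exI[of _ 1])
    then have "((\<lambda>\<tau>::real. (K * \<tau> powr ?\<theta>) powr (1 / ?q) + \<tau>) \<longlongrightarrow> 0) (at_right 0)" by simp
    then have "\<forall>\<^sub>F \<tau> in at_right 0. (K * \<tau> powr ?\<theta>) powr (1 / ?q) + \<tau> < \<delta> / 2"
      using \<delta>(1) by (intro order_tendstoD(2)) auto
    then obtain \<eta> where \<eta>: "\<eta> > 0" "\<And>\<tau>. 0 < \<tau> \<Longrightarrow> \<tau> < \<eta> \<Longrightarrow> (K * \<tau> powr ?\<theta>) powr (1 / ?q) + \<tau> < \<delta> / 2"
      unfolding eventually_at_right_field by auto
    have far: "- snd z \<ge> \<eta>" if "z \<in> \<Theta>" "norm z \<ge> \<delta> / 2" for z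
    proof (rule ccontr)
      assume c: "\<not> - snd z \<ge> \<eta>"
      have z: "snd z < 0" "norm (fst z) powr ?q \<le> K * (- snd z) powr ?\<theta>"
        using that(1) \<Theta>(3) by (auto simp: cusp_def)
      have "norm (fst z) = (norm (fst z) powr ?q) powr (1 / ?q)"
        using p by (simp add: powr_powr)
      also have "\<dots> \<le> (K * (- snd z) powr ?\<theta>) powr (1 / ?q)"
        using z(2) p by (intro powr_mono2) auto
      finally have "norm (fst z) + norm (snd z) < \<delta> / 2"
        using \<eta>(2)[of "- snd z"] z(1) c by simp
      moreover have "norm z \<le> norm (fst z) + norm (snd z)"
        unfolding norm_prod_def by (rule sqrt_sum_squares_le_sum) simp_all
      ultimately show False using that(2) by simp
    qed
    obtain B where size: "B \<ge> 2 * M / (K * \<eta> powr \<beta>)" "barrier_data TYPE('a) p \<beta> K B"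
      using barrier_size_exists[OF p K \<beta>] by blast
    interpret barrier_data p \<beta> K B "TYPE('a)" by (rule size(2))
    have wfar: "2 * M \<le> w z" if "z \<in> \<Theta>" "norm z \<ge> \<delta> / 2" for z
    proof -
      have "2 * M \<le> B * (K * \<eta> powr \<beta>)"
        using size(1) K \<eta>(1) by (simp add: divide_le_eq)
      also have "\<dots> \<le> B * (K * (- snd z) powr \<beta>)"
        using far[OF that] \<eta>(1) \<beta> B K by (intro mult_left_mono powr_mono2) auto
      also have "\<dots> \<le> w z" using barrier_ge[of z] that(1) \<Theta>(3) by (auto simp: mult.assoc)
      finally show ?thesis .
    qed
    have bd: "\<forall>\<^sub>F z in at \<zeta> within \<Theta>. \<bar>f \<zeta> - f ?o\<bar> \<le> w z + e" if \<zeta>: "\<zeta> \<in> frontier \<Theta>" for \<zeta>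
    proof (cases "dist \<zeta> ?o < \<delta>")
      case True
      have "\<bar>f \<zeta> - f ?o\<bar> \<le> w z + e" if "z \<in> \<Theta>" for z
        using \<delta>(2)[OF \<zeta> True] barrier_nonneg[of z] that \<Theta>(3) by fastforce
      then show ?thesis by (auto simp: eventually_at_filter)
    next
      case False
      \<comment> \<open>Half of \<delta> leaves room: points of \<Theta> near \<zeta> stay farther
        than \<delta>/2 from the origin, where w \<ge> 2 M.\<close>
      then have "norm \<zeta> > \<delta> / 2" using \<delta>(1) by (simp add: zero_prod_def[symmetric])
      then have "\<forall>\<^sub>F z in nhds \<zeta>. norm z > \<delta> / 2"
        by (intro order_tendstoD(1)[of norm "norm \<zeta>"] tendsto_norm filterlim_ident)
      then have "\<forall>\<^sub>F z in at \<zeta> within \<Theta>. z \<in> \<Theta> \<and> norm z > \<delta> / 2"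
        unfolding eventually_at_filter by eventually_elim auto
      then show ?thesis
      proof eventually_elim
        case (elim z)
        then show ?case using wfar[of z] M[OF \<zeta>] M[OF origin] e by auto
      qed
    qed
    have up: "upper_perron p \<Theta> f z \<le> ereal (f ?o + e + w z)" if "z \<in> \<Theta>" for z
    proof -
      have "(\<lambda>z. ereal (f ?o + e + w z)) \<in> upper_class p \<Theta> f"
        unfolding upper_class_def
      proof (intro CollectI conjI ballI)
        show "p_superparabolic p \<Theta> (\<lambda>z. ereal (f ?o + e + w z))"
          by (rule barrier_superparabolic[OF \<Theta>(1,3)])
        show "\<exists>m. \<forall>\<eta>\<in>\<Theta>. ereal m \<le> ereal (f ?o + e + w \<eta>)"
          using barrier_nonneg \<Theta>(3) by (intro exI[of _ "f ?o + e"]) auto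
        fix \<zeta> assume "\<zeta> \<in> frontier \<Theta>"
        from bd[OF this] have "\<forall>\<^sub>F z in at \<zeta> within \<Theta>. ereal (f \<zeta>) \<le> ereal (f ?o + e + w z)"
          by eventually_elim (simp add: abs_le_iff)
        then show "ereal (f \<zeta>) \<le> Liminf (at \<zeta> within \<Theta>) (\<lambda>z. ereal (f ?o + e + w z))"
          by (rule Liminf_bounded)
      qed
      then show ?thesis unfolding upper_perron_def by (rule INF_lower)
    qed
    have low: "ereal (f ?o - 2 * e - w z) \<le> upper_perron p \<Theta> f z" if "z \<in> \<Theta>" for z
      unfolding upper_perron_def
    proof (rule INF_greatest)
      fix u assume u: "u \<in> upper_class p \<Theta> f"
      have "\<forall>\<^sub>F z in at \<zeta> within \<Theta>. f ?o - w z - e \<le> f \<zeta>" if "\<zeta> \<in> frontier \<Theta>" for \<zeta>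
        using bd[OF that] by eventually_elim (simp add: abs_le_iff)
      then show "ereal (f ?o - 2 * e - w z) \<le> u z"
        by (rule upper_class_lower_bound[OF \<Theta> e _ u that])
    qed
    have "((\<lambda>z::'a \<times> real. 2 * B * K * \<bar>snd z\<bar> powr \<beta>) \<longlongrightarrow> 2 * B * K * \<bar>snd ?o\<bar> powr \<beta>) (at ?o within \<Theta>)"
      using \<beta> by (intro tendsto_intros tendsto_powr') auto
    then have "\<forall>\<^sub>F z in at ?o within \<Theta>. 2 * B * K * \<bar>snd z\<bar> powr \<beta> < e"
      using e by (intro order_tendstoD(2)) auto
    moreover have "\<forall>\<^sub>F z in at ?o within \<Theta>. z \<in> \<Theta>" by (simp add: eventually_at_filter)
    ultimately show ?thesis
    proof eventually_elim
      case (elim z)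
      then have "snd z < 0" using \<Theta>(3) by (auto simp: cusp_def)
      then have w: "w z < e" using barrier_le[of z] elim(1) by simp
      have "ereal (f ?o - 3 * e) \<le> ereal (f ?o - 2 * e - w z)" "ereal (f ?o + e + w z) \<le> ereal (f ?o + 3 * e)"
        using w e by auto
      then show ?case using up[OF elim(2)] low[OF elim(2)] by (meson order_trans)
    qed
  qed
  show "(upper_perron p \<Theta> f \<longlongrightarrow> ereal (f ?o)) (at ?o within \<Theta>)"
  proof (rule order_tendstoI)
    fix y assume "y < ereal (f ?o)"
    then obtain y' where y': "y < ereal y'" "y' < f ?o" using ereal_dense2 by force
    have "(f ?o - y') / 3 > 0" "f ?o - 3 * ((f ?o - y') / 3) = y'" using y'(2) by (simp_all add: field_simps)
    from main[OF this(1), unfolded this(2)] show "\<forall>\<^sub>F z in at ?o within \<Theta>. y < upper_perron p \<Theta> f z"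
      by eventually_elim (meson less_le_trans y'(1))
  next
    fix y assume "ereal (f ?o) < y"
    then obtain y' where y': "ereal y' < y" "f ?o < y'" using ereal_dense2 by force
    have "(y' - f ?o) / 3 > 0" "f ?o + 3 * ((y' - f ?o) / 3) = y'" using y'(2) by (simp_all add: field_simps)
    from main[OF this(1), unfolded this(2)] show "\<forall>\<^sub>F z in at ?o within \<Theta>. upper_perron p \<Theta> f z < y"
      by eventually_elim (meson le_less_trans y'(1))
  qed
qed

text \<open>
  The power of the logarithm is absorbed by giving up part of the exponent
  \<open>n (p - 2)\<^sup>2 / (l (p - 1))\<close> by which the domain is thinner than the critical \<open>(-t)\<^bsup>1/(p-1)\<^esup>\<close>.
\<close>

theorem proposition6p1:
  fixes p K \<alpha> l :: real
    and h :: "real \<Rightarrow> real"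
    and \<Theta> :: "((real ^ 'n) \<times> real) set"
  assumes "p > 2" and "K > 0" and "\<alpha> > 0"
    and "l = real CARD('n) * (p - 2) + p"
    and "\<And>t. h t = (\<bar>ln (- t)\<bar> powr (p - 2) - 1) / (p - 2)"
    and "\<Theta> = {(x, t). - 1 / (2 * exp 1) < t \<and> t < 0 \<and>
                (norm x / (- t) powr (1 / l)) powr (p / (p - 1))
                  < K * (- t) powr (real CARD('n) * (p - 2) / l) * h t powr (\<alpha> * (p - 2))}"
  shows "regular_point p \<Theta> (0, 0)"
proof -
  note p = assms(1) and K = assms(2) and \<alpha> = assms(3) and h = assms(5) and \<Theta> = assms(6)
  define n where "n = real CARD('n)"
  have n: "n > 0" by (simp add: n_def)
  have l: "l > 0" "l = n * (p - 2) + p" using assms(4) n p by (auto simp: n_def add_pos_pos)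
  \<comment> \<open>The exponent p/((p-1) l) + n(p-2)/l of -t in the domain exceeds 1/(p-1) by
    n(p-2)^2/(l(p-1)). Half of the excess is \<kappa>, spent on the logarithm; the other half has to
    be \<beta>(p-2)/(p-1), which determines \<beta>.\<close>
  define \<beta> where "\<beta> = n * (p - 2) / (2 * l)"
  have \<beta>: "0 < \<beta>" "\<beta> < 1" using n p l by (auto simp: \<beta>_def divide_less_eq)
  define \<kappa> where "\<kappa> = n * (p - 2)\<^sup>2 / (2 * l * (p - 1))"
  have \<kappa>: "\<kappa> > 0" using n p l by (simp add: \<kappa>_def)
  have exps: "p / (p - 1) * (1 / l) + n * (p - 2) / l - \<kappa> = (1 + \<beta> * (p - 2)) / (p - 1)"
  proof -
    have "(p + n * (p - 2) * (p - 1)) * 2 - n * (p - 2)\<^sup>2 = 2 * l + n * (p - 2) * (p - 2)"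
      unfolding l(2) by (simp add: algebra_simps power2_eq_square)
    then have "((p + n * (p - 2) * (p - 1)) * 2 - n * (p - 2)\<^sup>2) / (2 * l * (p - 1)) =
        (2 * l + n * (p - 2) * (p - 2)) / (2 * l * (p - 1))" by simp
    moreover have "p / (p - 1) * (1 / l) + n * (p - 2) / l - \<kappa> =
        ((p + n * (p - 2) * (p - 1)) * 2 - n * (p - 2)\<^sup>2) / (2 * l * (p - 1))"
      using l(1) p unfolding \<kappa>_def by (simp add: divide_simps) (simp add: algebra_simps)
    moreover have "(1 + \<beta> * (p - 2)) / (p - 1) = (2 * l + n * (p - 2) * (p - 2)) / (2 * l * (p - 1))"
      using l(1) p unfolding \<beta>_def by (simp add: divide_simps)
    ultimately show ?thesis by simp
  qed
  have small: "1 / (2 * exp 1) < (1::real)"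
  proof -
    have "(1::real) < exp 1" by simp
    then have "1 < 2 * exp (1::real)" by linarith
    then show ?thesis by (simp add: divide_less_eq)
  qed
  \<comment> \<open>Since 1/(2 exp 1) < exp(-1), the logarithm exceeds 1 in absolute value, so the
    base h(t) of the real power is positive.\<close>
  have lnpos: "\<bar>ln (- t)\<bar> > 1" if "- 1 / (2 * exp 1) < t" "t < 0" for t :: real
  proof -
    have "- t < 1 / (2 * exp 1)" using that by simp
    also have "\<dots> < exp (- 1)" by (simp add: exp_minus field_simps)
    finally have "ln (- t) < -1" using that by (metis exp_gt_zero ln_exp ln_less_cancel_iff neg_0_less_iff_less)
    then show ?thesis by simp
  qed
  have hpos: "h t > 0" if "- 1 / (2 * exp 1) < t" "t < 0" for t
    using lnpos[OF that] p unfolding h by (simp add: gr_one_powr)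
  \<comment> \<open>Chosen so that the bound |ln s| \<le> s^(-e)/e, raised to the powers p - 2 and
    \<alpha>(p - 2) in turn, loses exactly the power \<kappa> of -t.\<close>
  define e where "e = \<kappa> / ((p - 2) * (\<alpha> * (p - 2)))"
  have e: "e > 0" using \<kappa> \<alpha> p by (simp add: e_def)
  define C where "C = (((1 / e) powr (p - 2)) / (p - 2)) powr (\<alpha> * (p - 2))"
  have C: "C > 0" using e p by (simp add: C_def)
  have hle: "h t powr (\<alpha> * (p - 2)) \<le> C * (- t) powr (- \<kappa>)" if t: "- 1 / (2 * exp 1) < t" "t < 0" for t
  proof -
    have t1: "- t < 1"
    proof -
      have "- t < 1 / (2 * exp 1)" using t by simp
      also have "\<dots> < 1" by (rule small)
      finally show ?thesis .
    qed
    have log: "\<bar>ln s\<bar> \<le> (1 / e) * s powr (- e)" if "0 < s" "s < 1" for s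
    proof -
      have "\<bar>ln s\<bar> = ln (1 / s)" using that by (simp add: ln_div)
      also have "\<dots> \<le> (1 / s) powr e / e"
        using that e by (intro ln_powr_bound) auto
      also have "\<dots> = (1 / e) * s powr (- e)"
        using that by (simp add: powr_minus powr_divide field_simps)
      finally show ?thesis .
    qed
    have "\<bar>ln (- t)\<bar> \<le> (1 / e) * (- t) powr (- e)"
      using t t1 by (intro log) auto
    then have "\<bar>ln (- t)\<bar> powr (p - 2) \<le> ((1 / e) * (- t) powr (- e)) powr (p - 2)"
      using p by (intro powr_mono2) auto
    also have "\<dots> = (1 / e) powr (p - 2) * (- t) powr (- e * (p - 2))"
      by (simp only: powr_mult powr_powr)
    finally have "h t \<le> ((1 / e) powr (p - 2) * (- t) powr (- e * (p - 2))) / (p - 2)"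
      unfolding h using p by (intro divide_right_mono) auto
    then have "h t \<le> ((1 / e) powr (p - 2)) / (p - 2) * (- t) powr (- e * (p - 2))" by simp
    then have "h t powr (\<alpha> * (p - 2)) \<le> (((1 / e) powr (p - 2)) / (p - 2) * (- t) powr (- e * (p - 2))) powr (\<alpha> * (p - 2))"
      using hpos[OF t] \<alpha> p by (intro powr_mono2) auto
    also have "\<dots> = C * (- t) powr ((- e * (p - 2)) * (\<alpha> * (p - 2)))"
      unfolding C_def by (simp only: powr_mult powr_powr)
    also have "(- e * (p - 2)) * (\<alpha> * (p - 2)) = - \<kappa>"
    proof -
      have "(p - 2) * (\<alpha> * (p - 2)) \<noteq> 0" using \<alpha> p by simp
      then have "e * ((p - 2) * (\<alpha> * (p - 2))) = \<kappa>"
        unfolding e_def times_divide_eq_left by (rule nonzero_mult_div_cancel_right)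
      then show ?thesis by (simp only: mult_minus_left mult.assoc)
    qed
    finally show ?thesis .
  qed
  have sub: "\<Theta> \<subseteq> cusp p \<beta> (K * C)"
  proof
    fix z assume "z \<in> \<Theta>"
    then obtain x t where z: "z = (x, t)" and t: "- 1 / (2 * exp 1) < t" "t < 0"
      and lt: "(norm x / (- t) powr (1 / l)) powr (p / (p - 1)) < K * (- t) powr (n * (p - 2) / l) * h t powr (\<alpha> * (p - 2))"
      unfolding \<Theta> n_def by blast
    have "norm x powr (p / (p - 1)) = (norm x / (- t) powr (1 / l)) powr (p / (p - 1)) * ((- t) powr (1 / l)) powr (p / (p - 1))"
      using t by (simp add: powr_divide)
    also have "\<dots> \<le> (K * (- t) powr (n * (p - 2) / l) * (C * (- t) powr (- \<kappa>))) * ((- t) powr (1 / l)) powr (p / (p - 1))"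
      using lt hle[OF t] K by (intro mult_right_mono order_trans[OF less_imp_le[OF lt]] mult_left_mono) auto
    also have "((- t) powr (1 / l)) powr (p / (p - 1)) = (- t) powr (p / (p - 1) * (1 / l))"
      by (simp add: powr_powr mult.commute)
    also have "(K * (- t) powr (n * (p - 2) / l) * (C * (- t) powr (- \<kappa>))) * (- t) powr (p / (p - 1) * (1 / l)) =
        K * C * (- t) powr (p / (p - 1) * (1 / l) + n * (p - 2) / l - \<kappa>)"
      unfolding diff_conv_add_uminus powr_add by (simp only: mult_ac)
    finally show "z \<in> cusp p \<beta> (K * C)"
      using t unfolding exps by (simp add: z cusp_def)
  qed
  have op: "open \<Theta>"
  proof -
    define S where "S = {z :: (real ^ 'n) \<times> real. - 1 / (2 * exp 1) < snd z \<and> snd z < 0}"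
    have S: "open S" unfolding S_def by (intro open_Collect_conj open_Collect_less continuous_intros)
    have ch: "continuous_on S (\<lambda>z. h (snd z) powr (\<alpha> * (p - 2)))"
    proof (rule continuous_on_powr)
      show "continuous_on S (\<lambda>z. h (snd z))"
        unfolding h by (intro continuous_intros continuous_on_powr') (use lnpos p in \<open>auto simp: S_def\<close>)
      show "\<forall>z\<in>S. h (snd z) \<noteq> 0" using hpos by (force simp: S_def)
    qed (intro continuous_intros)
    have c1: "continuous_on S (\<lambda>z. (norm (fst z) / (- snd z) powr (1 / l)) powr (p / (p - 1)))"
      using p l by (intro continuous_on_powr' continuous_intros) (auto simp: S_def)
    have c2: "continuous_on S (\<lambda>z. K * (- snd z) powr (n * (p - 2) / l) * h (snd z) powr (\<alpha> * (p - 2)))"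
      by (intro continuous_intros ch) (auto simp: S_def)
    let ?F = "\<lambda>z. K * (- snd z) powr (n * (p - 2) / l) * h (snd z) powr (\<alpha> * (p - 2)) - (norm (fst z) / (- snd z) powr (1 / l)) powr (p / (p - 1))"
    have "open (S \<inter> ?F -` {0<..})"
      by (intro continuous_open_preimage[OF _ S] continuous_on_diff c1 c2) auto
    moreover have "S \<inter> ?F -` {0<..} = \<Theta>" unfolding \<Theta> S_def n_def by auto
    ultimately show ?thesis by simp
  qed
  have bd: "bounded \<Theta>"
  proof -
    let ?R = "(K * C * 1 powr ((1 + \<beta> * (p - 2)) / (p - 1))) powr ((p - 1) / p)"
    have "\<Theta> \<subseteq> cball 0 ?R \<times> {-1..0}"
    proof
      fix z assume z: "z \<in> \<Theta>"
      then have t: "- 1 / (2 * exp 1) < snd z" "snd z < 0" unfolding \<Theta> by auto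
      have t1: "- snd z \<le> 1" using t(1) small unfolding minus_divide_left[symmetric] by linarith
      have "norm (fst z) powr (p / (p - 1)) \<le> K * C * (- snd z) powr ((1 + \<beta> * (p - 2)) / (p - 1))"
        using sub z by (auto simp: cusp_def)
      also have "\<dots> \<le> K * C * 1 powr ((1 + \<beta> * (p - 2)) / (p - 1))"
        using t t1 K C p \<beta> by (intro mult_left_mono powr_mono2) auto
      finally have "(norm (fst z) powr (p / (p - 1))) powr ((p - 1) / p) \<le> ?R"
        using p by (intro powr_mono2) auto
      then have "norm (fst z) \<le> ?R" using p by (simp add: powr_powr)
      then show "z \<in> cball 0 ?R \<times> {-1..0}" using t t1 by (cases z) auto
    qed
    moreover have "bounded (cball (0 :: real ^ 'n) ?R \<times> {-1..(0::real)})" by (intro bounded_Times) auto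
    ultimately show ?thesis by (rule bounded_subset[rotated])
  qed
  have "(0, 0) \<in> frontier \<Theta>"
  proof -
    have "(0, 0) \<notin> \<Theta>" unfolding \<Theta> by simp
    moreover have "((0 :: real ^ 'n), 0) \<in> closure \<Theta>"
      unfolding closure_approachable
    proof (intro allI impI)
      fix \<epsilon> :: real assume \<epsilon>: "\<epsilon> > 0"
      \<comment> \<open>On the axis the left side of the defining inequality is 0 and the right side
        is positive; 1/(4 exp 1) keeps t above the lower time limit.\<close>
      define t where "t = - min (\<epsilon> / 2) (1 / (4 * exp 1))"
      have t: "- 1 / (2 * exp 1) < t" "t < 0"
        using \<epsilon> by (auto simp: t_def min_less_iff_disj divide_strict_left_mono)
      have "(0, t) \<in> \<Theta>"
        unfolding \<Theta> using t K hpos[OF t] p by simp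
      moreover have "dist (0, t) ((0 :: real ^ 'n), 0) < \<epsilon>"
        using \<epsilon> t by (simp add: dist_Pair_Pair t_def)
      ultimately show "\<exists>y\<in>\<Theta>. dist y (0, 0) < \<epsilon>" by blast
    qed
    ultimately show ?thesis using op by (simp add: frontier_def interior_open)
  qed
  then show ?thesis
    using cusp_regular[OF p _ \<beta> op bd sub] K C by simp
qed

end
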